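(* Let $m$ be a positive integer, let $\mathcal{A}=\{0,1,2,\ldots,m-1\}$, let $\mu_0$ be given by $\mu_0(\{j\})=1/m$ for each $j\in\mathcal{A}$, and let $(\Omega_m,T,\mu)$ be the full shift generated by $(\mathcal{A},\mu_0)$. Write $\mathfrak{S}_0=\mathfrak{S}_0(\Omega_m,T,\mu)$. Then: (a) There is a dense $G_\delta$ set $\mathcal{G}\subseteq C(\Omega_m,\mathbb{R})$ (with respect to the uniform topology) such that for each $\mathfrak{q}\in\mathcal{G}$ and every $\ell\in\mathfrak{S}_0$ there exists $\lambda_0(\mathfrak{q},\ell)$ such that $\lambda\mathfrak{q}\in\mathrm{OG}_{\mathrm{Schr}}(\ell)$ for all $\lambda\ge\lambda_0(\mathfrak{q},\ell)$. (b) $\mathrm{OG}_{\mathrm{Schr}}(\ell)\neq\emptyset$ for all $\ell\in\mathfrak{S}_0$. (c) $\mathrm{AGO}_{\mathrm{diag}}\neq\emptyset$ and $\mathrm{AGO}_{\mathrm{Jacobi}}\neq\emptyset$.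
   Context: Full shift: for compact $\mathcal{A}\subseteq\mathbb{R}$ and a Borel probability measure $\mu_0$ with $\operatorname{supp}\mu_0=\mathcal{A}$, the full shift generated by $(\mathcal{A},\mu_0)$ is $(\Omega,T,\mu)$ with $\Omega=\mathcal{A}^{\mathbb{Z}}$ (product topology), $[T\omega]_n=\omega_{n+1}$, $\mu=\mu_0^{\mathbb{Z}}$. Operators: for continuous $\mathfrak{q}:\Omega\to\mathbb{R}$ and $\mathfrak{p}:\Omega\to\mathbb{R}_{\ge0}$, the Jacobi matrices $J_\omega=J_{\mathfrak{q},\mathfrak{p},\omega}$ act on $\ell^2(\mathbb{Z})$ by $[J_\omega\psi](n)=\mathfrak{p}(T^{n-1}\omega)\psi(n-1)+\mathfrak{q}(T^n\omega)\psi(n)+\mathfrak{p}(T^n\omega)\psi(n+1)$. There is a compact set $\Sigma_{\mathfrak{q},\mathfrak{p}}\subseteq\mathbb{R}$ (the almost-sure spectrum) with $\sigma(J_{\mathfrak{q},\mathfrak{p},\omega})=\Sigma_{\mathfrak{q},\mathfrak{p}}$ for $\mu$-a.e. $\omega$. The density of states measure $\kappa$ is defined by $\int h\,d\kappa=\int_\Omega\langle\delta_0,h(J_\omega)\delta_0\rangle\,d\mu(\omega)$ for $h\in C(\mathbb{R})$, and the integrated density of states is $k_{\mathfrak{q},\mathfrak{p}}(E)=\kappa((-\infty,E])$. Schwartzman group: the suspension $(X,\tau,\nu)$ of $(\Omega,T,\mu)$ is $X=(\Omega\times\mathbb{R})/\!\sim$ with $(T^n\omega,t)\sim(\omega,t+n)$,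 $\tau^s([\omega,t])=[\omega,s+t]$, $\int_X f\,d\nu=\int_\Omega\int_0^1 f([\omega,t])\,dt\,d\mu(\omega)$. For continuous $\phi:X\to\mathbb{T}=\mathbb{R}/\mathbb{Z}$ and $x\in X$, let $\widetilde\phi_x:\mathbb{R}\to\mathbb{R}$ be a continuous lift of $t\mapsto\phi(\tau^tx)$; $\lim_{t\to\infty}\widetilde\phi_x(t)/t$ exists for $\nu$-a.e. $x$, is a.e. constant and depends only on the homotopy class of $\phi$; call the value $\mathfrak{A}_\nu(\phi)$. The Schwartzman group $\mathfrak{S}(\Omega,T,\mu)\subseteq\mathbb{R}$ is the set of all values $\mathfrak{A}_\nu(\phi)$, and $\mathfrak{S}_0(\Omega,T,\mu)=\mathfrak{S}(\Omega,T,\mu)\cap(0,1)$. Gaps: for $\ell\in\mathfrak{S}_0$, $\Sigma_{\mathfrak{q},\mathfrak{p}}$ has an open gap with label $\ell$ if there is a bounded connected component $I$ of $\mathbb{R}\setminus\Sigma_{\mathfrak{q},\mathfrak{p}}$ with $k_{\mathfrak{q},\mathfrak{p}}(E)=\ell$ for $E\in I$. $\mathrm{OG}_{\mathrm{Jacobi}}(\ell)$ is the set of $(\mathfrak{q},\mathfrak{p})\in C(\Omega,\mathbb{R})\times C(\Omega,\mathbb{R}_{\ge0})$ such that $\Sigma_{\mathfrak{q},\mathfrak{p}}$ has an open gap with label $\ell$; $\mathrm{OG}_{\mathrm{Schr}}(\ell)=\{\mathfrak{q}\in C(\Omega,\mathbb{R}):(\mathfrak{q},1)\in\mathrm{OG}_{\mathrm{Jacobi}}(\ell)\}$;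 $\mathrm{OG}_{\mathrm{diag}}(\ell)=\{\mathfrak{q}\in C(\Omega,\mathbb{R}):(\mathfrak{q},0)\in\mathrm{OG}_{\mathrm{Jacobi}}(\ell)\}$. For $\bullet\in\{\mathrm{Jacobi},\mathrm{Schr},\mathrm{diag}\}$, $\mathrm{AGO}_\bullet=\bigcap_{\ell\in\mathfrak{S}_0}\mathrm{OG}_\bullet(\ell)$ (an empty intersection being the whole ambient function space). *)

theory Defs
  imports "HOL-Probability.Probability" "HOL-Computational_Algebra.Polynomial"
begin

section \<open>The complex Hilbert space of square-summable two-sided sequences\<close>

typedef ell2 = "{\<psi> :: int \<Rightarrow> complex. (\<lambda>n. (cmod (\<psi> n))\<^sup>2) summable_on UNIV}"
  morphisms entry Abs_ell2
  by (rule exI[of _ "\<lambda>_. 0"]) simp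

setup_lifting type_definition_ell2

lemma ell2_eqI: "(\<And>n. entry \<phi> n = entry \<psi> n) \<Longrightarrow> \<phi> = \<psi>"
  by (metis entry_inject ext)

lemma square_summable_add:
  fixes f g :: "int \<Rightarrow> complex"
  assumes "(\<lambda>n. (cmod (f n))\<^sup>2) summable_on UNIV" "(\<lambda>n. (cmod (g n))\<^sup>2) summable_on UNIV"
  shows "(\<lambda>n. (cmod (f n + g n))\<^sup>2) summable_on UNIV"
proof (rule summable_on_comparison_test)
  show "(\<lambda>n. 2 * (cmod (f n))\<^sup>2 + 2 * (cmod (g n))\<^sup>2) summable_on UNIV"
    by (intro summable_on_add summable_on_cmult_right assms)
  fix n
  have "(cmod (f n + g n))\<^sup>2 \<le> (cmod (f n) + cmod (g n))\<^sup>2"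
    by (intro power_mono norm_triangle_ineq) simp
  also have "\<dots> \<le> 2 * (cmod (f n))\<^sup>2 + 2 * (cmod (g n))\<^sup>2"
    using sum_squares_bound[of "cmod (f n)" "cmod (g n)"] by (simp add: power2_sum)
  finally show "(cmod (f n + g n))\<^sup>2 \<le> 2 * (cmod (f n))\<^sup>2 + 2 * (cmod (g n))\<^sup>2" .
qed auto

lemma square_summable_mult_bounded:
  fixes c f :: "int \<Rightarrow> complex"
  assumes "(\<lambda>n. (cmod (f n))\<^sup>2) summable_on UNIV" and "\<And>n. cmod (c n) \<le> C"
  shows "(\<lambda>n. (cmod (c n * f n))\<^sup>2) summable_on UNIV"
proof (rule summable_on_comparison_test)
  show "(\<lambda>n. C\<^sup>2 * (cmod (f n))\<^sup>2) summable_on UNIV"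
    by (intro summable_on_cmult_right assms)
  fix n
  show "(cmod (c n * f n))\<^sup>2 \<le> C\<^sup>2 * (cmod (f n))\<^sup>2"
    by (auto simp: norm_mult power_mult_distrib intro!: mult_right_mono power_mono assms(2))
qed auto

lemma square_summable_inner:
  fixes f g :: "int \<Rightarrow> complex"
  assumes "(\<lambda>n. (cmod (f n))\<^sup>2) summable_on UNIV" "(\<lambda>n. (cmod (g n))\<^sup>2) summable_on UNIV"
  shows "(\<lambda>n. cnj (f n) * g n) summable_on UNIV"
proof (rule abs_summable_summable, rule summable_on_comparison_test)
  show "(\<lambda>n. (cmod (f n))\<^sup>2 + (cmod (g n))\<^sup>2) summable_on UNIV"
    by (intro summable_on_add assms)
  fix n
  show "norm (cnj (f n) * g n) \<le> (cmod (f n))\<^sup>2 + (cmod (g n))\<^sup>2"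
    using sum_squares_bound[of "cmod (f n)" "cmod (g n)"]
      mult_nonneg_nonneg[OF norm_ge_zero[of "f n"] norm_ge_zero[of "g n"]]
    unfolding norm_mult complex_mod_cnj by linarith
qed auto

lift_definition ell2_cscale :: "complex \<Rightarrow> ell2 \<Rightarrow> ell2" (infixr "*\<^sub>C" 75)
  is "\<lambda>c \<psi> n. c * \<psi> n"
  by (rule square_summable_mult_bounded) auto

text \<open>The inner product is antilinear in the first argument.\<close>

lift_definition cinner :: "ell2 \<Rightarrow> ell2 \<Rightarrow> complex"
  is "\<lambda>\<phi> \<psi>. \<Sum>\<^sub>\<infinity>n. cnj (\<phi> n) * \<psi> n" .

lift_definition delta :: "int \<Rightarrow> ell2" is "\<lambda>k n. if n = k then 1 else 0"
proof -
  fix k :: int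
  have "(\<lambda>n. (cmod (if n = k then 1 else 0))\<^sup>2) summable_on {k}" by simp
  then show "(\<lambda>n. (cmod (if n = k then 1 else 0))\<^sup>2) summable_on UNIV"
    by (rule summable_on_cong_neutral[THEN iffD1, rotated -1]) auto
qed

instantiation ell2 :: real_inner
begin

lift_definition zero_ell2 :: ell2 is "\<lambda>_. 0" by simp
lift_definition plus_ell2 :: "ell2 \<Rightarrow> ell2 \<Rightarrow> ell2" is "\<lambda>\<phi> \<psi> n. \<phi> n + \<psi> n"
  by (rule square_summable_add)
lift_definition uminus_ell2 :: "ell2 \<Rightarrow> ell2" is "\<lambda>\<phi> n. - \<phi> n" by simp
definition minus_ell2 :: "ell2 \<Rightarrow> ell2 \<Rightarrow> ell2" where "\<phi> - \<psi> = \<phi> + - (\<psi> :: ell2)"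
definition scaleR_ell2 :: "real \<Rightarrow> ell2 \<Rightarrow> ell2" where "r *\<^sub>R \<psi> = complex_of_real r *\<^sub>C \<psi>"
definition inner_ell2 :: "ell2 \<Rightarrow> ell2 \<Rightarrow> real" where "inner \<phi> \<psi> = Re (cinner \<phi> \<psi>)"
definition norm_ell2 :: "ell2 \<Rightarrow> real" where "norm \<psi> = sqrt (inner \<psi> (\<psi> :: ell2))"
definition dist_ell2 :: "ell2 \<Rightarrow> ell2 \<Rightarrow> real" where "dist \<phi> \<psi> = norm (\<phi> - \<psi> :: ell2)"
definition sgn_ell2 :: "ell2 \<Rightarrow> ell2" where "sgn \<psi> = inverse (norm \<psi>) *\<^sub>R (\<psi> :: ell2)"
definition uniformity_ell2 :: "(ell2 \<times> ell2) filter" where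
  "uniformity_ell2 = (INF e\<in>{0<..}. principal {(x, y). dist x y < e})"
definition open_ell2 :: "ell2 set \<Rightarrow> bool" where
  "open_ell2 U \<longleftrightarrow> (\<forall>x\<in>U. \<forall>\<^sub>F (x', y) in uniformity. x' = x \<longrightarrow> y \<in> U)"

lemma Re_cinner_self:
  "(\<lambda>n. (cmod (entry \<psi> n))\<^sup>2) summable_on UNIV"
  "cinner \<psi> \<psi> = complex_of_real (\<Sum>\<^sub>\<infinity>n. (cmod (entry \<psi> n))\<^sup>2)"
proof -
  show *: "(\<lambda>n. (cmod (entry \<psi> n))\<^sup>2) summable_on UNIV"
    using entry[of \<psi>] by simp
  have "((\<lambda>n. complex_of_real ((cmod (entry \<psi> n))\<^sup>2)) has_sum
      complex_of_real (\<Sum>\<^sub>\<infinity>n. (cmod (entry \<psi> n))\<^sup>2)) UNIV"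
    unfolding has_sum_of_real_iff using * by simp
  moreover have "(\<lambda>n. complex_of_real ((cmod (entry \<psi> n))\<^sup>2)) = (\<lambda>n. cnj (entry \<psi> n) * entry \<psi> n)"
    by (simp only: complex_norm_square mult.commute)
  ultimately show "cinner \<psi> \<psi> = complex_of_real (\<Sum>\<^sub>\<infinity>n. (cmod (entry \<psi> n))\<^sup>2)"
    unfolding cinner.rep_eq by (simp add: infsumI)
qed

lemma cinner_summable: "(\<lambda>n. cnj (entry \<phi> n) * entry \<psi> n) summable_on UNIV"
  by (rule square_summable_inner) (use entry in auto)

instance
proof
  fix x y z :: ell2 and a b r :: real
  show "x + y + z = x + (y + z)" by transfer (simp add: add.assoc)
  show "x + y = y + x" by transfer (simp add: add.commute)
  show "0 + x = x" by transfer simp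
  show "- x + x = 0" by transfer simp
  show "x - y = x + - y" by (rule minus_ell2_def)
  show "a *\<^sub>R (x + y) = a *\<^sub>R x + a *\<^sub>R y"
    unfolding scaleR_ell2_def by transfer (simp add: algebra_simps)
  show "(a + b) *\<^sub>R x = a *\<^sub>R x + b *\<^sub>R x"
    unfolding scaleR_ell2_def by transfer (simp add: algebra_simps)
  show "a *\<^sub>R b *\<^sub>R x = (a * b) *\<^sub>R x"
    unfolding scaleR_ell2_def by transfer (simp add: algebra_simps)
  show "1 *\<^sub>R x = x"
    unfolding scaleR_ell2_def by transfer simp
  show "dist x y = norm (x - y)" by (rule dist_ell2_def)
  show "sgn x = inverse (norm x) *\<^sub>R x" by (rule sgn_ell2_def)
  show "uniformity = (INF e\<in>{0<..}. principal {(x, y :: ell2). dist x y < e})"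
    by (rule uniformity_ell2_def)
  show "open U \<longleftrightarrow> (\<forall>x\<in>U. \<forall>\<^sub>F (x', y) in uniformity. x' = x \<longrightarrow> y \<in> U)" for U :: "ell2 set"
    by (rule open_ell2_def)
  have cnj: "cinner y x = cnj (cinner x y)" for x y
    unfolding cinner.rep_eq by (simp add: infsum_cnj[symmetric] mult.commute)
  show "inner x y = inner y x"
    unfolding inner_ell2_def by (subst cnj) simp
  have "cinner (x + y) z = cinner x z + cinner y z"
    unfolding cinner.rep_eq plus_ell2.rep_eq
    by (subst infsum_add[symmetric]) (auto intro: cinner_summable simp: distrib_right)
  then show "inner (x + y) z = inner x z + inner y z"
    unfolding inner_ell2_def by simp
  have "cinner (complex_of_real r *\<^sub>C x) y = complex_of_real r * cinner x y"
    unfolding cinner.rep_eq ell2_cscale.rep_eq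
    by (subst infsum_cmult_right'[symmetric]) (simp add: mult.assoc)
  then show "inner (r *\<^sub>R x) y = r * inner x y"
    unfolding inner_ell2_def scaleR_ell2_def by simp
  show "0 \<le> inner x x"
    unfolding inner_ell2_def Re_cinner_self by (simp add: infsum_nonneg)
  show "(inner x x = 0) = (x = 0)"
  proof
    assume "inner x x = 0"
    then have "(\<Sum>\<^sub>\<infinity>n. (cmod (entry x n))\<^sup>2) = 0"
      unfolding inner_ell2_def Re_cinner_self by simp
    then have "\<forall>n. (cmod (entry x n))\<^sup>2 = 0"
      using nonneg_infsum_le_0D[OF _ Re_cinner_self(1)[of x]] by auto
    then show "x = 0" by (intro ell2_eqI) (simp add: zero_ell2.rep_eq)
  next
    assume "x = 0"
    then show "inner x x = 0"
      unfolding inner_ell2_def cinner.rep_eq by (simp add: zero_ell2.rep_eq)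
  qed
  show "norm x = sqrt (inner x x)" by (rule norm_ell2_def)
qed

end

lemma norm_ell2: "norm \<psi> = sqrt (\<Sum>\<^sub>\<infinity>n. (cmod (entry \<psi> n))\<^sup>2)"
  unfolding norm_ell2_def inner_ell2_def Re_cinner_self by simp


section \<open>Bounded operators, spectrum and continuous functional calculus\<close>

definition bounded_clinear :: "(ell2 \<Rightarrow> ell2) \<Rightarrow> bool" where
  "bounded_clinear A \<longleftrightarrow> bounded_linear A \<and> (\<forall>c \<psi>. A (c *\<^sub>C \<psi>) = c *\<^sub>C A \<psi>)"

definition spectrum :: "(ell2 \<Rightarrow> ell2) \<Rightarrow> complex set" where
  "spectrum A = {z. \<not> (\<exists>B. bounded_clinear B \<and>
     (\<forall>\<psi>. B (A \<psi> - z *\<^sub>C \<psi>) = \<psi>) \<and> (\<forall>\<psi>. A (B \<psi>) - z *\<^sub>C B \<psi> = \<psi>))}"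

definition poly_op :: "complex poly \<Rightarrow> (ell2 \<Rightarrow> ell2) \<Rightarrow> ell2 \<Rightarrow> ell2" where
  "poly_op f A \<psi> = (\<Sum>i\<le>degree f. coeff f i *\<^sub>C (A ^^ i) \<psi>)"

text \<open>
  The operator \<open>h(A)\<close> for a bounded self-adjoint \<open>A\<close> and continuous \<open>h\<close>: the operator-norm limit
  of \<open>f\<^sub>n(A)\<close> for polynomials \<open>f\<^sub>n\<close> converging to \<open>h\<close> uniformly on the spectrum of \<open>A\<close>.
\<close>

definition cont_calc :: "(real \<Rightarrow> complex) \<Rightarrow> (ell2 \<Rightarrow> ell2) \<Rightarrow> ell2 \<Rightarrow> ell2" where
  "cont_calc h A = (THE B. bounded_clinear B \<and>
     (\<exists>f :: nat \<Rightarrow> complex poly.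
        uniform_limit {x. complex_of_real x \<in> spectrum A}
          (\<lambda>n x. poly (f n) (complex_of_real x)) h sequentially \<and>
        (\<lambda>n. onorm (\<lambda>\<psi>. poly_op (f n) A \<psi> - B \<psi>)) \<longlonglongrightarrow> 0))"


section \<open>Dynamical systems and their Jacobi matrices\<close>

text \<open>
  A system is given by a subset \<open>\<Omega>\<close> of a topological space, a map \<open>T\<close> restricting to a homeomorphism
  of \<open>\<Omega>\<close>, and a measure \<open>\<mu>\<close> with underlying set \<open>\<Omega>\<close>.
\<close>

definition int_iterate :: "'a set \<Rightarrow> ('a \<Rightarrow> 'a) \<Rightarrow> int \<Rightarrow> 'a \<Rightarrow> 'a" where
  "int_iterate \<Omega> T n = (if 0 \<le> n then T ^^ nat n else inv_into \<Omega> T ^^ nat (- n))"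

text \<open>
  \<open>C(\<Omega>, \<real>)\<close> with the uniform metric; its elements are \<^const>\<open>undefined\<close> outside \<open>\<Omega>\<close>.
\<close>

definition cfun_metric :: "'a::topological_space set \<Rightarrow> ('a \<Rightarrow> real) metric" where
  "cfun_metric \<Omega> = cfunspace (top_of_set \<Omega>) euclidean_metric"

abbreviation cfun :: "'a::topological_space set \<Rightarrow> ('a \<Rightarrow> real) set" where
  "cfun \<Omega> \<equiv> mspace (cfun_metric \<Omega>)"

definition cfun_nonneg :: "'a::topological_space set \<Rightarrow> ('a \<Rightarrow> real) set" where
  "cfun_nonneg \<Omega> = {p \<in> cfun \<Omega>. \<forall>\<omega>\<in>\<Omega>. 0 \<le> p \<omega>}"

text \<open>The value is meaningful for bounded coefficient sequences, see \<open>entry_jacobi_matrix\<close>.\<close>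

definition jacobi_matrix :: "(int \<Rightarrow> real) \<Rightarrow> (int \<Rightarrow> real) \<Rightarrow> ell2 \<Rightarrow> ell2" where
  "jacobi_matrix b a \<psi> = Abs_ell2 (\<lambda>n.
     complex_of_real (a (n - 1)) * entry \<psi> (n - 1) + complex_of_real (b n) * entry \<psi> n
     + complex_of_real (a n) * entry \<psi> (n + 1))"

lemma entry_jacobi_matrix:
  assumes a: "\<And>n. \<bar>a n\<bar> \<le> C" and b: "\<And>n. \<bar>b n\<bar> \<le> C"
  shows "entry (jacobi_matrix b a \<psi>) n =
    complex_of_real (a (n - 1)) * entry \<psi> (n - 1) + complex_of_real (b n) * entry \<psi> n
     + complex_of_real (a n) * entry \<psi> (n + 1)"
proof -
  have s: "(\<lambda>n. (cmod (entry \<psi> (n + k)))\<^sup>2) summable_on UNIV" for k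
    using summable_on_reindex_bij_betw[of "\<lambda>n. n + k" UNIV UNIV "\<lambda>n. (cmod (entry \<psi> n))\<^sup>2"]
      Re_cinner_self(1)[of \<psi>] bij_plus_right[of k] by simp
  have "(\<lambda>n. (cmod (
     complex_of_real (a (n - 1)) * entry \<psi> (n - 1) + complex_of_real (b n) * entry \<psi> n
     + complex_of_real (a n) * entry \<psi> (n + 1)))\<^sup>2) summable_on UNIV"
    by (intro square_summable_add square_summable_mult_bounded[where C = C])
      (use s[of "-1"] s[of 0] s[of 1] a b in auto)
  then show ?thesis
    unfolding jacobi_matrix_def by (subst Abs_ell2_inverse) auto
qed

definition jacobi ::
  "'a set \<Rightarrow> ('a \<Rightarrow> 'a) \<Rightarrow> ('a \<Rightarrow> real) \<Rightarrow> ('a \<Rightarrow> real) \<Rightarrow> 'a \<Rightarrow> ell2 \<Rightarrow> ell2" where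
  "jacobi \<Omega> T q p \<omega> =
     jacobi_matrix (\<lambda>n. q (int_iterate \<Omega> T n \<omega>)) (\<lambda>n. p (int_iterate \<Omega> T n \<omega>))"

definition as_spectrum ::
  "'a set \<Rightarrow> ('a \<Rightarrow> 'a) \<Rightarrow> 'a measure \<Rightarrow> ('a \<Rightarrow> real) \<Rightarrow> ('a \<Rightarrow> real) \<Rightarrow> real set" where
  "as_spectrum \<Omega> T \<mu> q p =
     (THE S. compact S \<and> (AE \<omega> in \<mu>. spectrum (jacobi \<Omega> T q p \<omega>) = complex_of_real ` S))"

definition dos_measure ::
  "'a set \<Rightarrow> ('a \<Rightarrow> 'a) \<Rightarrow> 'a measure \<Rightarrow> ('a \<Rightarrow> real) \<Rightarrow> ('a \<Rightarrow> real) \<Rightarrow> real measure" where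
  "dos_measure \<Omega> T \<mu> q p =
     (THE \<kappa>. sets \<kappa> = sets borel \<and>
       (\<forall>h :: real \<Rightarrow> complex. continuous_on UNIV h \<longrightarrow>
          has_bochner_integral \<kappa> h
            (\<integral>\<omega>. cinner (delta 0) (cont_calc h (jacobi \<Omega> T q p \<omega>) (delta 0)) \<partial>\<mu>)))"

definition ids ::
  "'a set \<Rightarrow> ('a \<Rightarrow> 'a) \<Rightarrow> 'a measure \<Rightarrow> ('a \<Rightarrow> real) \<Rightarrow> ('a \<Rightarrow> real) \<Rightarrow> real \<Rightarrow> real" where
  "ids \<Omega> T \<mu> q p E = measure (dos_measure \<Omega> T \<mu> q p) {..E}"


section \<open>Suspension and Schwartzman group\<close>

definition quotient_topology :: "'a topology \<Rightarrow> ('a \<Rightarrow> 'b) \<Rightarrow> 'b topology" where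
  "quotient_topology X \<pi> =
     topology (\<lambda>U. U \<subseteq> \<pi> ` topspace X \<and> openin X {x \<in> topspace X. \<pi> x \<in> U})"

lemma openin_quotient_topology:
  "openin (quotient_topology X \<pi>) U \<longleftrightarrow>
     U \<subseteq> \<pi> ` topspace X \<and> openin X {x \<in> topspace X. \<pi> x \<in> U}"
proof -
  have "istopology (\<lambda>U. U \<subseteq> \<pi> ` topspace X \<and> openin X {x \<in> topspace X. \<pi> x \<in> U})"
  proof (unfold istopology_def, intro conjI allI impI; (elim conjE)?)
    fix S T
    assume "openin X {x \<in> topspace X. \<pi> x \<in> S}" "openin X {x \<in> topspace X. \<pi> x \<in> T}"
    then have "openin X ({x \<in> topspace X. \<pi> x \<in> S} \<inter> {x \<in> topspace X. \<pi> x \<in> T})"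
      by (rule openin_Int)
    then show "openin X {x \<in> topspace X. \<pi> x \<in> S \<inter> T}"
      by (rule back_subst[of "openin X"]) auto
  next
    fix \<K>
    assume "\<forall>K\<in>\<K>. K \<subseteq> \<pi> ` topspace X \<and> openin X {x \<in> topspace X. \<pi> x \<in> K}"
    then have "openin X (\<Union>K\<in>\<K>. {x \<in> topspace X. \<pi> x \<in> K})" by blast
    then show "openin X {x \<in> topspace X. \<pi> x \<in> \<Union>\<K>}"
      by (rule back_subst[of "openin X"]) auto
  qed auto
  then show ?thesis
    unfolding quotient_topology_def by (simp add: topology_inverse')
qed

lemma topspace_quotient_topology: "topspace (quotient_topology X \<pi>) = \<pi> ` topspace X"
proof
  show "topspace (quotient_topology X \<pi>) \<subseteq> \<pi> ` topspace X"
    using openin_quotient_topology[of X \<pi>] openin_topspace by blast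
  have "{x \<in> topspace X. \<pi> x \<in> \<pi> ` topspace X} = topspace X" by auto
  then show "\<pi> ` topspace X \<subseteq> topspace (quotient_topology X \<pi>)"
    by (intro openin_subset) (simp add: openin_quotient_topology)
qed

lemma quotient_map_quotient_topology: "quotient_map X (quotient_topology X \<pi>) \<pi>"
  unfolding quotient_map_def by (auto simp: topspace_quotient_topology openin_quotient_topology)

text \<open>The circle \<open>\<real>/\<int>\<close>, with points represented as cosets of \<open>\<int>\<close>.\<close>

definition circle_proj :: "real \<Rightarrow> real set" where
  "circle_proj s = {s + of_int n | n. True}"

definition circle :: "real set topology" where
  "circle = quotient_topology euclideanreal circle_proj"

text \<open>The class of \<open>(\<omega>, t)\<close> under \<open>(T\<^sup>n\<omega>, t) \<sim> (\<omega>, t + n)\<close> on \<open>\<Omega> \<times> \<real>\<close>.\<close>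

definition suspension_rel :: "'a set \<Rightarrow> ('a \<Rightarrow> 'a) \<Rightarrow> (('a \<times> real) \<times> ('a \<times> real)) set" where
  "suspension_rel \<Omega> T =
     {((int_iterate \<Omega> T n \<omega>, t), (\<omega>, t + of_int n)) | n \<omega> t. \<omega> \<in> \<Omega>}"

definition suspension_proj :: "'a set \<Rightarrow> ('a \<Rightarrow> 'a) \<Rightarrow> 'a \<times> real \<Rightarrow> ('a \<times> real) set" where
  "suspension_proj \<Omega> T x = suspension_rel \<Omega> T `` {x}"

definition suspension ::
  "'a::topological_space set \<Rightarrow> ('a \<Rightarrow> 'a) \<Rightarrow> ('a \<times> real) set topology" where
  "suspension \<Omega> T = quotient_topology (top_of_set (\<Omega> \<times> UNIV)) (suspension_proj \<Omega> T)"

definition suspension_flow :: "real \<Rightarrow> ('a \<times> real) set \<Rightarrow> ('a \<times> real) set" where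
  "suspension_flow s x = (\<lambda>(\<omega>, t). (\<omega>, s + t)) ` x"

definition suspension_measure ::
  "'a::topological_space set \<Rightarrow> ('a \<Rightarrow> 'a) \<Rightarrow> 'a measure \<Rightarrow> ('a \<times> real) set measure" where
  "suspension_measure \<Omega> T \<mu> =
     distr (\<mu> \<Otimes>\<^sub>M restrict_space lborel {0..1})
       (sigma (topspace (suspension \<Omega> T)) {U. openin (suspension \<Omega> T) U})
       (suspension_proj \<Omega> T)"

text \<open>
  \<open>winding_value \<Omega> T \<mu> \<phi> \<alpha>\<close> states that \<open>\<alpha>\<close> is the almost-sure value of the limit defining
  \<open>\<AA>\<^sub>\<nu>(\<phi>)\<close>. Two lifts differ by an integer constant, so the choice of the lift is irrelevant.
\<close>

definition is_lift :: "(('a \<times> real) set \<Rightarrow> real set) \<Rightarrow> ('a \<times> real) set \<Rightarrow> (real \<Rightarrow> real) \<Rightarrow> bool" where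
  "is_lift \<phi> x g \<longleftrightarrow> continuous_on UNIV g \<and> (\<forall>t. circle_proj (g t) = \<phi> (suspension_flow t x))"

definition winding_value ::
  "'a::topological_space set \<Rightarrow> ('a \<Rightarrow> 'a) \<Rightarrow> 'a measure \<Rightarrow>
    (('a \<times> real) set \<Rightarrow> real set) \<Rightarrow> real \<Rightarrow> bool" where
  "winding_value \<Omega> T \<mu> \<phi> \<alpha> \<longleftrightarrow>
     (AE x in suspension_measure \<Omega> T \<mu>.
        \<exists>g. is_lift \<phi> x g \<and> ((\<lambda>t. g t / t) \<longlongrightarrow> \<alpha>) at_top)"

definition schwartzman ::
  "'a::topological_space set \<Rightarrow> ('a \<Rightarrow> 'a) \<Rightarrow> 'a measure \<Rightarrow> real set" where
  "schwartzman \<Omega> T \<mu> =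
     {\<alpha>. \<exists>\<phi>. continuous_map (suspension \<Omega> T) circle \<phi> \<and> winding_value \<Omega> T \<mu> \<phi> \<alpha>}"

definition schwartzman0 ::
  "'a::topological_space set \<Rightarrow> ('a \<Rightarrow> 'a) \<Rightarrow> 'a measure \<Rightarrow> real set" where
  "schwartzman0 \<Omega> T \<mu> = schwartzman \<Omega> T \<mu> \<inter> {0<..<1}"


section \<open>Open gaps\<close>

definition has_open_gap ::
  "'a set \<Rightarrow> ('a \<Rightarrow> 'a) \<Rightarrow> 'a measure \<Rightarrow> ('a \<Rightarrow> real) \<Rightarrow> ('a \<Rightarrow> real) \<Rightarrow> real \<Rightarrow> bool" where
  "has_open_gap \<Omega> T \<mu> q p l \<longleftrightarrow>
     (\<exists>I \<in> components (- as_spectrum \<Omega> T \<mu> q p). bounded I \<and> (\<forall>E\<in>I. ids \<Omega> T \<mu> q p E = l))"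

definition OG_Jacobi ::
  "'a::topological_space set \<Rightarrow> ('a \<Rightarrow> 'a) \<Rightarrow> 'a measure \<Rightarrow> real \<Rightarrow>
    (('a \<Rightarrow> real) \<times> ('a \<Rightarrow> real)) set" where
  "OG_Jacobi \<Omega> T \<mu> l = {(q, p). q \<in> cfun \<Omega> \<and> p \<in> cfun_nonneg \<Omega> \<and> has_open_gap \<Omega> T \<mu> q p l}"

definition OG_Schr ::
  "'a::topological_space set \<Rightarrow> ('a \<Rightarrow> 'a) \<Rightarrow> 'a measure \<Rightarrow> real \<Rightarrow> ('a \<Rightarrow> real) set" where
  "OG_Schr \<Omega> T \<mu> l = {q \<in> cfun \<Omega>. (q, \<lambda>\<omega>\<in>\<Omega>. 1) \<in> OG_Jacobi \<Omega> T \<mu> l}"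

definition OG_diag ::
  "'a::topological_space set \<Rightarrow> ('a \<Rightarrow> 'a) \<Rightarrow> 'a measure \<Rightarrow> real \<Rightarrow> ('a \<Rightarrow> real) set" where
  "OG_diag \<Omega> T \<mu> l = {q \<in> cfun \<Omega>. (q, \<lambda>\<omega>\<in>\<Omega>. 0) \<in> OG_Jacobi \<Omega> T \<mu> l}"

text \<open>Intersecting with the ambient space fixes the meaning of an empty intersection.\<close>

definition AGO_Jacobi ::
  "'a::topological_space set \<Rightarrow> ('a \<Rightarrow> 'a) \<Rightarrow> 'a measure \<Rightarrow>
    (('a \<Rightarrow> real) \<times> ('a \<Rightarrow> real)) set" where
  "AGO_Jacobi \<Omega> T \<mu> =
     (cfun \<Omega> \<times> cfun_nonneg \<Omega>) \<inter> (\<Inter>l\<in>schwartzman0 \<Omega> T \<mu>. OG_Jacobi \<Omega> T \<mu> l)"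

definition AGO_diag ::
  "'a::topological_space set \<Rightarrow> ('a \<Rightarrow> 'a) \<Rightarrow> 'a measure \<Rightarrow> ('a \<Rightarrow> real) set" where
  "AGO_diag \<Omega> T \<mu> = cfun \<Omega> \<inter> (\<Inter>l\<in>schwartzman0 \<Omega> T \<mu>. OG_diag \<Omega> T \<mu> l)"


section \<open>Full shifts\<close>

definition left_shift :: "(int \<Rightarrow> real) \<Rightarrow> int \<Rightarrow> real" where
  "left_shift \<omega> = (\<lambda>n. \<omega> (n + 1))"

definition shift_space :: "real set \<Rightarrow> (int \<Rightarrow> real) set" where
  "shift_space A = (\<Pi>\<^sub>E n\<in>UNIV. A)"

definition shift_measure :: "real measure \<Rightarrow> (int \<Rightarrow> real) measure" where
  "shift_measure \<mu>\<^sub>0 = (\<Pi>\<^sub>M n\<in>UNIV. \<mu>\<^sub>0)"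

text \<open>
  For a finite alphabet the Borel sets of the alphabet are all of its subsets, so the single-site
  measure is \<^const>\<open>uniform_count_measure\<close> and \<open>mu m\<close> has underlying set \<open>Omega m\<close>.
\<close>

definition alphabet :: "nat \<Rightarrow> real set" where
  "alphabet m = real ` {0..<m}"

definition Omega :: "nat \<Rightarrow> (int \<Rightarrow> real) set" where
  "Omega m = shift_space (alphabet m)"

definition mu :: "nat \<Rightarrow> (int \<Rightarrow> real) measure" where
  "mu m = shift_measure (uniform_count_measure (alphabet m))"

lemma space_mu: "space (mu m) = Omega m"
  by (simp add: mu_def Omega_def shift_measure_def shift_space_def space_PiM
      space_uniform_count_measure)

lemma int_iterate_shift:
  assumes "\<omega> \<in> shift_space A"
  shows "int_iterate (shift_space A) left_shift n \<omega> = (\<lambda>k. \<omega> (k + n))"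
proof -
  have inj: "inj left_shift"
  proof (rule injI, rule ext)
    fix x y n assume "left_shift x = left_shift y"
    then have "left_shift x (n - 1) = left_shift y (n - 1)" by simp
    then show "x n = y n" by (simp add: left_shift_def)
  qed
  have inv: "inv_into (shift_space A) left_shift \<xi> = (\<lambda>k. \<xi> (k - 1))" if "\<xi> \<in> shift_space A" for \<xi>
    by (rule inv_into_f_eq)
      (use that inj in \<open>auto simp: shift_space_def left_shift_def inj_on_def inj_def PiE_iff\<close>)
  have pos: "(left_shift ^^ k) \<omega> = (\<lambda>j. \<omega> (j + int k))" for k
    by (induction k) (auto simp: left_shift_def algebra_simps)
  have neg: "(inv_into (shift_space A) left_shift ^^ k) \<omega> = (\<lambda>j. \<omega> (j - int k))" for k
  proof (induction k)
    case (Suc k)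
    have "(\<lambda>j. \<omega> (j - int k)) \<in> shift_space A"
      using assms by (auto simp: shift_space_def PiE_iff)
    then show ?case using Suc by (simp add: inv algebra_simps)
  qed simp
  show ?thesis by (simp add: int_iterate_def pos neg)
qed

lemma measurable_suspension_proj:
  "suspension_proj (Omega m) left_shift \<in>
     measurable (mu m \<Otimes>\<^sub>M restrict_space lborel {0..1})
       (sigma (topspace (suspension (Omega m) left_shift)) {U. openin (suspension (Omega m) left_shift) U})"
proof (rule measurable_sigma_sets)
  let ?M = "mu m \<Otimes>\<^sub>M restrict_space lborel {0..1 :: real}"
  have sp: "space ?M = Omega m \<times> {0..1}"
    by (simp add: space_pair_measure space_mu space_restrict_space)
  have top: "topspace (suspension (Omega m) left_shift) = suspension_proj (Omega m) left_shift ` (Omega m \<times> UNIV)"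
    by (simp add: suspension_def topspace_quotient_topology)
  show "sets (sigma (topspace (suspension (Omega m) left_shift)) {U. openin (suspension (Omega m) left_shift) U})
      = sigma_sets (topspace (suspension (Omega m) left_shift)) {U. openin (suspension (Omega m) left_shift) U}"
    by (rule sets_measure_of) (auto dest: openin_subset)
  show "{U. openin (suspension (Omega m) left_shift) U} \<subseteq> Pow (topspace (suspension (Omega m) left_shift))"
    by (auto dest: openin_subset)
  show "suspension_proj (Omega m) left_shift \<in> space ?M \<rightarrow> topspace (suspension (Omega m) left_shift)"
    unfolding sp top by auto
  have 1: "(\<lambda>x. x) \<in> measurable (mu m) borel"
  proof -
    have "(\<lambda>\<omega>. \<omega> i) \<in> borel_measurable (mu m)" for i
    proof -
      have "(\<lambda>\<omega>. \<omega> i) \<in> measurable (mu m) (uniform_count_measure (alphabet m))"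
        unfolding mu_def shift_measure_def by (rule measurable_component_singleton) simp
      moreover have "(\<lambda>x. x) \<in> borel_measurable (uniform_count_measure (alphabet m))"
        by (auto simp: measurable_def space_uniform_count_measure sets_uniform_count_measure)
      ultimately show ?thesis using measurable_compose by blast
    qed
    then show ?thesis
      by (subst measurable_cong_sets[OF refl sets_PiM_equal_borel[symmetric]])
        (rule measurable_PiM_single', auto)
  qed
  have 2: "(\<lambda>x. x) \<in> measurable (restrict_space lborel {0..1 :: real}) borel"
    by (rule measurable_restrict_space1) simp
  have 3: "(\<lambda>x. (fst x, snd x)) \<in> measurable ?M (borel \<Otimes>\<^sub>M borel)"
    by (intro measurable_Pair measurable_compose[OF measurable_fst 1]
        measurable_compose[OF measurable_snd 2])
  then have 4: "(\<lambda>x. x) \<in> borel_measurable ?M" by (simp add: borel_prod)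
  fix U assume "U \<in> {U. openin (suspension (Omega m) left_shift) U}"
  then have "openin (top_of_set (Omega m \<times> UNIV))
      {x \<in> Omega m \<times> UNIV. suspension_proj (Omega m) left_shift x \<in> U}"
    by (simp add: suspension_def openin_quotient_topology)
  then obtain W where W: "open W"
    "{x \<in> Omega m \<times> UNIV. suspension_proj (Omega m) left_shift x \<in> U} = Omega m \<times> UNIV \<inter> W"
    by (auto simp: openin_open)
  have "suspension_proj (Omega m) left_shift -` U \<inter> space ?M = (\<lambda>x. x) -` W \<inter> space ?M"
    using W(2) unfolding sp by blast
  also have "\<dots> \<in> sets ?M"
    using measurable_sets[OF 4, of W] W(1) by simp
  finally show "suspension_proj (Omega m) left_shift -` U \<inter> space ?M \<in> sets ?M" .
qed

end

theory Submission
  imports Defs "HOL-Computational_Algebra.Fundamental_Theorem_Algebra"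
begin

text \<open>
  A potential \<open>q\<close> that misses an interval \<open>(x, y)\<close> gives the diagonal operator a gap with label
  \<open>\<mu>(q \<le> x)\<close>. The operator \<open>J\<^sub>t\<close> with hopping \<open>t\<close> keeps \<open>(x + 2 t, y - 2 t)\<close> free of spectrum,
  and the label does not change: with \<open>\<tau>\<close> the trace per unit volume, \<open>\<Delta>\<close> the derivative of \<open>J\<^sub>t\<close>
  in \<open>t\<close>, and \<open>f\<close> a polynomial \<open>C\<^sup>1\<close>-close to a cutoff whose derivative lives in the gap,
  cyclicity of \<open>\<tau>\<close> gives \<open>d/dt \<tau>(f(J\<^sub>t)) = \<tau>(f'(J\<^sub>t) \<Delta>)\<close>, which is small because \<open>f'\<close> is small
  on the spectrum. Scaling \<open>q\<close> by a large constant is the same as making the hopping small.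

  Since \<open>\<Omega>\<close> is totally disconnected, a map from the suspension to the circle winds, up to a
  coboundary, by a locally constant integer function; hence the labels are rationals \<open>j / m\<^sup>k\<close>.
  For each of them the potentials with a gap of that label form a dense open set (perturb a locally
  constant potential so that it takes distinct values on distinct words), and Baire's theorem
  provides the generic set. Its elements also settle the diagonal and the Jacobi case.
\<close>

section \<open>Square-summable sequences form a Hilbert space\<close>

text \<open>\<open>as_spectrum\<close>, \<open>dos_measure\<close> and \<open>cont_calc\<close> are
  definite descriptions: they say nothing until existence and uniqueness are shown, and much of the
  development supplies this. Spectra: almost every \<open>\<omega>\<close> contains every finite
  word, so its orbit is dense and its spectrum contains that of every other point, which forces a
  common value. Density of states: test functions are reduced to polynomials, whose integrals are
  combinations of moments, and the moments determine a measure. Labels are also treated through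
  polynomials: matrix elements of powers of \<open>J_t\<close> are polynomials in \<open>t\<close>,
  so they can be differentiated in \<open>t\<close>, while a cutoff has only its functional
  calculus. Uniform closeness to the cutoff would not suffice, since the change along the path from
  hopping 0 is governed by \<open>f'\<close> on the spectra of all intermediate operators. On the
  Schwartzman side, the almost sure limit is rewritten as the integral of an integer function of
  finitely many coordinates; a word on \<open>k\<close> coordinates has mass \<open>1 / m^k\<close>,
  which is where the denominators come from.\<close>

lemmas entry_add [simp] = plus_ell2.rep_eq
lemmas entry_uminus [simp] = uminus_ell2.rep_eq
lemmas entry_zero [simp] = zero_ell2.rep_eq
lemmas entry_cscale [simp] = ell2_cscale.rep_eq
lemmas entry_delta = delta.rep_eq

lemma entry_diff [simp]: "entry (\<phi> - \<psi>) n = entry \<phi> n - entry \<psi> n"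
  by (simp only: minus_ell2_def entry_add entry_uminus) simp

lemma scaleR_ell2_eq: "r *\<^sub>R \<psi> = complex_of_real r *\<^sub>C (\<psi> :: ell2)"
  by (simp add: scaleR_ell2_def)

lemma entry_sum [simp]: "entry (\<Sum>i\<in>I. f i) n = (\<Sum>i\<in>I. entry (f i) n)"
  by (induction I rule: infinite_finite_induct) auto

lemma cscale_simps [simp]:
  "1 *\<^sub>C \<psi> = \<psi>" "0 *\<^sub>C \<psi> = 0" "c *\<^sub>C (0 :: ell2) = 0" "c *\<^sub>C d *\<^sub>C \<psi> = (c * d) *\<^sub>C \<psi>"
  by (auto intro!: ell2_eqI)

lemma cscale_add_right: "c *\<^sub>C (\<phi> + \<psi>) = c *\<^sub>C \<phi> + c *\<^sub>C \<psi>"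
  and cscale_diff_right: "c *\<^sub>C (\<phi> - \<psi>) = c *\<^sub>C \<phi> - c *\<^sub>C \<psi>"
  and cscale_add_left: "(c + d) *\<^sub>C \<psi> = c *\<^sub>C \<psi> + d *\<^sub>C \<psi>"
  by (auto intro!: ell2_eqI simp: algebra_simps)

lemma cscale_sum_right: "c *\<^sub>C (\<Sum>i\<in>I. f i) = (\<Sum>i\<in>I. c *\<^sub>C f i)"
  by (intro ell2_eqI) (simp add: sum_distrib_left)

lemma cinner_commute: "cinner \<psi> \<phi> = cnj (cinner \<phi> \<psi>)"
  unfolding cinner.rep_eq by (simp add: infsum_cnj[symmetric] mult.commute)

lemma cinner_add_right: "cinner \<phi> (\<psi> + \<xi>) = cinner \<phi> \<psi> + cinner \<phi> \<xi>"
  unfolding cinner.rep_eq entry_add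
  by (subst infsum_add[symmetric]) (auto intro: cinner_summable simp: distrib_left)

lemma cinner_cscale_right: "cinner \<phi> (c *\<^sub>C \<psi>) = c * cinner \<phi> \<psi>"
  unfolding cinner.rep_eq entry_cscale
  by (subst infsum_cmult_right'[symmetric]) (simp add: mult.left_commute)

lemma cinner_add_left: "cinner (\<psi> + \<xi>) \<phi> = cinner \<psi> \<phi> + cinner \<xi> \<phi>"
  by (metis cinner_add_right cinner_commute complex_cnj_add)

lemma cinner_cscale_left: "cinner (c *\<^sub>C \<psi>) \<phi> = cnj c * cinner \<psi> \<phi>"
  by (metis cinner_cscale_right cinner_commute complex_cnj_mult)

lemma cinner_zero_right [simp]: "cinner \<phi> 0 = 0"
  using cinner_cscale_right[of \<phi> 0 0] by simp

lemma cinner_zero_left [simp]: "cinner 0 \<phi> = 0"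
  using cinner_cscale_left[of 0 0 \<phi>] by simp

lemma cinner_diff_right: "cinner \<phi> (\<psi> - \<xi>) = cinner \<phi> \<psi> - cinner \<phi> \<xi>"
  using cinner_add_right[of \<phi> "\<psi> - \<xi>" \<xi>] by (simp add: algebra_simps)

lemma cinner_sum_right: "cinner \<phi> (\<Sum>i\<in>I. f i) = (\<Sum>i\<in>I. cinner \<phi> (f i))"
  by (induction I rule: infinite_finite_induct) (auto simp: cinner_add_right)

lemma cinner_delta_left: "cinner (delta n) \<psi> = entry \<psi> n"
proof -
  have "cinner (delta n) \<psi> = (\<Sum>\<^sub>\<infinity>k\<in>{n}. cnj (entry (delta n) k) * entry \<psi> k)"
    unfolding cinner.rep_eq by (rule infsum_cong_neutral) (auto simp: entry_delta)
  then show ?thesis by (simp add: entry_delta)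
qed

lemma cinner_delta_right: "cinner \<psi> (delta n) = cnj (entry \<psi> n)"
  by (subst cinner_commute) (simp add: cinner_delta_left)

lemma norm_power2_ell2: "(norm \<psi>)\<^sup>2 = (\<Sum>\<^sub>\<infinity>n. (cmod (entry \<psi> n))\<^sup>2)"
  by (simp add: norm_ell2 infsum_nonneg)

lemma cinner_self: "cinner \<psi> \<psi> = complex_of_real ((norm \<psi>)\<^sup>2)"
  by (simp only: Re_cinner_self(2) norm_power2_ell2)

lemma norm_cscale [simp]: "norm (c *\<^sub>C \<psi>) = cmod c * norm \<psi>"
proof -
  have "complex_of_real ((norm (c *\<^sub>C \<psi>))\<^sup>2) = complex_of_real ((cmod c * norm \<psi>)\<^sup>2)"
    by (simp add: cinner_self[symmetric] cinner_cscale_left cinner_cscale_right power_mult_distrib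
        complex_norm_square del: of_real_power)
  then have "(norm (c *\<^sub>C \<psi>))\<^sup>2 = (cmod c * norm \<psi>)\<^sup>2"
    by (simp only: of_real_eq_iff)
  then show ?thesis
    by (simp add: power2_eq_iff_nonneg)
qed

text \<open>Rotating \<open>\<psi>\<close> by the phase \<open>?u\<close> makes the complex product
  real and nonnegative, so the Cauchy-Schwarz inequality of the class \<open>real_inner\<close>
  applies.\<close>

lemma cmod_cinner_le: "cmod (cinner \<phi> \<psi>) \<le> norm \<phi> * norm \<psi>"
proof (cases "cinner \<phi> \<psi> = 0")
  case False
  let ?c = "cinner \<phi> \<psi>" and ?u = "cnj (cinner \<phi> \<psi>) / cmod (cinner \<phi> \<psi>)"
  have "?u * ?c = complex_of_real (cmod ?c)"
    using False by (simp add: field_simps complex_norm_square[symmetric] power2_eq_square)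
  then have "cmod ?c = inner \<phi> (?u *\<^sub>C \<psi>)"
    by (simp add: inner_ell2_def cinner_cscale_right)
  also have "\<dots> \<le> norm \<phi> * norm (?u *\<^sub>C \<psi>)"
    by (rule norm_cauchy_schwarz)
  finally show ?thesis using False by (simp add: norm_divide)
qed simp

lemma norm_delta [simp]: "norm (delta k) = 1"
proof -
  have "complex_of_real ((norm (delta k))\<^sup>2) = 1"
    by (simp only: cinner_self[symmetric] cinner_delta_left) (simp add: entry_delta)
  then have "(norm (delta k))\<^sup>2 = 1" by (simp only: of_real_eq_1_iff)
  then show ?thesis using norm_ge_zero[of "delta k"] by (simp only: power2_eq_1_iff) linarith
qed

lemma cmod_entry_le: "cmod (entry \<psi> n) \<le> norm \<psi>"
  using cmod_cinner_le[of "delta n" \<psi>] by (simp add: cinner_delta_left)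

lemma sum_entry_le_norm:
  assumes "finite F" shows "(\<Sum>n\<in>F. (cmod (entry \<psi> n))\<^sup>2) \<le> (norm \<psi>)\<^sup>2"
  unfolding norm_power2_ell2 by (rule finite_sum_le_infsum) (use assms Re_cinner_self(1) in auto)

text \<open>Completeness needs both facts at once: a coordinatewise limit with controlled finite
  sums is an element of \<open>ell2\<close>, and the same bound controls its norm.\<close>

lemma ell2_bounded_partial_sums:
  assumes "\<And>F. finite F \<Longrightarrow> (\<Sum>n\<in>F. (cmod (f n))\<^sup>2) \<le> e\<^sup>2" "0 \<le> e"
  obtains \<psi> where "entry \<psi> = f" "norm \<psi> \<le> e"
proof -
  have "(\<lambda>n. (cmod (f n))\<^sup>2) summable_on UNIV"
    by (rule nonneg_bounded_partial_sums_imp_summable_on[where C = "e\<^sup>2"])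
      (use assms in \<open>auto simp: eventually_finite_subsets_at_top intro!: exI[of _ "{}"]\<close>)
  then have e: "entry (Abs_ell2 f) = f"
    by (simp add: Abs_ell2_inverse)
  have "(\<lambda>n. (cmod (entry (Abs_ell2 f) n))\<^sup>2) summable_on UNIV"
    by (rule Re_cinner_self)
  then have "(norm (Abs_ell2 f))\<^sup>2 \<le> e\<^sup>2"
    unfolding norm_power2_ell2 by (rule infsum_le_finite_sums) (use assms e in auto)
  then show ?thesis using that[OF e] assms(2) by (simp add: power2_le_iff_abs_le)
qed

instance ell2 :: banach
proof
  fix X :: "nat \<Rightarrow> ell2" assume X: "Cauchy X"
  have conv: "convergent (\<lambda>k. entry (X k) n)" for n
    unfolding Cauchy_convergent_iff[symmetric]
  proof (rule metric_CauchyI)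
    fix e :: real assume "0 < e"
    with X obtain M where M: "\<And>k l. k \<ge> M \<Longrightarrow> l \<ge> M \<Longrightarrow> dist (X k) (X l) < e"
      using metric_CauchyD by blast
    have "dist (entry (X k) n) (entry (X l) n) < e" if "k \<ge> M" "l \<ge> M" for k l
      using cmod_entry_le[of "X k - X l" n] M[OF that] by (simp add: dist_norm)
    then show "\<exists>M. \<forall>k\<ge>M. \<forall>l\<ge>M. dist (entry (X k) n) (entry (X l) n) < e"
      by blast
  qed
  define f where "f = (\<lambda>n. lim (\<lambda>k. entry (X k) n))"
  have f: "(\<lambda>k. entry (X k) n) \<longlonglongrightarrow> f n" for n
    using conv[of n] by (simp add: convergent_LIMSEQ_iff f_def)
  have close: "\<exists>\<psi>. entry \<psi> = (\<lambda>n. f n - entry (X k) n) \<and> norm \<psi> \<le> e"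
    if M: "\<And>k l. k \<ge> M \<Longrightarrow> l \<ge> M \<Longrightarrow> dist (X k) (X l) < e" and k: "k \<ge> M" and "e > 0" for M k e
  proof (rule ell2_bounded_partial_sums[where f = "\<lambda>n. f n - entry (X k) n" and e = e])
    fix F :: "int set" assume "finite F"
    \<comment> \<open>Finite sums commute with the limit in \<open>l\<close>, so a bound over every
      finite \<open>F\<close> survives the passage to \<open>f\<close>.\<close>
    have "(\<Sum>n\<in>F. (cmod (entry (X l) n - entry (X k) n))\<^sup>2) \<le> e\<^sup>2" if "l \<ge> M" for l
    proof -
      have "(\<Sum>n\<in>F. (cmod (entry (X l - X k) n))\<^sup>2) \<le> (norm (X l - X k))\<^sup>2"
        by (rule sum_entry_le_norm) fact
      also have "\<dots> \<le> e\<^sup>2"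
        using M[OF that k] by (intro power_mono) (auto simp: dist_norm)
      finally show ?thesis by simp
    qed
    then show "(\<Sum>n\<in>F. (cmod (f n - entry (X k) n))\<^sup>2) \<le> e\<^sup>2"
      by (intro LIMSEQ_le_const2[where X = "\<lambda>l. \<Sum>n\<in>F. (cmod (entry (X l) n - entry (X k) n))\<^sup>2"])
        (auto intro!: tendsto_intros f)
  qed (use \<open>e > 0\<close> in auto)
  obtain M where "\<And>k l. k \<ge> M \<Longrightarrow> l \<ge> M \<Longrightarrow> dist (X k) (X l) < 1"
    using X zero_less_one metric_CauchyD by blast
  from close[OF this order_refl] obtain \<psi> where \<psi>: "entry \<psi> = (\<lambda>n. f n - entry (X M) n)"
    by auto
  define L where "L = X M + \<psi>"
  have L: "entry L = f"
    by (auto simp: L_def \<psi>)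
  have "X \<longlonglongrightarrow> L"
  proof (rule metric_LIMSEQ_I)
    fix e :: real assume "0 < e"
    then obtain M where M: "\<And>k l. k \<ge> M \<Longrightarrow> l \<ge> M \<Longrightarrow> dist (X k) (X l) < e / 2"
      using X metric_CauchyD[of X "e / 2"] by auto
    have "dist (X k) L < e" if k: "k \<ge> M" for k
    proof -
      obtain \<psi> where \<psi>: "entry \<psi> = (\<lambda>n. f n - entry (X k) n)" "norm \<psi> \<le> e / 2"
        using close[OF M k] \<open>0 < e\<close> by auto
      have "\<psi> = L - X k" by (rule ell2_eqI) (simp add: \<psi> L)
      then show ?thesis using \<psi>(2) \<open>0 < e\<close> by (simp add: dist_norm norm_minus_commute)
    qed
    then show "\<exists>M. \<forall>k\<ge>M. dist (X k) L < e" by blast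
  qed
  then show "convergent X" by (auto simp: convergent_def)
qed

section \<open>Inverting operators\<close>

text \<open>Lax-Milgram: for a suitable \<open>t\<close> the map \<open>x - t (S x - w)\<close> is a
  contraction, and its fixed point solves \<open>S x = w\<close>.\<close>

lemma coercive_surj:
  fixes S :: "'a::{real_inner,complete_space} \<Rightarrow> 'a"
  assumes S: "bounded_linear S" and c: "c > 0" "\<And>x. c * (norm x)\<^sup>2 \<le> inner x (S x)"
  shows "surj S"
proof -
  interpret bounded_linear S by fact
  obtain K where K: "K > 0" "\<And>x. norm (S x) \<le> norm x * K"
    using pos_bounded by blast
  define L where "L = max K c"
  have L: "L > 0" "c \<le> L" "norm (S x) \<le> L * norm x" for x
    using K mult_left_mono[of K L "norm x"] by (auto simp: L_def mult.commute intro: order_trans)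
  \<comment> \<open>This \<open>t\<close> minimises \<open>1 - 2 t c + t\<^sup>2 L\<^sup>2\<close>,
    the squared contraction factor. Enlarging \<open>K\<close> to some \<open>L \<ge> c\<close>
    keeps the minimum \<open>1 - c\<^sup>2 / L\<^sup>2\<close> nonnegative.\<close>
  define t where "t = c / L\<^sup>2"
  have t: "t > 0" using c L by (simp add: t_def)
  define r where "r = sqrt (1 - c\<^sup>2 / L\<^sup>2)"
  have cL: "c\<^sup>2 / L\<^sup>2 \<le> 1" "c\<^sup>2 / L\<^sup>2 > 0" using c L by (auto simp: power_mono)
  have contr: "norm (u - t *\<^sub>R S u) \<le> r * norm u" for u
  proof (rule power2_le_imp_le)
    have "(norm (u - t *\<^sub>R S u))\<^sup>2 = (norm u)\<^sup>2 - 2 * t * inner u (S u) + t\<^sup>2 * (norm (S u))\<^sup>2"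
      unfolding power2_norm_eq_inner
      by (simp add: inner_diff_left inner_diff_right inner_commute algebra_simps power2_eq_square)
    also have "\<dots> \<le> (norm u)\<^sup>2 - 2 * t * (c * (norm u)\<^sup>2) + t\<^sup>2 * (L * norm u)\<^sup>2"
      using t c(2) L(3)[of u] by (intro add_mono diff_mono mult_left_mono power_mono) auto
    also have "\<dots> = (1 - 2 * t * c + t\<^sup>2 * L\<^sup>2) * (norm u)\<^sup>2"
      by (simp add: algebra_simps power_mult_distrib)
    also have "1 - 2 * t * c + t\<^sup>2 * L\<^sup>2 = 1 - c\<^sup>2 / L\<^sup>2"
      using L by (simp add: t_def field_simps power2_eq_square)
    also have "(1 - c\<^sup>2 / L\<^sup>2) * (norm u)\<^sup>2 = (r * norm u)\<^sup>2"
      using cL by (simp add: r_def power_mult_distrib)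
    finally show "(norm (u - t *\<^sub>R S u))\<^sup>2 \<le> (r * norm u)\<^sup>2" .
  qed (use cL in \<open>simp add: r_def\<close>)
  show ?thesis
    unfolding surj_def
  proof
    fix w
    have "\<exists>!x. x - t *\<^sub>R (S x - w) = x"
    proof (rule banach_fix_type[of r])
      show "\<forall>x y. dist (x - t *\<^sub>R (S x - w)) (y - t *\<^sub>R (S y - w)) \<le> r * dist x y"
      proof (intro allI)
        fix x y
        have "(x - t *\<^sub>R (S x - w)) - (y - t *\<^sub>R (S y - w)) = (x - y) - t *\<^sub>R S (x - y)"
          by (simp add: diff algebra_simps)
        then show "dist (x - t *\<^sub>R (S x - w)) (y - t *\<^sub>R (S y - w)) \<le> r * dist x y"
          using contr[of "x - y"] unfolding dist_norm by (simp only:)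
      qed
    qed (use cL in \<open>auto simp: r_def\<close>)
    then obtain x where "t *\<^sub>R (S x - w) = 0" by (auto simp: algebra_simps)
    then show "\<exists>x. w = S x" using t by auto
  qed
qed

lemma bounded_clinearD:
  assumes "bounded_clinear A"
  shows "bounded_linear A" "A (c *\<^sub>C \<psi>) = c *\<^sub>C A \<psi>" "A (\<phi> + \<psi>) = A \<phi> + A \<psi>"
    "A (\<phi> - \<psi>) = A \<phi> - A \<psi>" "A 0 = 0"
  using assms linear_add[of A] linear_diff[of A] linear_0[of A]
  by (auto simp: bounded_clinear_def bounded_linear.linear)

lemma bounded_clinearI:
  assumes "\<And>\<phi> \<psi>. A (\<phi> + \<psi>) = A \<phi> + A \<psi>" "\<And>c \<psi>. A (c *\<^sub>C \<psi>) = c *\<^sub>C A \<psi>"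
    "\<And>\<psi>. norm (A \<psi>) \<le> K * norm \<psi>"
  shows "bounded_clinear A"
  unfolding bounded_clinear_def
  by (intro conjI bounded_linear_intro[where K = K]) (use assms in \<open>auto simp: scaleR_ell2_eq mult.commute\<close>)

lemma bounded_clinear_id: "bounded_clinear (\<lambda>\<psi>. \<psi>)"
  by (rule bounded_clinearI[where K = 1]) auto

lemma bounded_clinear_cscale: "bounded_clinear A \<Longrightarrow> bounded_clinear (\<lambda>\<psi>. c *\<^sub>C A \<psi>)"
proof -
  assume A: "bounded_clinear A"
  then obtain K where K: "\<And>x. norm (A x) \<le> K * norm x"
    using bounded_linear.bounded[of A] by (auto simp: bounded_clinear_def mult.commute)
  have "norm (c *\<^sub>C A \<psi>) \<le> (cmod c * K) * norm \<psi>" for \<psi>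
    using mult_left_mono[OF K[of \<psi>], of "cmod c"] by (simp add: mult.assoc)
  then show ?thesis
    by (intro bounded_clinearI[where K = "cmod c * K"])
      (simp_all add: bounded_clinearD[OF A] cscale_add_right mult.commute)
qed

lemma bounded_clinear_add:
  "bounded_clinear A \<Longrightarrow> bounded_clinear B \<Longrightarrow> bounded_clinear (\<lambda>\<psi>. A \<psi> + B \<psi>)"
  unfolding bounded_clinear_def by (auto intro: bounded_linear_add simp: cscale_add_right)

lemma bounded_clinear_diff:
  "bounded_clinear A \<Longrightarrow> bounded_clinear B \<Longrightarrow> bounded_clinear (\<lambda>\<psi>. A \<psi> - B \<psi>)"
  unfolding bounded_clinear_def by (auto intro: bounded_linear_sub simp: cscale_diff_right)

lemma bounded_clinear_compose:
  "bounded_clinear A \<Longrightarrow> bounded_clinear B \<Longrightarrow> bounded_clinear (\<lambda>\<psi>. A (B \<psi>))"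
  unfolding bounded_clinear_def by (auto intro: bounded_linear_compose)

lemma bounded_clinear_shift: "bounded_clinear A \<Longrightarrow> bounded_clinear (\<lambda>\<psi>. A \<psi> - z *\<^sub>C \<psi>)"
  by (intro bounded_clinear_diff bounded_clinear_cscale bounded_clinear_id)

definition invertible_op :: "(ell2 \<Rightarrow> ell2) \<Rightarrow> bool" where
  "invertible_op A \<longleftrightarrow> (\<exists>B. bounded_clinear B \<and> (\<forall>\<psi>. B (A \<psi>) = \<psi>) \<and> (\<forall>\<psi>. A (B \<psi>) = \<psi>))"

lemma spectrum_iff: "z \<in> spectrum A \<longleftrightarrow> \<not> invertible_op (\<lambda>\<psi>. A \<psi> - z *\<^sub>C \<psi>)"
  by (simp add: spectrum_def invertible_op_def)

definition bounded_below :: "(ell2 \<Rightarrow> ell2) \<Rightarrow> bool" where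
  "bounded_below A \<longleftrightarrow> (\<exists>c>0. \<forall>\<psi>. c * norm \<psi> \<le> norm (A \<psi>))"

lemma invertible_opI:
  assumes A: "bounded_clinear A" and "bounded_below A" "surj A"
  shows "invertible_op A"
proof -
  obtain c where c: "c > 0" "\<And>\<psi>. c * norm \<psi> \<le> norm (A \<psi>)"
    using assms(2) by (auto simp: bounded_below_def)
  note A = bounded_clinearD[OF A]
  have "inj A"
  proof (rule injI)
    fix x y assume "A x = A y"
    then have "c * norm (x - y) \<le> 0" using c(2)[of "x - y"] by (simp add: A)
    then show "x = y" using c(1) by (simp add: mult_le_0_iff)
  qed
  then have inv: "inv A (A \<psi>) = \<psi>" "A (inv A \<psi>) = \<psi>" for \<psi>
    using \<open>surj A\<close> by (auto simp: surj_f_inv_f)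
  have eq: "inv A \<phi> = \<xi>" if "A \<xi> = \<phi>" for \<phi> \<xi>
    using that inv(1) by auto
  have "bounded_clinear (inv A)"
  proof (rule bounded_clinearI[where K = "1 / c"])
    show "norm (inv A \<psi>) \<le> 1 / c * norm \<psi>" for \<psi>
      using c(2)[of "inv A \<psi>"] c(1) by (simp add: inv field_simps)
  qed (auto intro!: eq simp: A inv)
  then show ?thesis using inv by (auto simp: invertible_op_def)
qed

lemma invertible_op_bounded_below:
  assumes "invertible_op A" shows "bounded_below A"
proof -
  obtain B where B: "bounded_clinear B" "\<And>\<psi>. B (A \<psi>) = \<psi>"
    using assms by (auto simp: invertible_op_def)
  obtain K where K: "K > 0" "\<And>x. norm (B x) \<le> norm x * K"
    using bounded_linear.pos_bounded[OF bounded_clinearD(1)[OF B(1)]] by blast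
  have "1 / K * norm \<psi> \<le> norm (A \<psi>)" for \<psi>
    using K(2)[of "A \<psi>"] K(1) by (simp add: B field_simps)
  then show ?thesis using K(1) unfolding bounded_below_def by (intro exI[of _ "1 / K"]) auto
qed

lemma invertible_op_compose:
  assumes "invertible_op A" "invertible_op B" shows "invertible_op (\<lambda>\<psi>. A (B \<psi>))"
proof -
  obtain A' B' where "bounded_clinear A'" "\<And>\<psi>. A' (A \<psi>) = \<psi>" "\<And>\<psi>. A (A' \<psi>) = \<psi>"
    "bounded_clinear B'" "\<And>\<psi>. B' (B \<psi>) = \<psi>" "\<And>\<psi>. B (B' \<psi>) = \<psi>"
    using assms unfolding invertible_op_def by blast
  then show ?thesis unfolding invertible_op_def
    by (intro exI[of _ "\<lambda>\<psi>. B' (A' \<psi>)"]) (auto intro: bounded_clinear_compose)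
qed

lemma invertible_op_cscale: "c \<noteq> 0 \<Longrightarrow> invertible_op (\<lambda>\<psi>. c *\<^sub>C \<psi>)"
  unfolding invertible_op_def
  by (intro exI[of _ "\<lambda>\<psi>. (1 / c) *\<^sub>C \<psi>"]) (auto intro: bounded_clinear_cscale bounded_clinear_id)

text \<open>Coercivity makes \<open>E F\<close> surjective; since the factors commute, the outer one
  may be taken to be \<open>F\<close>, which is then surjective itself. Boundedness of
  \<open>E\<close> turns coercivity of the product into a lower bound for \<open>F\<close>.\<close>

lemma invertible_op_factor:
  assumes E: "bounded_clinear E" and F: "bounded_clinear F"
    and comm: "\<And>\<psi>. E (F \<psi>) = F (E \<psi>)"
    and c: "c > 0" "\<And>\<psi>. c * (norm \<psi>)\<^sup>2 \<le> inner \<psi> (E (F \<psi>))"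
  shows "invertible_op F"
proof (rule invertible_opI[OF F])
  have "surj (\<lambda>\<psi>. E (F \<psi>))"
    by (rule coercive_surj[OF _ c]) (use E F in \<open>auto simp: bounded_clinear_def intro: bounded_linear_compose\<close>)
  then show "surj F" unfolding comm surj_def by metis
  obtain K where K: "K > 0" "\<And>x. norm (E x) \<le> norm x * K"
    using bounded_linear.pos_bounded[OF bounded_clinearD(1)[OF E]] by blast
  have "c / K * norm \<psi> \<le> norm (F \<psi>)" for \<psi>
  proof (cases "\<psi> = 0")
    case False
    have "c * (norm \<psi>)\<^sup>2 \<le> norm \<psi> * norm (E (F \<psi>))"
      using c(2)[of \<psi>] norm_cauchy_schwarz[of \<psi> "E (F \<psi>)"] by linarith
    then have "norm \<psi> * (c * norm \<psi>) \<le> norm \<psi> * norm (E (F \<psi>))"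
      by (simp add: power2_eq_square mult_ac)
    then have "c * norm \<psi> \<le> norm (E (F \<psi>))" using False by simp
    also have "\<dots> \<le> norm (F \<psi>) * K" by (rule K)
    finally show ?thesis using K(1) by (simp add: field_simps)
  qed simp
  then show "bounded_below F" unfolding bounded_below_def
    using c(1) K(1) by (intro exI[of _ "c / K"]) auto
qed

section \<open>Spectra of self-adjoint operators\<close>

definition self_adjoint :: "(ell2 \<Rightarrow> ell2) \<Rightarrow> bool" where
  "self_adjoint A \<longleftrightarrow> bounded_clinear A \<and> (\<forall>\<phi> \<psi>. cinner (A \<phi>) \<psi> = cinner \<phi> (A \<psi>))"

lemma inner_shift:
  assumes "self_adjoint A"
  shows "inner \<phi> (A \<psi> - z *\<^sub>C \<psi>) = inner (A \<phi> - cnj z *\<^sub>C \<phi>) \<psi>"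
proof -
  have "cinner (A \<phi> - cnj z *\<^sub>C \<phi>) \<psi> + cinner (cnj z *\<^sub>C \<phi>) \<psi> = cinner (A \<phi>) \<psi>"
    by (simp add: cinner_add_left[symmetric])
  then have "cinner (A \<phi> - cnj z *\<^sub>C \<phi>) \<psi> = cinner \<phi> (A \<psi> - z *\<^sub>C \<psi>)"
    using assms by (simp add: cinner_diff_right cinner_cscale_left cinner_cscale_right
        self_adjoint_def algebra_simps)
  then show ?thesis by (simp add: inner_ell2_def)
qed

lemma shift_commute:
  assumes "bounded_clinear A"
  shows "A (A \<psi> - z *\<^sub>C \<psi>) - w *\<^sub>C (A \<psi> - z *\<^sub>C \<psi>) = A (A \<psi> - w *\<^sub>C \<psi>) - z *\<^sub>C (A \<psi> - w *\<^sub>C \<psi>)"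
  by (rule ell2_eqI) (simp add: bounded_clinearD[OF assms] algebra_simps)

text \<open>With \<open>x = Re z\<close>, the product of \<open>A - cnj z\<close> and
  \<open>A - z\<close> is \<open>(A - x)\<^sup>2 + (Im z)\<^sup>2\<close>, which is coercive off the
  real axis.\<close>

lemma self_adjoint_spectrum_real:
  assumes A: "self_adjoint A" and z: "z \<in> spectrum A"
  shows "Im z = 0"
proof (rule ccontr)
  assume Im: "Im z \<noteq> 0"
  have bA: "bounded_clinear A" using A by (simp add: self_adjoint_def)
  define x where "x = complex_of_real (Re z)"
  have x: "cnj x = x" by (simp add: x_def)
  have "invertible_op (\<lambda>\<psi>. A \<psi> - z *\<^sub>C \<psi>)"
  proof (rule invertible_op_factor[where E = "\<lambda>\<psi>. A \<psi> - cnj z *\<^sub>C \<psi>" and c = "(Im z)\<^sup>2"])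
    fix \<psi>
    have "A (A \<psi> - z *\<^sub>C \<psi>) - cnj z *\<^sub>C (A \<psi> - z *\<^sub>C \<psi>)
        = (A (A \<psi> - x *\<^sub>C \<psi>) - x *\<^sub>C (A \<psi> - x *\<^sub>C \<psi>)) + ((Im z)\<^sup>2) *\<^sub>R \<psi>"
      unfolding scaleR_ell2_eq
      by (rule ell2_eqI) (simp add: bounded_clinearD[OF bA] x_def algebra_simps complex_eq_iff power2_eq_square)
    moreover have "inner \<psi> (A (A \<psi> - x *\<^sub>C \<psi>) - x *\<^sub>C (A \<psi> - x *\<^sub>C \<psi>)) = (norm (A \<psi> - x *\<^sub>C \<psi>))\<^sup>2"
      by (simp add: inner_shift[OF A] x power2_norm_eq_inner)
    ultimately show "(Im z)\<^sup>2 * (norm \<psi>)\<^sup>2 \<le> inner \<psi> (A (A \<psi> - z *\<^sub>C \<psi>) - cnj z *\<^sub>C (A \<psi> - z *\<^sub>C \<psi>))"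
      by (simp add: inner_add_right power2_norm_eq_inner[symmetric])
  qed (use Im bA in \<open>auto intro: bounded_clinear_shift shift_commute\<close>)
  then show False using z by (simp add: spectrum_iff)
qed

text \<open>Weyl's criterion. A lower bound for \<open>A - x\<close> makes
  \<open>(A - x)\<^sup>2\<close> coercive, so surjectivity comes for free; from here on, real
  spectra are handled by norm estimates alone.\<close>

lemma self_adjoint_spectrum_iff:
  assumes A: "self_adjoint A"
  shows "complex_of_real x \<in> spectrum A \<longleftrightarrow> \<not> bounded_below (\<lambda>\<psi>. A \<psi> - complex_of_real x *\<^sub>C \<psi>)"
proof -
  have bA: "bounded_clinear A" using A by (simp add: self_adjoint_def)
  let ?S = "\<lambda>\<psi>. A \<psi> - complex_of_real x *\<^sub>C \<psi>"
  have "invertible_op ?S" if "bounded_below ?S"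
  proof -
    obtain c where c: "c > 0" "\<And>\<psi>. c * norm \<psi> \<le> norm (?S \<psi>)"
      using \<open>bounded_below ?S\<close> by (auto simp: bounded_below_def)
    show ?thesis
    proof (rule invertible_op_factor[where E = ?S and c = "c\<^sup>2"])
      fix \<psi>
      have "inner \<psi> (?S (?S \<psi>)) = (norm (?S \<psi>))\<^sup>2"
        by (simp add: inner_shift[OF A] power2_norm_eq_inner)
      moreover have "(c * norm \<psi>)\<^sup>2 \<le> (norm (?S \<psi>))\<^sup>2"
        using c by (intro power_mono) auto
      ultimately show "c\<^sup>2 * (norm \<psi>)\<^sup>2 \<le> inner \<psi> (?S (?S \<psi>))"
        by (simp add: power_mult_distrib)
    qed (use c bA in \<open>auto intro: bounded_clinear_shift\<close>)
  qed
  then show ?thesis using invertible_op_bounded_below by (auto simp: spectrum_iff)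
qed

lemma spectrum_of_real_image:
  assumes "self_adjoint A"
  shows "spectrum A = complex_of_real ` {x. complex_of_real x \<in> spectrum A}"
proof -
  have "z = complex_of_real (Re z)" if "z \<in> spectrum A" for z
    using self_adjoint_spectrum_real[OF assms that] by (simp add: complex_eq_iff)
  then show ?thesis by (metis (mono_tags, lifting) mem_Collect_eq image_iff set_eqI)
qed

lemma self_adjoint_spectrum_bounded:
  assumes A: "self_adjoint A" and K: "\<And>\<psi>. norm (A \<psi>) \<le> K * norm \<psi>"
    and x: "complex_of_real x \<in> spectrum A"
  shows "\<bar>x\<bar> \<le> K"
proof (rule ccontr)
  assume "\<not> \<bar>x\<bar> \<le> K"
  moreover have "(\<bar>x\<bar> - K) * norm \<psi> \<le> norm (A \<psi> - complex_of_real x *\<^sub>C \<psi>)" for \<psi>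
    using K[of \<psi>] norm_triangle_ineq2[of "complex_of_real x *\<^sub>C \<psi>" "A \<psi>"]
    by (simp add: algebra_simps norm_minus_commute)
  ultimately have "bounded_below (\<lambda>\<psi>. A \<psi> - complex_of_real x *\<^sub>C \<psi>)"
    unfolding bounded_below_def by (intro exI[of _ "\<bar>x\<bar> - K"]) auto
  then show False using x self_adjoint_spectrum_iff[OF A] by blast
qed

lemma self_adjoint_spectrum_closed:
  assumes A: "self_adjoint A"
  shows "closed {x. complex_of_real x \<in> spectrum A}"
  unfolding closed_def open_dist
proof (intro ballI)
  fix x assume "x \<in> - {x. complex_of_real x \<in> spectrum A}"
  then obtain c where c: "c > 0" "\<And>\<psi>. c * norm \<psi> \<le> norm (A \<psi> - complex_of_real x *\<^sub>C \<psi>)"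
    using self_adjoint_spectrum_iff[OF A] by (auto simp: bounded_below_def)
  have "y \<in> - {x. complex_of_real x \<in> spectrum A}" if "dist y x < c / 2" for y
  proof -
    have "c / 2 * norm \<psi> \<le> norm (A \<psi> - complex_of_real y *\<^sub>C \<psi>)" for \<psi>
    proof -
      have eq: "A \<psi> - complex_of_real x *\<^sub>C \<psi> =
          (A \<psi> - complex_of_real y *\<^sub>C \<psi>) + complex_of_real (y - x) *\<^sub>C \<psi>"
        by (rule ell2_eqI) (simp add: algebra_simps)
      have "c * norm \<psi> \<le> norm (A \<psi> - complex_of_real y *\<^sub>C \<psi>) + norm (complex_of_real (y - x) *\<^sub>C \<psi>)"
        using c(2)[of \<psi>] unfolding eq by (rule order_trans[OF _ norm_triangle_ineq])
      then have "c * norm \<psi> \<le> norm (A \<psi> - complex_of_real y *\<^sub>C \<psi>) + \<bar>y - x\<bar> * norm \<psi>"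
        by (simp only: norm_cscale norm_of_real)
      moreover have "\<bar>y - x\<bar> * norm \<psi> \<le> c / 2 * norm \<psi>"
        using that by (intro mult_right_mono) (auto simp: dist_real_def)
      ultimately show ?thesis by (simp add: field_simps)
    qed
    then show ?thesis using self_adjoint_spectrum_iff[OF A] c(1)
      by (auto simp: bounded_below_def intro!: exI[of _ "c / 2"])
  qed
  then show "\<exists>e>0. \<forall>y. dist y x < e \<longrightarrow> y \<in> - {x. complex_of_real x \<in> spectrum A}"
    using c(1) by (intro exI[of _ "c / 2"]) auto
qed

section \<open>Polynomials of an operator\<close>

lemma poly_op_eq:
  assumes "degree f \<le> N" shows "poly_op f A \<psi> = (\<Sum>i\<le>N. coeff f i *\<^sub>C (A ^^ i) \<psi>)"
  unfolding poly_op_def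
  by (rule sum.mono_neutral_left) (use assms in \<open>auto simp: coeff_eq_0\<close>)

lemma poly_op_0 [simp]: "poly_op 0 A \<psi> = 0"
  by (simp add: poly_op_def)

lemma poly_op_add: "poly_op (f + g) A \<psi> = poly_op f A \<psi> + poly_op g A \<psi>"
proof -
  let ?N = "max (degree f) (degree g)"
  have "degree (f + g) \<le> ?N" by (rule degree_add_le_max)
  then show ?thesis
    by (simp add: poly_op_eq[of _ ?N] sum.distrib[symmetric] cscale_add_left)
qed

lemma poly_op_smult: "poly_op (smult c f) A \<psi> = c *\<^sub>C poly_op f A \<psi>"
  by (simp add: poly_op_eq[of _ "degree f"] cscale_sum_right)

lemma poly_op_diff: "poly_op (f - g) A \<psi> = poly_op f A \<psi> - poly_op g A \<psi>"
  using poly_op_add[of "f - g" g A \<psi>] by (simp add: algebra_simps)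

lemma poly_op_pCons:
  assumes A: "bounded_clinear A"
  shows "poly_op (pCons a f) A \<psi> = a *\<^sub>C \<psi> + A (poly_op f A \<psi>)"
proof -
  have sum: "A (\<Sum>i\<in>I. g i) = (\<Sum>i\<in>I. A (g i))" for g and I :: "nat set"
    by (induction I rule: infinite_finite_induct) (auto simp: bounded_clinearD[OF A])
  have "poly_op (pCons a f) A \<psi> = (\<Sum>i\<le>Suc (degree f). coeff (pCons a f) i *\<^sub>C (A ^^ i) \<psi>)"
    by (rule poly_op_eq) (simp add: degree_pCons_le)
  also have "\<dots> = a *\<^sub>C \<psi> + A (poly_op f A \<psi>)"
    by (simp add: sum.atMost_Suc_shift poly_op_def sum bounded_clinearD[OF A] del: sum.atMost_Suc)
  finally show ?thesis .
qed

lemma poly_op_bounded_clinear: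
  assumes A: "bounded_clinear A" shows "bounded_clinear (poly_op f A)"
proof (induction f)
  case 0
  have "bounded_clinear (\<lambda>\<psi>. 0)" by (rule bounded_clinearI[where K = 0]) auto
  moreover have "poly_op 0 A = (\<lambda>\<psi>. 0)" by (rule ext) simp
  ultimately show ?case by simp
next
  case (pCons a f)
  have "poly_op (pCons a f) A = (\<lambda>\<psi>. a *\<^sub>C \<psi> + A (poly_op f A \<psi>))"
    by (rule ext) (rule poly_op_pCons[OF A])
  then show ?case
    using bounded_clinear_add[OF bounded_clinear_cscale[OF bounded_clinear_id] bounded_clinear_compose[OF A pCons.IH]]
    by simp
qed

lemma poly_op_mult:
  assumes A: "bounded_clinear A"
  shows "poly_op (f * g) A \<psi> = poly_op f A (poly_op g A \<psi>)"
  by (induction f) (simp_all add: poly_op_pCons[OF A] poly_op_add poly_op_smult)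

lemma poly_op_linear_factor:
  assumes A: "bounded_clinear A" shows "poly_op [:- z, 1:] A \<psi> = A \<psi> - z *\<^sub>C \<psi>"
  by (rule ell2_eqI) (simp add: poly_op_pCons[OF A] bounded_clinearD[OF A])

lemma poly_op_const:
  assumes A: "bounded_clinear A" shows "poly_op [:c:] A \<psi> = c *\<^sub>C \<psi>"
  by (simp add: poly_op_pCons[OF A] bounded_clinearD[OF A])

lemma poly_op_commute:
  assumes A: "bounded_clinear A" shows "poly_op f A (A \<psi>) = A (poly_op f A \<psi>)"
  using poly_op_mult[OF A, of f "[:0, 1:]"] poly_op_mult[OF A, of "[:0, 1:]" f]
    poly_op_linear_factor[OF A, of 0] by (simp add: mult.commute del: mult_pCons_left mult_pCons_right)

lemma cinner_poly_op:
  assumes A: "self_adjoint A"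
  shows "cinner (poly_op f A \<phi>) \<psi> = cinner \<phi> (poly_op (map_poly cnj f) A \<psi>)"
proof -
  have bA: "bounded_clinear A" using A by (simp add: self_adjoint_def)
  show ?thesis
  proof (induction f arbitrary: \<psi>)
    case (pCons a f)
    have "map_poly cnj (pCons a f) = pCons (cnj a) (map_poly cnj f)"
      by (rule map_poly_pCons) (use pCons.hyps in auto)
    then show ?case
      using A by (simp add: poly_op_pCons[OF bA] cinner_add_left cinner_add_right cinner_cscale_left
          cinner_cscale_right pCons.IH self_adjoint_def poly_op_commute[OF bA])
  qed simp
qed

lemma poly_map_cnj: "poly (map_poly cnj f) (complex_of_real x) = cnj (poly f (complex_of_real x))"
  by (induction f) (auto simp: map_poly_pCons)

text \<open>Over \<open>\<complex>\<close> the polynomial \<open>f\<close> splits into linear factors.\<close>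

lemma invertible_poly_op:
  assumes A: "bounded_clinear A" and f: "f \<noteq> 0" and z: "\<And>z. poly f z = 0 \<Longrightarrow> z \<notin> spectrum A"
  shows "invertible_op (poly_op f A)"
proof -
  obtain Z where Z: "f = smult (lead_coeff f) (\<Prod>x\<in>#Z. [:-x, 1:])"
    using alg_closed_imp_factorization[OF f] by blast
  \<comment> \<open>Quantifying over sub-multisets keeps the information that each factor belongs to
    a root of \<open>f\<close> throughout the multiset induction.\<close>
  have "invertible_op (poly_op (\<Prod>x\<in>#Z'. [:-x, 1:]) A)" if "Z' \<subseteq># Z" for Z'
    using that
  proof (induction Z')
    case empty
    have "poly_op 1 A = (\<lambda>\<psi>. \<psi>)" by (rule ext) (simp add: poly_op_def)
    then show ?case using invertible_op_cscale[of 1] by simp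
  next
    case (add x Z')
    have x: "x \<in># Z" and Z': "Z' \<subseteq># Z"
      using mset_subset_eq_insertD[OF add.prems] by (auto simp: subset_mset.less_imp_le)
    have "poly f x = 0" using x by (subst Z) (auto simp: poly_prod_mset prod_mset_zero_iff)
    then have "invertible_op (\<lambda>\<psi>. A \<psi> - x *\<^sub>C \<psi>)" using z[of x] by (simp add: spectrum_iff)
    then have "invertible_op (\<lambda>\<psi>. A (poly_op (\<Prod>x\<in>#Z'. [:-x, 1:]) A \<psi>) - x *\<^sub>C poly_op (\<Prod>x\<in>#Z'. [:-x, 1:]) A \<psi>)"
      using invertible_op_compose[of "\<lambda>\<psi>. A \<psi> - x *\<^sub>C \<psi>" "poly_op (\<Prod>x\<in>#Z'. [:-x, 1:]) A"] add.IH[OF Z']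
      by blast
    moreover have "poly_op (\<Prod>x\<in>#add_mset x Z'. [:-x, 1:]) A
        = (\<lambda>\<psi>. A (poly_op (\<Prod>x\<in>#Z'. [:-x, 1:]) A \<psi>) - x *\<^sub>C poly_op (\<Prod>x\<in>#Z'. [:-x, 1:]) A \<psi>)"
      by (rule ext) (simp only: image_mset_add_mset prod_mset.add_mset poly_op_mult[OF A] poly_op_linear_factor[OF A])
    ultimately show ?case by (simp only:)
  qed
  from this[OF subset_mset.order_refl] invertible_op_cscale[of "lead_coeff f"] f
  have "invertible_op (\<lambda>\<psi>. lead_coeff f *\<^sub>C poly_op (\<Prod>x\<in>#Z. [:-x, 1:]) A \<psi>)"
    using invertible_op_compose[of "\<lambda>\<psi>. lead_coeff f *\<^sub>C \<psi>"] by auto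
  also have "(\<lambda>\<psi>. lead_coeff f *\<^sub>C poly_op (\<Prod>x\<in>#Z. [:-x, 1:]) A \<psi>) = poly_op f A"
    by (subst (3) Z) (simp add: poly_op_smult fun_eq_iff)
  finally show ?thesis .
qed

text \<open>
  With \<open>M = \<parallel>f(A)\<parallel>\<close>, unit vectors almost attaining the norm of \<open>f(A)\<close> show that
  \<open>f(A)\<^sup>* f(A) - M\<^sup>2\<close> is not bounded below, so that \<open>\<bar>f\<bar>\<^sup>2\<close> takes the value \<open>M\<^sup>2\<close> on the spectrum.
\<close>

lemma onorm_poly_op_attained:
  assumes A: "self_adjoint A" and M: "onorm (poly_op f A) > 0"
    and P: "map_poly cnj f * f \<noteq> [:complex_of_real ((onorm (poly_op f A))\<^sup>2):]"
  obtains x where "complex_of_real x \<in> spectrum A" "cmod (poly f (complex_of_real x)) = onorm (poly_op f A)"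
proof -
  have bA: "bounded_clinear A" using A by (simp add: self_adjoint_def)
  have bl: "bounded_linear (poly_op f A)"
    using poly_op_bounded_clinear[OF bA] by (simp add: bounded_clinear_def)
  define M where "M = onorm (poly_op f A)"
  have M: "M > 0" "norm (poly_op f A \<psi>) \<le> M * norm \<psi>" for \<psi>
    using M onorm[OF bl] by (auto simp: M_def)
  let ?F = "poly_op f A" and ?G = "poly_op (map_poly cnj f) A"
  \<comment> \<open>The third assumption amounts to \<open>P \<noteq> 0\<close>: without it there is
    no factorization from which a spectral root could be read off.\<close>
  define P where "P = map_poly cnj f * f - [:complex_of_real (M\<^sup>2):]"
  have PA: "poly_op P A \<psi> = ?G (?F \<psi>) - complex_of_real (M\<^sup>2) *\<^sub>C \<psi>" for \<psi>
    by (simp add: P_def poly_op_diff poly_op_mult[OF bA] poly_op_const[OF bA])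
  have "\<not> bounded_below (poly_op P A)"
  proof
    assume "bounded_below (poly_op P A)"
    then obtain c where c: "c > 0" "\<And>\<psi>. c * norm \<psi> \<le> norm (poly_op P A \<psi>)"
      by (auto simp: bounded_below_def)
    have GF: "inner (?G (?F \<psi>)) \<psi> = (norm (?F \<psi>))\<^sup>2" for \<psi>
    proof -
      have "inner (?G (?F \<psi>)) \<psi> = Re (cinner \<psi> (?G (?F \<psi>)))"
        by (simp add: inner_ell2_def cinner_commute[of "?G (?F \<psi>)"])
      also have "\<dots> = (norm (?F \<psi>))\<^sup>2"
        by (simp add: cinner_poly_op[OF A, symmetric] cinner_self)
      finally show ?thesis .
    qed
    have Gn: "norm (?G \<phi>) \<le> M * norm \<phi>" for \<phi>
    proof (cases "?G \<phi> = 0")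
      case False
      have "(norm (?G \<phi>))\<^sup>2 = cmod (cinner (?F (?G \<phi>)) \<phi>)"
        by (simp add: cinner_poly_op[OF A] cinner_self)
          (simp add: cinner_self norm_power)?
      also have "\<dots> \<le> norm (?F (?G \<phi>)) * norm \<phi>" by (rule cmod_cinner_le)
      also have "\<dots> \<le> M * norm (?G \<phi>) * norm \<phi>" by (intro mult_right_mono M) auto
      finally show ?thesis using False by (simp add: power2_eq_square mult_ac)
    qed (use M in simp)
    \<comment> \<open>Expanding the square and inserting \<open>Gn\<close> leaves
      \<open>M\<^sup>2\<close> times \<open>M\<^sup>2 \<parallel>\<psi>\<parallel>\<^sup>2 -
      \<parallel>?F \<psi>\<parallel>\<^sup>2\<close>, which is nonnegative; the factor 2 is
      slack.\<close>
    have key: "c\<^sup>2 * (norm \<psi>)\<^sup>2 \<le> 2 * M\<^sup>2 * (M\<^sup>2 * (norm \<psi>)\<^sup>2 - (norm (?F \<psi>))\<^sup>2)" for \<psi>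
    proof -
      have "(c * norm \<psi>)\<^sup>2 \<le> (norm (poly_op P A \<psi>))\<^sup>2"
        using c by (intro power_mono) auto
      also have "\<dots> = (norm (?G (?F \<psi>)))\<^sup>2 - 2 * M\<^sup>2 * (norm (?F \<psi>))\<^sup>2 + M\<^sup>2 * M\<^sup>2 * (norm \<psi>)\<^sup>2"
        unfolding PA scaleR_ell2_eq[symmetric] GF[symmetric] power2_norm_eq_inner[of "_ - _"]
        by (simp add: inner_diff_left inner_diff_right inner_commute power2_norm_eq_inner GF)
      also have "(norm (?G (?F \<psi>)))\<^sup>2 \<le> (M * norm (?F \<psi>))\<^sup>2"
        by (intro power_mono Gn) auto
      also have "(M * norm (?F \<psi>))\<^sup>2 - 2 * M\<^sup>2 * (norm (?F \<psi>))\<^sup>2 + M\<^sup>2 * M\<^sup>2 * (norm \<psi>)\<^sup>2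
          \<le> 2 * M\<^sup>2 * (M\<^sup>2 * (norm \<psi>)\<^sup>2 - (norm (?F \<psi>))\<^sup>2)"
      proof -
        have "M\<^sup>2 * (norm (?F \<psi>))\<^sup>2 \<le> M\<^sup>2 * (M * norm \<psi>)\<^sup>2"
          by (intro mult_left_mono power_mono M) auto
        then show ?thesis by (simp add: algebra_simps power_mult_distrib)
      qed
      finally show ?thesis by (simp add: power_mult_distrib)
    qed
    \<comment> \<open>By \<open>key\<close>, the norm of \<open>?F\<close> is at most the root of
      \<open>M\<^sup>2 - d\<close>, contradicting the choice of \<open>M\<close>. The sign of
      \<open>M\<^sup>2 - d\<close> is not known, hence \<open>max 0\<close> under the root.\<close>
    define d where "d = c\<^sup>2 / (2 * M\<^sup>2)"
    have "(norm (?F \<psi>))\<^sup>2 \<le> (M\<^sup>2 - d) * (norm \<psi>)\<^sup>2" for \<psi>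
      using key[of \<psi>] M(1) by (simp add: d_def field_simps)
    moreover have "d > 0" using c M by (simp add: d_def)
    ultimately have "(norm (?F \<psi>))\<^sup>2 \<le> (sqrt (max 0 (M\<^sup>2 - d)) * norm \<psi>)\<^sup>2" for \<psi>
      by (simp add: power_mult_distrib) (meson max.cobounded2 mult_right_mono order_trans zero_le_power2)
    then have "norm (?F \<psi>) \<le> sqrt (max 0 (M\<^sup>2 - d)) * norm \<psi>" for \<psi>
      by (rule power2_le_imp_le) simp
    then have "M \<le> sqrt (max 0 (M\<^sup>2 - d))"
      unfolding M_def by (intro onorm_bound) (auto simp: M_def)
    then have "M\<^sup>2 \<le> max 0 (M\<^sup>2 - d)"
      using M(1) by (metis max.cobounded1 power_mono real_sqrt_pow2 less_imp_le)
    then show False using \<open>d > 0\<close> M(1) by (auto simp: max_def split: if_splits)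
  qed
  moreover have "P \<noteq> 0" using P by (simp add: P_def M_def)
  ultimately obtain z where z: "poly P z = 0" "z \<in> spectrum A"
    using invertible_poly_op[OF bA] invertible_op_bounded_below by blast
  define x where "x = Re z"
  have x: "z = complex_of_real x"
    using self_adjoint_spectrum_real[OF A z(2)] by (simp add: x_def complex_eq_iff)
  have "complex_of_real ((cmod (poly f z))\<^sup>2) = complex_of_real (M\<^sup>2)"
    using z(1) unfolding P_def x by (simp add: poly_map_cnj complex_norm_square mult.commute del: of_real_power)
  then have "(cmod (poly f z))\<^sup>2 = M\<^sup>2" by (simp only: of_real_eq_iff)
  then have "cmod (poly f z) = M" using M(1) by (simp add: power2_eq_iff_nonneg)
  then show ?thesis using that z(2) by (simp add: x M_def)
qed

text \<open>For the polynomial \<open>x\<close> the norm of \<open>A\<close> is attained on the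
  spectrum. The remaining case is \<open>A = 0\<close>, where \<open>0\<close> itself is
  spectral.\<close>

lemma self_adjoint_spectrum_nonempty:
  assumes A: "self_adjoint A" shows "\<exists>x. complex_of_real x \<in> spectrum A"
proof -
  have bA: "bounded_clinear A" using A by (simp add: self_adjoint_def)
  have X: "poly_op [:0, 1:] A = A"
    using poly_op_linear_factor[OF bA, of 0] by (simp add: fun_eq_iff)
  have bl: "bounded_linear A" using bA by (simp add: bounded_clinear_def)
  show ?thesis
  proof (cases "onorm A = 0")
    case True
    then have "A \<psi> = 0" for \<psi> using onorm[OF bl, of \<psi>] by simp
    then have "\<not> bounded_below (\<lambda>\<psi>. A \<psi> - complex_of_real 0 *\<^sub>C \<psi>)"
      by (auto simp: bounded_below_def intro!: exI[of _ "delta 0"])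
    then show ?thesis using self_adjoint_spectrum_iff[OF A, of 0] by blast
  next
    case False
    have "map_poly cnj [:0, 1:] * [:0, 1:] \<noteq> [:complex_of_real ((onorm A)\<^sup>2):]"
      by (simp add: map_poly_pCons)
    then show ?thesis
      using onorm_poly_op_attained[OF A, of "[:0, 1:]"] False onorm_pos_le[OF bl] X
      by (metis less_eq_real_def)
  qed
qed

text \<open>In the case excluded from \<open>onorm_poly_op_attained\<close>,
  \<open>cmod (poly f x)\<close> is constant on the reals and equal to the operator norm, so any
  spectral point attains it; this is where nonemptiness of the spectrum enters.\<close>

lemma norm_poly_op_le:
  assumes A: "self_adjoint A"
    and K: "\<And>x. complex_of_real x \<in> spectrum A \<Longrightarrow> cmod (poly f (complex_of_real x)) \<le> K"
  shows "norm (poly_op f A \<psi>) \<le> K * norm \<psi>"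
proof -
  have bA: "bounded_clinear A" using A by (simp add: self_adjoint_def)
  have bl: "bounded_linear (poly_op f A)"
    using poly_op_bounded_clinear[OF bA] by (simp add: bounded_clinear_def)
  obtain x0 where x0: "complex_of_real x0 \<in> spectrum A"
    using self_adjoint_spectrum_nonempty[OF A] by blast
  have "onorm (poly_op f A) \<le> K"
  proof (cases "onorm (poly_op f A) > 0")
    case pos: True
    have "\<exists>x. complex_of_real x \<in> spectrum A \<and> cmod (poly f (complex_of_real x)) = onorm (poly_op f A)"
    proof (cases "map_poly cnj f * f = [:complex_of_real ((onorm (poly_op f A))\<^sup>2):]")
      case True
      have "complex_of_real ((cmod (poly f x0))\<^sup>2) = complex_of_real ((onorm (poly_op f A))\<^sup>2)"
        using arg_cong[OF True, of "\<lambda>p. poly p x0"]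
        by (simp add: poly_map_cnj complex_norm_square mult.commute del: of_real_power)
      then have "cmod (poly f x0) = onorm (poly_op f A)"
        using pos by (simp only: of_real_eq_iff) (simp add: power2_eq_iff_nonneg)
      then show ?thesis using x0 by blast
    qed (use onorm_poly_op_attained[OF A pos] in blast)
    then show ?thesis using K by metis
  next
    case False
    then show ?thesis using K[OF x0] norm_ge_zero[of "poly f (complex_of_real x0)"] by linarith
  qed
  then have "onorm (poly_op f A) * norm \<psi> \<le> K * norm \<psi>" by (rule mult_right_mono) simp
  then show ?thesis using onorm[OF bl, of \<psi>] by linarith
qed

section \<open>The continuous functional calculus\<close>

lemma obtain_scale:
  fixes a d :: real
  assumes "0 \<le> a" "0 < d" obtains e where "e > 0" "e * a < d"
\<comment> \<open>Dividing by \<open>a + 1\<close> rather than by \<open>a\<close> covers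
  \<open>a = 0\<close>.\<close>
proof (rule that[of "d / (a + 1)"])
  have "a + 1 > 0" using assms by simp
  then show "d / (a + 1) > 0" "d / (a + 1) * a < d" using assms by (auto simp: field_simps)
qed

lemma poly_of_real_poly:
  "poly (map_poly complex_of_real p) (complex_of_real x) = complex_of_real (poly p x)"
  by (induction p) (auto simp: map_poly_pCons)

lemma real_poly_approx:
  fixes h :: "real \<Rightarrow> real"
  assumes "compact S" "continuous_on S h" "e > 0"
  obtains p where "\<And>x. x \<in> S \<Longrightarrow> \<bar>poly p x - h x\<bar> < e"
proof -
  obtain g where g: "polynomial_function g" "\<And>x. x \<in> S \<Longrightarrow> norm (h x - g x) < e"
    using Stone_Weierstrass_polynomial_function[OF assms] by blast
  have "real_polynomial_function g" using g(1) by (simp add: real_polynomial_function_eq)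
  then obtain a n where an: "g = (\<lambda>x. \<Sum>i\<le>n. a i * x ^ i)"
    by (auto simp: real_polynomial_function_iff_sum)
  define p where "p = (\<Sum>i\<le>n. monom (a i) i)"
  have "poly p x = g x" for x by (simp add: p_def an poly_sum poly_monom)
  then show ?thesis using that[of p] g(2) by (simp add: abs_minus_commute)
qed

lemma complex_poly_approx:
  fixes h :: "real \<Rightarrow> complex"
  assumes S: "compact S" "continuous_on S h" and "e > 0"
  obtains p where "\<And>x. x \<in> S \<Longrightarrow> cmod (poly p (complex_of_real x) - h x) < e"
proof -
  have "continuous_on S (\<lambda>x. Re (h x))" "continuous_on S (\<lambda>x. Im (h x))" "e / 2 > 0"
    using assms by (auto intro!: continuous_intros)
  then obtain p q where p: "\<And>x. x \<in> S \<Longrightarrow> \<bar>poly p x - Re (h x)\<bar> < e / 2"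
    and q: "\<And>x. x \<in> S \<Longrightarrow> \<bar>poly q x - Im (h x)\<bar> < e / 2"
    using real_poly_approx[OF S(1)] by metis
  define r where "r = map_poly complex_of_real p + smult \<i> (map_poly complex_of_real q)"
  have "cmod (poly r (complex_of_real x) - h x) < e" if "x \<in> S" for x
  proof -
    let ?d = "poly r (complex_of_real x) - h x"
    have "Re ?d = poly p x - Re (h x)" "Im ?d = poly q x - Im (h x)"
      by (simp_all add: r_def poly_of_real_poly)
    then show ?thesis using cmod_le[of ?d] p[OF that] q[OF that] by linarith
  qed
  then show ?thesis using that by blast
qed

lemma complex_poly_sequence:
  fixes h :: "real \<Rightarrow> complex"
  assumes "compact S" "continuous_on S h"
  obtains f where "uniform_limit S (\<lambda>n x. poly (f n) (complex_of_real x)) h sequentially"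
proof -
  have "\<forall>n. \<exists>p. \<forall>x\<in>S. cmod (poly p (complex_of_real x) - h x) < inverse (real (Suc n))"
    by (metis complex_poly_approx[OF assms] inverse_positive_iff_positive of_nat_0_less_iff zero_less_Suc)
  then obtain f where f: "\<And>n x. x \<in> S \<Longrightarrow> cmod (poly (f n) (complex_of_real x) - h x) < inverse (real (Suc n))"
    by metis
  have "uniform_limit S (\<lambda>n x. poly (f n) (complex_of_real x)) h sequentially"
  proof (rule uniform_limitI)
    fix e :: real assume "e > 0"
    then have "\<forall>\<^sub>F n in sequentially. inverse (real (Suc n)) < e"
      by (intro order_tendstoD[OF LIMSEQ_inverse_real_of_nat])
    then show "\<forall>\<^sub>F n in sequentially. \<forall>x\<in>S. dist (poly (f n) (complex_of_real x)) (h x) < e"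
    proof eventually_elim
      case (elim n)
      show ?case using f[of _ n] elim by (auto simp: dist_norm intro: less_trans)
    qed
  qed
  then show ?thesis using that by blast
qed

lemma cont_calc:
  assumes A: "self_adjoint A" and h: "continuous_on UNIV h"
  shows "bounded_clinear (cont_calc h A)"
    and "(\<And>x. complex_of_real x \<in> spectrum A \<Longrightarrow> cmod (poly f (complex_of_real x) - h x) \<le> e) \<Longrightarrow>
      norm (poly_op f A \<psi> - cont_calc h A \<psi>) \<le> e * norm \<psi>"
proof -
  have bA: "bounded_clinear A" using A by (simp add: self_adjoint_def)
  note bp = poly_op_bounded_clinear[OF bA]
  let ?S = "{x. complex_of_real x \<in> spectrum A}"
  obtain K where "\<And>\<psi>. norm (A \<psi>) \<le> K * norm \<psi>"
    using bounded_linear.bounded[of A] bA by (auto simp: bounded_clinear_def mult.commute)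
  then have "?S \<subseteq> {-K..K}" using self_adjoint_spectrum_bounded[OF A] by (force simp: abs_le_iff)
  then have S: "compact ?S"
    using self_adjoint_spectrum_closed[OF A] compact_Icc bounded_subset
    by (metis (lifting) compact_eq_bounded_closed)
  let ?lim = "\<lambda>f B. uniform_limit ?S (\<lambda>n x. poly (f n) (complex_of_real x)) h sequentially \<and>
        (\<lambda>n. onorm (\<lambda>\<psi>. poly_op (f n) A \<psi> - B \<psi>)) \<longlonglongrightarrow> 0"
  have est: "norm (poly_op f A \<psi> - B \<psi>) \<le> e * norm \<psi>"
    if B: "bounded_clinear B" "?lim g B" and f: "\<And>x. x \<in> ?S \<Longrightarrow> cmod (poly f (complex_of_real x) - h x) \<le> e"
    for B g f e \<psi>
  proof (rule field_le_epsilon)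
    fix d :: real assume "d > 0"
    obtain d' where d': "d' > 0" "d' * norm \<psi> < d / 2"
      using obtain_scale[of "norm \<psi>" "d / 2"] \<open>d > 0\<close> by auto
    have "\<forall>\<^sub>F n in sequentially. \<forall>x\<in>?S. dist (poly (g n) (complex_of_real x)) (h x) < d'"
      using B(2) d'(1) uniform_limitD by blast
    moreover have "\<forall>\<^sub>F n in sequentially. onorm (\<lambda>\<psi>. poly_op (g n) A \<psi> - B \<psi>) < d'"
      using B(2) d'(1) order_tendstoD(2) by blast
    ultimately have "\<forall>\<^sub>F n in sequentially. (\<forall>x\<in>?S. dist (poly (g n) (complex_of_real x)) (h x) < d')
        \<and> onorm (\<lambda>\<psi>. poly_op (g n) A \<psi> - B \<psi>) < d'"
      by (rule eventually_conj)
    then obtain n where n: "\<And>x. x \<in> ?S \<Longrightarrow> dist (poly (g n) (complex_of_real x)) (h x) < d'"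
      "onorm (\<lambda>\<psi>. poly_op (g n) A \<psi> - B \<psi>) < d'"
      using eventually_happens'[OF sequentially_bot] by blast
    have "norm (poly_op (f - g n) A \<psi>) \<le> (e + d') * norm \<psi>"
    proof (rule norm_poly_op_le[OF A])
      fix x assume x: "complex_of_real x \<in> spectrum A"
      let ?x = "complex_of_real x"
      have "poly (f - g n) ?x = (poly f ?x - h x) - (poly (g n) ?x - h x)" by simp
      then show "cmod (poly (f - g n) ?x) \<le> e + d'"
        using f[of x] n(1)[of x] x norm_triangle_ineq4[of "poly f ?x - h x" "poly (g n) ?x - h x"]
        by (simp add: dist_norm)
    qed
    moreover have "bounded_linear (\<lambda>\<psi>. poly_op (g n) A \<psi> - B \<psi>)"
      using bp B(1) by (auto simp: bounded_clinear_def intro: bounded_linear_sub)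
    then have "norm (poly_op (g n) A \<psi> - B \<psi>) \<le> onorm (\<lambda>\<psi>. poly_op (g n) A \<psi> - B \<psi>) * norm \<psi>"
      by (rule onorm)
    then have "norm (poly_op (g n) A \<psi> - B \<psi>) \<le> d' * norm \<psi>"
      using n(2) by (meson less_imp_le mult_right_mono norm_ge_zero order_trans)
    moreover have "poly_op f A \<psi> - B \<psi> = poly_op (f - g n) A \<psi> + (poly_op (g n) A \<psi> - B \<psi>)"
      by (simp add: poly_op_diff)
    ultimately show "norm (poly_op f A \<psi> - B \<psi>) \<le> e * norm \<psi> + d"
      using norm_triangle_ineq[of "poly_op (f - g n) A \<psi>" "poly_op (g n) A \<psi> - B \<psi>"] d'(2)
      by (simp add: algebra_simps)
  qed
  obtain g where g: "uniform_limit ?S (\<lambda>n x. poly (g n) (complex_of_real x)) h sequentially"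
    using complex_poly_sequence[OF S] continuous_on_subset[OF h] by blast
  have cau: "\<exists>M. \<forall>m\<ge>M. \<forall>n\<ge>M. \<forall>\<psi>. norm (poly_op (g m) A \<psi> - poly_op (g n) A \<psi>) \<le> e * norm \<psi>"
    if e: "e > 0" for e
  proof -
    have "\<exists>M. \<forall>n\<ge>M. \<forall>x\<in>?S. dist (poly (g n) (complex_of_real x)) (h x) < e / 2"
      using uniform_limitD[OF g half_gt_zero[OF e]] unfolding eventually_sequentially .
    then obtain M where "\<forall>n\<ge>M. \<forall>x\<in>?S. dist (poly (g n) (complex_of_real x)) (h x) < e / 2" ..
    note M = this[rule_format]
    have "norm (poly_op (g m - g n) A \<psi>) \<le> e * norm \<psi>" if "m \<ge> M" "n \<ge> M" for m n \<psi>
    proof (rule norm_poly_op_le[OF A])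
      fix x assume x: "complex_of_real x \<in> spectrum A"
      have "dist (poly (g m) (complex_of_real x)) (poly (g n) (complex_of_real x)) < e"
        by (rule dist_triangle_half_l[of _ "h x"]) (use M \<open>m \<ge> M\<close> \<open>n \<ge> M\<close> x in auto)
      then show "cmod (poly (g m - g n) (complex_of_real x)) \<le> e" by (simp add: dist_norm)
    qed
    then show ?thesis by (auto simp: poly_op_diff)
  qed
  have "convergent (\<lambda>n. poly_op (g n) A \<psi>)" for \<psi>
    unfolding Cauchy_convergent_iff[symmetric]
  proof (rule metric_CauchyI)
    fix e :: real assume "e > 0"
    then obtain e' where e: "e' > 0" "e' * norm \<psi> < e"
      using obtain_scale[of "norm \<psi>" e] by auto
    from cau[OF e(1)] e(2) show "\<exists>M. \<forall>m\<ge>M. \<forall>n\<ge>M. dist (poly_op (g m) A \<psi>) (poly_op (g n) A \<psi>) < e"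
      unfolding dist_norm by (meson le_less_trans)
  qed
  then have "\<exists>L. \<forall>\<psi>. (\<lambda>n. poly_op (g n) A \<psi>) \<longlonglongrightarrow> L \<psi>"
    by (auto simp: convergent_def intro: choice)
  then obtain L where L: "\<And>\<psi>. (\<lambda>n. poly_op (g n) A \<psi>) \<longlonglongrightarrow> L \<psi>" by blast
  \<comment> \<open>Letting the second index of \<open>cau\<close> tend to infinity keeps the bound
    uniform in \<open>\<psi>\<close>, which upgrades pointwise convergence to convergence in
    operator norm.\<close>
  have close: "\<exists>M. \<forall>m\<ge>M. \<forall>\<psi>. norm (poly_op (g m) A \<psi> - L \<psi>) \<le> e * norm \<psi>" if e: "e > 0" for e
  proof -
    obtain M where M: "\<And>m n \<psi>. m \<ge> M \<Longrightarrow> n \<ge> M \<Longrightarrow> norm (poly_op (g m) A \<psi> - poly_op (g n) A \<psi>) \<le> e * norm \<psi>"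
      using cau[OF e] by blast
    have "norm (poly_op (g m) A \<psi> - L \<psi>) \<le> e * norm \<psi>" if "m \<ge> M" for m \<psi>
      by (rule LIMSEQ_le_const2[OF tendsto_norm[OF tendsto_diff[OF tendsto_const L]]])
        (use M[OF that] in blast)
    then show ?thesis by blast
  qed
  have "bounded_clinear L"
  proof -
    obtain M where M: "\<And>\<psi>. norm (poly_op (g M) A \<psi> - L \<psi>) \<le> norm \<psi>"
      using close[of 1] by auto
    obtain K where K: "\<And>\<psi>. norm (poly_op (g M) A \<psi>) \<le> K * norm \<psi>"
      using bounded_linear.bounded[of "poly_op (g M) A"] bp by (auto simp: bounded_clinear_def mult.commute)
    show ?thesis
    proof (rule bounded_clinearI[where K = "K + 1"])
      show "L (\<phi> + \<psi>) = L \<phi> + L \<psi>" for \<phi> \<psi>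
        using LIMSEQ_unique[OF L[of "\<phi> + \<psi>"]] tendsto_add[OF L[of \<phi>] L[of \<psi>]]
        by (simp add: bounded_clinearD(3)[OF bp])
      show "L (c *\<^sub>C \<psi>) = c *\<^sub>C L \<psi>" for c \<psi>
      proof (rule LIMSEQ_unique[OF L])
        have "bounded_linear (\<lambda>\<psi>. c *\<^sub>C \<psi>)"
          using bounded_clinear_cscale[OF bounded_clinear_id] by (simp add: bounded_clinear_def)
        from bounded_linear.tendsto[OF this L]
        show "(\<lambda>n. poly_op (g n) A (c *\<^sub>C \<psi>)) \<longlonglongrightarrow> c *\<^sub>C L \<psi>"
          by (simp add: bounded_clinearD(2)[OF bp])
      qed
      show "norm (L \<psi>) \<le> (K + 1) * norm \<psi>" for \<psi>
        using M[of \<psi>] K[of \<psi>] norm_triangle_ineq4[of "poly_op (g M) A \<psi>" "poly_op (g M) A \<psi> - L \<psi>"]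
        by (simp add: algebra_simps)
    qed
  qed
  moreover have "(\<lambda>n. onorm (\<lambda>\<psi>. poly_op (g n) A \<psi> - L \<psi>)) \<longlonglongrightarrow> 0"
  proof (rule LIMSEQ_I)
    fix r :: real assume "r > 0"
    then obtain M where M: "\<And>m \<psi>. m \<ge> M \<Longrightarrow> norm (poly_op (g m) A \<psi> - L \<psi>) \<le> r / 2 * norm \<psi>"
      using close[of "r / 2"] by auto
    have "norm (onorm (\<lambda>\<psi>. poly_op (g m) A \<psi> - L \<psi>) - 0) < r" if "m \<ge> M" for m
    proof -
      have "bounded_linear (\<lambda>\<psi>. poly_op (g m) A \<psi> - L \<psi>)"
        using bp \<open>bounded_clinear L\<close> by (auto simp: bounded_clinear_def intro: bounded_linear_sub)
      then have "onorm (\<lambda>\<psi>. poly_op (g m) A \<psi> - L \<psi>) \<ge> 0" by (rule onorm_pos_le)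
      moreover have "onorm (\<lambda>\<psi>. poly_op (g m) A \<psi> - L \<psi>) \<le> r / 2"
        by (rule onorm_bound) (use M[OF that] \<open>r > 0\<close> in auto)
      ultimately show ?thesis using \<open>r > 0\<close> by simp
    qed
    then show "\<exists>no. \<forall>n\<ge>no. norm (onorm (\<lambda>\<psi>. poly_op (g n) A \<psi> - L \<psi>) - 0) < r" by blast
  qed
  ultimately have L: "bounded_clinear L" "?lim g L" using g by auto
  have "cont_calc h A = L"
    unfolding cont_calc_def
  proof (rule the_equality)
    show "bounded_clinear L \<and> (\<exists>f. ?lim f L)" using L by blast
    fix B assume "bounded_clinear B \<and> (\<exists>f. ?lim f B)"
    then obtain f where B: "bounded_clinear B" "?lim f B" by blast
    show "B = L"
    proof (rule ext)
      fix \<psi>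
      have "norm (B \<psi> - L \<psi>) \<le> d" if "d > 0" for d
      proof -
        obtain e where e: "e > 0" "e * norm \<psi> < d / 2"
          using obtain_scale[of "norm \<psi>" "d / 2"] \<open>d > 0\<close> by auto
        obtain p where p: "\<And>x. x \<in> ?S \<Longrightarrow> cmod (poly p (complex_of_real x) - h x) < e"
          using complex_poly_approx[OF S continuous_on_subset[OF h] e(1)] by blast
        have "norm (poly_op p A \<psi> - B \<psi>) \<le> e * norm \<psi>" "norm (poly_op p A \<psi> - L \<psi>) \<le> e * norm \<psi>"
          using est[OF B, of p e \<psi>] est[OF L, of p e \<psi>] p by (auto simp: less_imp_le)
        then show ?thesis
          using norm_triangle_ineq4[of "poly_op p A \<psi> - L \<psi>" "poly_op p A \<psi> - B \<psi>"] e(2) by simp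
      qed
      then have "norm (B \<psi> - L \<psi>) \<le> 0" using field_le_epsilon[of "norm (B \<psi> - L \<psi>)" 0] by simp
      then show "B \<psi> = L \<psi>" by simp
    qed
  qed
  then show "bounded_clinear (cont_calc h A)"
    and "(\<And>x. complex_of_real x \<in> spectrum A \<Longrightarrow> cmod (poly f (complex_of_real x) - h x) \<le> e) \<Longrightarrow>
      norm (poly_op f A \<psi> - cont_calc h A \<psi>) \<le> e * norm \<psi>"
    using L est[OF L, of f e \<psi>] by auto
qed

section \<open>Jacobi matrices with constant off-diagonal entries\<close>

lift_definition shift_op :: "int \<Rightarrow> ell2 \<Rightarrow> ell2" is "\<lambda>k \<psi> n. \<psi> (n + k)"
proof -
  fix k :: int and \<psi> :: "int \<Rightarrow> complex"
  assume "(\<lambda>n. (cmod (\<psi> n))\<^sup>2) summable_on UNIV"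
  then show "(\<lambda>n. (cmod (\<psi> (n + k)))\<^sup>2) summable_on UNIV"
    using summable_on_reindex_bij_betw[of "\<lambda>n. n + k" UNIV UNIV "\<lambda>n. (cmod (\<psi> n))\<^sup>2"]
      bij_plus_right[of k] by simp
qed

lemmas entry_shift_op [simp] = shift_op.rep_eq

lemma norm_shift_op [simp]: "norm (shift_op k \<psi>) = norm \<psi>"
  using infsum_reindex_bij_betw[of "\<lambda>n. n + k" UNIV UNIV "\<lambda>n. (cmod (entry \<psi> n))\<^sup>2"] bij_plus_right[of k]
  by (simp add: norm_ell2)

lemma cinner_shift_op: "cinner (shift_op k \<phi>) \<psi> = cinner \<phi> (shift_op (- k) \<psi>)"
  using infsum_reindex_bij_betw[of "\<lambda>n. n + k" UNIV UNIV "\<lambda>n. cnj (entry \<phi> n) * entry \<psi> (n - k)"] bij_plus_right[of k]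
  by (simp add: cinner.rep_eq)

lemma norm_le_entrywise:
  assumes "\<And>n. cmod (entry \<phi> n) \<le> K * cmod (entry \<psi> n)" "K \<ge> 0"
  shows "norm \<phi> \<le> K * norm \<psi>"
proof (rule power2_le_imp_le)
  have "(norm \<phi>)\<^sup>2 \<le> (\<Sum>\<^sub>\<infinity>n. K\<^sup>2 * (cmod (entry \<psi> n))\<^sup>2)"
    unfolding norm_power2_ell2
    by (rule infsum_mono) (use power_mono[OF assms(1), of _ 2] in
      \<open>auto intro!: Re_cinner_self(1) summable_on_cmult_right simp: power_mult_distrib\<close>)
  also have "\<dots> = (K * norm \<psi>)\<^sup>2"
    by (simp add: infsum_cmult_right' norm_power2_ell2[symmetric] power_mult_distrib)
  finally show "(norm \<phi>)\<^sup>2 \<le> (K * norm \<psi>)\<^sup>2" .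
qed (use assms in simp)

lemma finitely_supported_dense:
  assumes "e > 0"
  obtains \<phi> F where "finite F" "\<And>n. n \<notin> F \<Longrightarrow> entry \<phi> n = 0" "norm (\<psi> - \<phi>) < e"
proof -
  obtain F where F: "finite F"
    "dist (\<Sum>n\<in>F. (cmod (entry \<psi> n))\<^sup>2) (\<Sum>\<^sub>\<infinity>n. (cmod (entry \<psi> n))\<^sup>2) \<le> (e / 2)\<^sup>2"
    using infsum_finite_approximation[OF Re_cinner_self(1)[of \<psi>], of "(e / 2)\<^sup>2"] assms by auto
  define \<phi> where "\<phi> = (\<Sum>n\<in>F. entry \<psi> n *\<^sub>C delta n)"
  have \<phi>: "entry \<phi> n = (if n \<in> F then entry \<psi> n else 0)" for n
    using F(1) by (simp add: \<phi>_def entry_delta if_distrib cong: if_cong)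
  let ?s = "\<Sum>n\<in>F. (cmod (entry \<psi> n))\<^sup>2"
  have c: "cinner \<xi> \<phi> = (\<Sum>n\<in>F. entry \<psi> n * cnj (entry \<xi> n))" for \<xi>
    unfolding \<phi>_def by (simp add: cinner_sum_right cinner_cscale_right cinner_delta_right)
  \<comment> \<open>Truncation is an orthogonal projection: the two products agree, and the squared
    distance is \<open>\<parallel>\<psi>\<parallel>\<^sup>2 - ?s\<close>, the tail of the
    series.\<close>
  have "cinner \<psi> \<phi> = complex_of_real ?s" "cinner \<phi> \<phi> = complex_of_real ?s"
    unfolding c of_real_sum by (auto simp: \<phi> complex_norm_square simp del: of_real_power intro!: sum.cong)
  then have i: "inner \<psi> \<phi> = ?s" "(norm \<phi>)\<^sup>2 = ?s"
    by (simp_all add: inner_ell2_def power2_norm_eq_inner)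
  have "(norm (\<psi> - \<phi>))\<^sup>2 = (norm \<psi>)\<^sup>2 - 2 * inner \<psi> \<phi> + (norm \<phi>)\<^sup>2"
    unfolding power2_norm_eq_inner by (simp add: inner_diff_left inner_diff_right inner_commute)
  also have "\<dots> \<le> (e / 2)\<^sup>2"
    using F(2) by (simp add: i norm_power2_ell2[of \<psi>] dist_real_def)
  finally have "norm (\<psi> - \<phi>) \<le> e / 2"
    using assms by (simp add: power2_le_iff_abs_le)
  then show ?thesis using that[OF F(1), of \<phi>] \<phi> assms by auto
qed

text \<open>The Schroedinger case is \<open>c = 1\<close> and the diagonal case
  \<open>c = 0\<close>; the constants in between form the path along which a gap is
  followed.\<close>

abbreviation const_jacobi :: "(int \<Rightarrow> real) \<Rightarrow> real \<Rightarrow> ell2 \<Rightarrow> ell2" where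
  "const_jacobi b c \<equiv> jacobi_matrix b (\<lambda>_. c)"

locale bounded_potential =
  fixes b :: "int \<Rightarrow> real" and R :: real
  assumes bounded: "\<And>n. \<bar>b n\<bar> \<le> R"
begin

lemma R_nonneg: "0 \<le> R"
  using bounded[of 0] by linarith

lemma entry_const_jacobi: "entry (const_jacobi b c \<psi>) n =
    complex_of_real c * entry \<psi> (n - 1) + complex_of_real (b n) * entry \<psi> n + complex_of_real c * entry \<psi> (n + 1)"
  by (rule entry_jacobi_matrix[where C = "max R \<bar>c\<bar>"]) (use bounded in \<open>auto simp: le_max_iff_disj\<close>)

definition diag_op :: "ell2 \<Rightarrow> ell2" where "diag_op = const_jacobi b 0"

lemma entry_diag_op [simp]: "entry (diag_op \<psi>) n = complex_of_real (b n) * entry \<psi> n"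
  by (simp add: diag_op_def entry_const_jacobi)

lemma const_jacobi_eq:
  "const_jacobi b c \<psi> = diag_op \<psi> + complex_of_real c *\<^sub>C (shift_op (- 1) \<psi> + shift_op 1 \<psi>)"
  by (rule ell2_eqI) (simp add: entry_const_jacobi algebra_simps)

lemma norm_hopping: "norm (complex_of_real c *\<^sub>C (shift_op (- 1) \<psi> + shift_op 1 \<psi>)) \<le> 2 * \<bar>c\<bar> * norm \<psi>"
  using mult_left_mono[OF norm_triangle_ineq[of "shift_op (- 1) \<psi>" "shift_op 1 \<psi>"], of "\<bar>c\<bar>"]
  by (simp add: algebra_simps)

lemma norm_const_jacobi: "norm (const_jacobi b c \<psi>) \<le> (R + 2 * \<bar>c\<bar>) * norm \<psi>"
proof -
  have "norm (diag_op \<psi>) \<le> R * norm \<psi>"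
    by (rule norm_le_entrywise) (auto simp: norm_mult R_nonneg intro!: mult_right_mono bounded)
  then show ?thesis
    unfolding const_jacobi_eq using norm_hopping[of c \<psi>]
      norm_triangle_ineq[of "diag_op \<psi>" "complex_of_real c *\<^sub>C (shift_op (- 1) \<psi> + shift_op 1 \<psi>)"]
    by (simp add: algebra_simps del: norm_cscale)
qed

lemma self_adjoint_const_jacobi: "self_adjoint (const_jacobi b c)"
  unfolding self_adjoint_def
proof (intro conjI allI)
  show "bounded_clinear (const_jacobi b c)"
  proof (rule bounded_clinearI)
    show "norm (const_jacobi b c \<psi>) \<le> (R + 2 * \<bar>c\<bar>) * norm \<psi>" for \<psi>
      by (rule norm_const_jacobi)
  qed (rule ell2_eqI, simp add: entry_const_jacobi algebra_simps)+
  fix \<phi> \<psi>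
  have "cinner (diag_op \<phi>) \<psi> = cinner \<phi> (diag_op \<psi>)"
    by (simp add: cinner.rep_eq mult_ac)
  then show "cinner (const_jacobi b c \<phi>) \<psi> = cinner \<phi> (const_jacobi b c \<psi>)"
    by (simp add: const_jacobi_eq cinner_add_left cinner_add_right cinner_cscale_left
        cinner_cscale_right cinner_shift_op)
qed

lemma bounded_clinear_const_jacobi: "bounded_clinear (const_jacobi b c)"
  using self_adjoint_const_jacobi by (simp add: self_adjoint_def)

lemma spectrum_const_jacobi_bounded:
  "complex_of_real x \<in> spectrum (const_jacobi b c) \<Longrightarrow> \<bar>x\<bar> \<le> R + 2 * \<bar>c\<bar>"
  by (rule self_adjoint_spectrum_bounded[OF self_adjoint_const_jacobi norm_const_jacobi])

text \<open>The diagonal part of \<open>J - E\<close> is bounded below by the distance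
  \<open>d\<close> of \<open>E\<close> from the two half-lines, and the hopping part has norm at
  most \<open>2 |c|\<close>. This is the origin of the loss of \<open>2 c\<close> at each end of a
  gap.\<close>

lemma spectrum_const_jacobi_gap:
  assumes gap: "\<And>n. b n \<le> x \<or> y \<le> b n" and E: "x + 2 * \<bar>c\<bar> < E" "E < y - 2 * \<bar>c\<bar>"
  shows "complex_of_real E \<notin> spectrum (const_jacobi b c)"
proof -
  define d where "d = min (E - x) (y - E)"
  have d: "d > 2 * \<bar>c\<bar>" using E by (auto simp: d_def)
  have "(d - 2 * \<bar>c\<bar>) * norm \<psi> \<le> norm (const_jacobi b c \<psi> - complex_of_real E *\<^sub>C \<psi>)" for \<psi>
  proof -
    let ?D = "diag_op \<psi> - complex_of_real E *\<^sub>C \<psi>"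
    have "norm \<psi> \<le> 1 / d * norm ?D"
    proof (rule norm_le_entrywise)
      fix n
      have "d \<le> \<bar>b n - E\<bar>" using gap[of n] E by (auto simp: d_def min_def abs_if)
      then have "d * cmod (entry \<psi> n) \<le> \<bar>b n - E\<bar> * cmod (entry \<psi> n)" by (rule mult_right_mono) simp
      also have "\<dots> = cmod (entry ?D n)"
      proof -
        have "entry ?D n = complex_of_real (b n - E) * entry \<psi> n" by (simp add: algebra_simps)
        then show ?thesis by (simp only: norm_mult norm_of_real)
      qed
      finally show "cmod (entry \<psi> n) \<le> 1 / d * cmod (entry ?D n)"
        using d by (simp add: field_simps)
    qed (use d in auto)
    then have "d * norm \<psi> \<le> norm ?D" using d by (simp add: field_simps)
    moreover have "const_jacobi b c \<psi> - complex_of_real E *\<^sub>C \<psi> =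
        ?D + complex_of_real c *\<^sub>C (shift_op (- 1) \<psi> + shift_op 1 \<psi>)"
      by (simp add: const_jacobi_eq)
    ultimately show ?thesis
      using norm_hopping[of c \<psi>] norm_diff_ineq[of ?D "complex_of_real c *\<^sub>C (shift_op (- 1) \<psi> + shift_op 1 \<psi>)"]
      by (simp add: algebra_simps del: norm_cscale)
  qed
  then have "bounded_below (\<lambda>\<psi>. const_jacobi b c \<psi> - complex_of_real E *\<^sub>C \<psi>)"
    unfolding bounded_below_def using d by (intro exI[of _ "d - 2 * \<bar>c\<bar>"]) auto
  then show ?thesis using self_adjoint_spectrum_iff[OF self_adjoint_const_jacobi] by blast
qed

end

text \<open>
  If translates of \<open>b\<close> approximate \<open>b'\<close> on every window, then translating a finitely supported
  vector transfers lower bounds from \<open>b\<close> to \<open>b'\<close>.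
\<close>

lemma spectrum_subset_of_approx:
  assumes b: "\<And>n. \<bar>b n\<bar> \<le> R" and b': "\<And>n. \<bar>b' n\<bar> \<le> R"
    and approx: "\<And>e N. e > 0 \<Longrightarrow> \<exists>s. \<forall>n. \<bar>n\<bar> \<le> N \<longrightarrow> \<bar>b (n + s) - b' n\<bar> < e"
  shows "spectrum (const_jacobi b' c) \<subseteq> spectrum (const_jacobi b c)"
proof
  interpret B: bounded_potential b R by standard (rule b)
  interpret B': bounded_potential b' R by standard (rule b')
  fix z assume z: "z \<in> spectrum (const_jacobi b' c)"
  obtain x where zE: "z = complex_of_real x"
    using self_adjoint_spectrum_real[OF B'.self_adjoint_const_jacobi z] complex_is_Real_iff by (metis Reals_cases)
  define E where "E = complex_of_real x"
  show "z \<in> spectrum (const_jacobi b c)"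
  proof (rule ccontr)
    assume "z \<notin> spectrum (const_jacobi b c)"
    then have "bounded_below (\<lambda>\<psi>. const_jacobi b c \<psi> - E *\<^sub>C \<psi>)"
      using self_adjoint_spectrum_iff[OF B.self_adjoint_const_jacobi, of x] by (simp add: E_def zE)
    then obtain d where d: "d > 0" "\<And>\<psi>. d * norm \<psi> \<le> norm (const_jacobi b c \<psi> - E *\<^sub>C \<psi>)"
      by (auto simp: bounded_below_def)
    let ?A' = "\<lambda>\<psi>. const_jacobi b' c \<psi> - E *\<^sub>C \<psi>"
    \<comment> \<open>Finite support comes first, since a translate of \<open>b\<close> resembles
      \<open>b'\<close> only on a bounded window; density removes the restriction
      afterwards.\<close>
    have fin: "d * norm \<phi> \<le> norm (?A' \<phi>)"
      if F: "finite F" "\<And>n. n \<notin> F \<Longrightarrow> entry \<phi> n = 0" for \<phi> F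
    proof (rule field_le_epsilon)
      fix e :: real assume "e > 0"
      then obtain e' where e': "e' > 0" "e' * norm \<phi> < e" using obtain_scale[of "norm \<phi>" e] by auto
      define N where "N = Max (insert 0 (abs ` F))"
      have N: "\<bar>n\<bar> \<le> N" if "n \<in> F" for n using that F(1) by (auto simp: N_def)
      obtain s where s: "\<And>n. \<bar>n\<bar> \<le> N \<Longrightarrow> \<bar>b (n + s) - b' n\<bar> < e'" using approx[OF e'(1)] by blast
      let ?\<psi> = "shift_op (- s) \<phi>"
      \<comment> \<open>Hopping is translation invariant and cancels, so \<open>?r\<close> involves
        only the potential difference, which is small on the support of
        \<open>\<phi>\<close>.\<close>
      let ?r = "shift_op s (const_jacobi b c ?\<psi> - E *\<^sub>C ?\<psi>) - ?A' \<phi>"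
      have "norm ?r \<le> e' * norm \<phi>"
      proof (rule norm_le_entrywise)
        fix n
        have "entry ?r n = complex_of_real (b (n + s) - b' n) * entry \<phi> n"
          by (simp add: B.entry_const_jacobi B'.entry_const_jacobi algebra_simps)
        moreover have "\<bar>b (n + s) - b' n\<bar> * cmod (entry \<phi> n) \<le> e' * cmod (entry \<phi> n)"
        proof (cases "n \<in> F")
          case True
          then show ?thesis using s[OF N] by (intro mult_right_mono) (auto simp: less_imp_le)
        qed (use F in simp)
        ultimately show "cmod (entry ?r n) \<le> e' * cmod (entry \<phi> n)" 
          by (simp add: norm_mult del: of_real_diff)
      qed (use e' in simp)
      moreover have "d * norm \<phi> \<le> norm (shift_op s (const_jacobi b c ?\<psi> - E *\<^sub>C ?\<psi>))"
        using d(2)[of ?\<psi>] by simp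
      moreover have "norm (shift_op s (const_jacobi b c ?\<psi> - E *\<^sub>C ?\<psi>)) \<le> norm (?A' \<phi>) + norm ?r"
        using norm_triangle_ineq[of "?A' \<phi>" ?r] by (simp add: algebra_simps)
      ultimately show "d * norm \<phi> \<le> norm (?A' \<phi>) + e" using e'(2) by linarith
    qed
    have bl: "bounded_linear ?A'"
      using bounded_clinear_shift[OF B'.bounded_clinear_const_jacobi] by (simp add: bounded_clinear_def)
    obtain K where K: "K > 0" "\<And>\<psi>. norm (?A' \<psi>) \<le> norm \<psi> * K"
      using bounded_linear.pos_bounded[OF bl] by blast
    have "d * norm \<psi> \<le> norm (?A' \<psi>)" for \<psi>
    proof (rule field_le_epsilon)
      fix e :: real assume "e > 0"
      \<comment> \<open>Replacing \<open>\<psi>\<close> by \<open>\<phi>\<close> costs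
        \<open>d\<close> times their distance on the left and \<open>K\<close> times it on the
        right.\<close>
      then have pos: "e / (d + K) > 0" using d K by simp
      obtain \<phi> F where F: "finite F" "\<And>n. n \<notin> F \<Longrightarrow> entry \<phi> n = 0" "norm (\<psi> - \<phi>) < e / (d + K)"
        using finitely_supported_dense[OF pos, of \<psi>] by metis
      have "norm (\<psi> - \<phi>) * (d + K) \<le> e"
        using F(3) d(1) K(1) by (simp add: field_simps)
      moreover have "?A' \<phi> = ?A' \<psi> - ?A' (\<psi> - \<phi>)"
        using bounded_linear.linear[OF bl] linear_diff[of ?A' \<psi> \<phi>] by simp
      then have "norm (?A' \<phi>) \<le> norm (?A' \<psi>) + norm (\<psi> - \<phi>) * K"
        using norm_triangle_ineq4[of "?A' \<psi>" "?A' (\<psi> - \<phi>)"] K(2)[of "\<psi> - \<phi>"] by simp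
      moreover have "d * norm \<psi> \<le> d * (norm \<phi> + norm (\<psi> - \<phi>))"
        using norm_triangle_ineq[of \<phi> "\<psi> - \<phi>"] d(1) by (intro mult_left_mono) auto
      ultimately show "d * norm \<psi> \<le> norm (?A' \<psi>) + e"
        using fin[OF F(1,2)] by (simp add: algebra_simps)
    qed
    then have "bounded_below ?A'" using d(1) unfolding bounded_below_def by blast
    then show False using self_adjoint_spectrum_iff[OF B'.self_adjoint_const_jacobi, of x] z
      by (simp add: E_def zE)
  qed
qed

section \<open>The uniform full shift\<close>

lemma Omega_iff: "\<omega> \<in> Omega m \<longleftrightarrow> (\<forall>i. \<omega> i \<in> alphabet m)"
  by (auto simp: Omega_def shift_space_def PiE_iff)

lemma finite_alphabet [simp]: "finite (alphabet m)"
  by (simp add: alphabet_def)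

lemma card_alphabet [simp]: "card (alphabet m) = m"
  by (simp add: alphabet_def card_image)

lemma compact_Omega: "compact (Omega m)"
proof -
  have "compactin (product_topology (\<lambda>_::int. euclideanreal) UNIV) (\<Pi>\<^sub>E n\<in>UNIV. alphabet m)"
    unfolding compactin_PiE by (auto intro: finite_imp_compact)
  then show ?thesis
    by (simp add: Omega_def shift_space_def euclidean_product_topology)
qed

lemma shift_Omega [simp]: "(\<lambda>k. \<omega> (k + n)) \<in> Omega m \<longleftrightarrow> \<omega> \<in> Omega m"
  by (auto simp: Omega_iff) (metis add.commute diff_add_cancel)

definition window :: "int \<Rightarrow> int set" where "window N = {-N..N}"

text \<open>The metric on \<open>int \<Rightarrow> real\<close> weights the coordinates
  geometrically along \<open>from_nat\<close>: the first \<open>k\<close> of them lie in some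
  window, and the others contribute at most \<open>(1 / 2) ^ k\<close>.\<close>

lemma agree_close:
  fixes d :: real
  assumes "d > 0"
  shows "\<exists>N. \<forall>\<omega> \<omega>' :: int \<Rightarrow> real. (\<forall>i\<in>window N. \<omega> i = \<omega>' i) \<longrightarrow> dist \<omega> \<omega>' < d"
proof -
  obtain k :: nat where k: "(1 / 2) ^ k < d"
    using real_arch_pow_inv[OF assms, of "1 / 2"] by auto
  define N where "N = Max ((\<lambda>n. \<bar>from_nat n :: int\<bar>) ` {..k})"
  have N: "from_nat n \<in> window N" if "n \<le> k" for n
  proof -
    have "\<bar>from_nat n :: int\<bar> \<le> N" using that by (simp add: N_def)
    then show ?thesis by (auto simp: window_def)
  qed
  have "dist \<omega> \<omega>' < d" if "\<forall>i\<in>window N. \<omega> i = \<omega>' i" for \<omega> \<omega>' :: "int \<Rightarrow> real"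
  proof -
    have "{dist (\<omega> (from_nat n)) (\<omega>' (from_nat n)) |n. n \<le> k} = {0}"
      using that N by (auto intro!: exI[of _ 0])
    then show ?thesis
      using dist_fun_le_dist_first_terms[of \<omega> \<omega>' k] k by simp
  qed
  then show ?thesis by blast
qed

text \<open>Uniform continuity on a compact product, read through \<open>agree_close\<close>. The
  parameter \<open>t\<close> is the time variable of the suspension; for potentials it is a
  dummy.\<close>

lemma uniform_window:
  fixes f :: "(int \<Rightarrow> real) \<times> real \<Rightarrow> 'a::metric_space"
  assumes f: "continuous_on (Omega m \<times> S) f" and S: "compact S" and e: "e > 0"
  shows "\<exists>N. \<forall>\<omega>\<in>Omega m. \<forall>\<omega>'\<in>Omega m. (\<forall>i\<in>window N. \<omega> i = \<omega>' i) \<longrightarrow>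
    (\<forall>t\<in>S. dist (f (\<omega>, t)) (f (\<omega>', t)) < e)"
proof -
  have "uniformly_continuous_on (Omega m \<times> S) f"
    by (intro compact_uniformly_continuous f compact_Times compact_Omega S)
  then obtain d where d: "d > 0" "\<And>x y. x \<in> Omega m \<times> S \<Longrightarrow> y \<in> Omega m \<times> S \<Longrightarrow> dist y x < d \<Longrightarrow> dist (f y) (f x) < e"
    using e unfolding uniformly_continuous_on_def by metis
  obtain N where N: "\<And>\<omega> \<omega>' :: int \<Rightarrow> real. (\<forall>i\<in>window N. \<omega> i = \<omega>' i) \<Longrightarrow> dist \<omega> \<omega>' < d"
    using agree_close[OF d(1)] by blast
  have "dist (f (\<omega>, t)) (f (\<omega>', t)) < e"
    if "\<omega> \<in> Omega m" "\<omega>' \<in> Omega m" "t \<in> S" "\<forall>i\<in>window N. \<omega> i = \<omega>' i" for \<omega> \<omega>' t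
    by (rule d(2)) (use that N[OF that(4)] in \<open>auto simp: dist_prod_def\<close>)
  then show ?thesis by blast
qed

text \<open>Compactness of \<open>Omega m\<close> makes the boundedness demanded by
  \<open>cfunspace\<close> automatic.\<close>

lemma cfun_iff: "q \<in> cfun (Omega m) \<longleftrightarrow> q \<in> extensional (Omega m) \<and> continuous_on (Omega m) q"
proof -
  have "bounded (q ` Omega m)" if "continuous_on (Omega m) q"
    using compact_continuous_image[OF that compact_Omega] compact_imp_bounded by blast
  then show ?thesis
    by (auto simp: cfun_metric_def Met_TC.mbounded_alt bounded_two_points)
qed

lemma uniform_window_cfun:
  fixes q :: "(int \<Rightarrow> real) \<Rightarrow> real"
  assumes q: "continuous_on (Omega m) q" and e: "e > 0"
  shows "\<exists>N. \<forall>\<omega>\<in>Omega m. \<forall>\<omega>'\<in>Omega m. (\<forall>i\<in>window N. \<omega> i = \<omega>' i) \<longrightarrow> \<bar>q \<omega> - q \<omega>'\<bar> < e"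
proof -
  have "continuous_on (Omega m \<times> {0::real}) (\<lambda>x. q (fst x))"
    by (intro continuous_on_compose2[OF q] continuous_intros) auto
  from uniform_window[OF this compact_sing e] show ?thesis by (simp add: dist_real_def)
qed

section \<open>Cylinder sets, functions of finitely many coordinates, dense orbits\<close>

locale uniform_shift =
  fixes m :: nat
  assumes m: "m > 0"
begin

interpretation U: prob_space "uniform_count_measure (alphabet m)"
  by (rule prob_space_uniform_count_measure) (use m in \<open>auto simp: alphabet_def\<close>)

interpretation PU: product_prob_space "\<lambda>_. uniform_count_measure (alphabet m)" "UNIV :: int set"
  by standard

lemma prob_space_mu: "prob_space (mu m)"
  unfolding mu_def shift_measure_def by (rule PU.P.prob_space_axioms)

lemma zero_in_alphabet: "0 \<in> alphabet m"
  using m by (auto simp: alphabet_def image_iff intro!: bexI[of _ 0])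

lemma Omega_nonempty: "Omega m \<noteq> {}"
  using zero_in_alphabet by (auto simp: Omega_iff intro!: exI[of _ "\<lambda>_. 0"])

lemma borel_measurable_mu: "(\<lambda>x. x) \<in> measurable (mu m) (borel :: (int \<Rightarrow> real) measure)"
proof -
  have "(\<lambda>\<omega>. \<omega> i) \<in> borel_measurable (mu m)" for i
  proof -
    have "(\<lambda>\<omega>. \<omega> i) \<in> measurable (mu m) (uniform_count_measure (alphabet m))"
      unfolding mu_def shift_measure_def by (rule measurable_component_singleton) simp
    moreover have "(\<lambda>x. x) \<in> borel_measurable (uniform_count_measure (alphabet m))"
      by (auto simp: measurable_def space_uniform_count_measure sets_uniform_count_measure)
    ultimately show ?thesis using measurable_compose by blast
  qed
  then show ?thesis
    by (subst measurable_cong_sets[OF refl sets_PiM_equal_borel[symmetric]])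
      (rule measurable_PiM_single', auto)
qed

lemma continuous_borel_measurable_mu:
  fixes q :: "(int \<Rightarrow> real) \<Rightarrow> 'a::topological_space"
  assumes "continuous_on (Omega m) q" shows "q \<in> borel_measurable (mu m)"
proof -
  have "(\<lambda>x. x) \<in> measurable (mu m) (restrict_space borel (Omega m))"
    by (rule measurable_restrict_space2) (use borel_measurable_mu in \<open>auto simp: space_mu\<close>)
  from measurable_compose[OF this borel_measurable_continuous_on_restrict[OF assms]] show ?thesis .
qed

lemma continuous_on_shift: "continuous_on S (\<lambda>\<omega> :: int \<Rightarrow> real. \<lambda>k. \<omega> (k + n))"
  by (rule continuous_on_coordinatewise_then_product)
    (rule continuous_on_subset[OF continuous_on_product_coordinates subset_UNIV])

lemma distr_mu_shift: "distr (mu m) (mu m) (\<lambda>\<omega> k. \<omega> (k + n)) = mu m"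
  using distr_PiM_reindex[of UNIV "\<lambda>_. uniform_count_measure (alphabet m)" "\<lambda>k. k + n" UNIV] U.prob_space_axioms
  by (simp add: mu_def shift_measure_def inj_on_def restrict_UNIV)

lemma measurable_shift: "(\<lambda>\<omega> k. \<omega> (k + n)) \<in> measurable (mu m) (mu m)"
  unfolding mu_def shift_measure_def
  by (rule measurable_PiM_single') (auto intro!: measurable_component_singleton simp: space_PiM)

lemma integral_mu_shift:
  fixes f :: "(int \<Rightarrow> real) \<Rightarrow> 'a::{banach,second_countable_topology}"
  assumes "f \<in> borel_measurable (mu m)"
  shows "(\<integral>\<omega>. f (\<lambda>k. \<omega> (k + n)) \<partial>mu m) = (\<integral>\<omega>. f \<omega> \<partial>mu m)"
  by (subst (2) distr_mu_shift[of n, symmetric]) (rule integral_distr[OF measurable_shift assms, symmetric])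

definition cyl :: "int set \<Rightarrow> (int \<Rightarrow> real) \<Rightarrow> (int \<Rightarrow> real) set" where
  "cyl I w = {\<omega> \<in> Omega m. \<forall>i\<in>I. \<omega> i = w i}"

lemma cyl:
  assumes "finite I" "w \<in> Omega m"
  shows "cyl I w \<in> sets (mu m)" "measure (mu m) (cyl I w) = 1 / real m ^ card I"
proof -
  let ?U = "uniform_count_measure (alphabet m)"
  have w: "w i \<in> alphabet m" for i using assms(2) by (simp add: Omega_iff)
  have eq: "cyl I w = prod_emb UNIV (\<lambda>_. ?U) I (\<Pi>\<^sub>E i\<in>I. {w i})"
    using w by (auto simp: cyl_def prod_emb_def Omega_def shift_space_def space_uniform_count_measure PiE_iff)
  show "cyl I w \<in> sets (mu m)"
    unfolding eq mu_def shift_measure_def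
    by (rule sets_PiM_I) (use assms w in \<open>auto simp: sets_uniform_count_measure\<close>)
  have "measure (mu m) (cyl I w) = (\<Prod>i\<in>I. measure ?U {w i})"
    unfolding eq mu_def shift_measure_def
    by (rule PU.measure_PiM_emb) (use assms w in \<open>auto simp: sets_uniform_count_measure\<close>)
  also have "\<dots> = 1 / real m ^ card I"
    by (simp add: measure_uniform_count_measure w power_one_over)
  finally show "measure (mu m) (cyl I w) = 1 / real m ^ card I" .
qed

text \<open>A pattern on \<open>I\<close> is represented by its extension by the letter 0. Words are
  thus points of \<open>Omega m\<close>, and a function on \<open>Omega m\<close> can be evaluated
  at them directly.\<close>

definition trunc :: "int set \<Rightarrow> (int \<Rightarrow> real) \<Rightarrow> int \<Rightarrow> real" where
  "trunc I \<omega> = (\<lambda>i. if i \<in> I then \<omega> i else 0)"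

definition words :: "int set \<Rightarrow> (int \<Rightarrow> real) set" where
  "words I = trunc I ` Omega m"

lemma trunc_Omega: "\<omega> \<in> Omega m \<Longrightarrow> trunc I \<omega> \<in> Omega m"
  using zero_in_alphabet by (auto simp: Omega_iff trunc_def)

lemma words_Omega: "w \<in> words I \<Longrightarrow> w \<in> Omega m"
  by (auto simp: words_def trunc_Omega)

lemma trunc_words: "w \<in> words I \<Longrightarrow> trunc I w = w"
  by (auto simp: words_def trunc_def)

lemma in_cyl_iff: "w \<in> words I \<Longrightarrow> \<omega> \<in> Omega m \<Longrightarrow> \<omega> \<in> cyl I w \<longleftrightarrow> trunc I \<omega> = w"
  using trunc_words[of w I] by (simp add: cyl_def trunc_def fun_eq_iff) metis

definition depends_on :: "int set \<Rightarrow> ((int \<Rightarrow> real) \<Rightarrow> 'a) \<Rightarrow> bool" where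
  "depends_on I f \<longleftrightarrow> (\<forall>\<omega>\<in>Omega m. f \<omega> = f (trunc I \<omega>))"

lemma finite_words: assumes "finite I" shows "finite (words I)"
proof -
  have "words I \<subseteq> {f. \<forall>i. (i \<in> I \<longrightarrow> f i \<in> alphabet m) \<and> (i \<notin> I \<longrightarrow> f i = 0)}"
    by (auto simp: words_def trunc_def Omega_iff)
  then show ?thesis using finite_set_of_finite_funs[OF assms finite_alphabet] finite_subset by blast
qed

lemma window_function_eq:
  fixes f :: "(int \<Rightarrow> real) \<Rightarrow> real"
  assumes I: "finite I" and f: "depends_on I f" and "\<omega> \<in> Omega m"
  shows "f \<omega> = (\<Sum>w\<in>words I. f w * indicator (cyl I w) \<omega>)"
proof -
  have "(\<Sum>w\<in>words I. f w * indicator (cyl I w) \<omega>) = (\<Sum>w\<in>words I. if w = trunc I \<omega> then f w else 0)"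
    by (rule sum.cong) (auto simp: indicator_def in_cyl_iff assms(3))
  also have "\<dots> = f (trunc I \<omega>)"
    using finite_words[OF I] assms(3) by (simp add: words_def)
  finally show ?thesis using f assms(3) by (simp add: depends_on_def)
qed

lemma window_function_integral:
  fixes f :: "(int \<Rightarrow> real) \<Rightarrow> real"
  assumes I: "finite I" and f: "depends_on I f"
  shows "has_bochner_integral (mu m) f ((\<Sum>w\<in>words I. f w) / real m ^ card I)"
proof -
  interpret prob_space "mu m" by (rule prob_space_mu)
  have "has_bochner_integral (mu m) (\<lambda>\<omega>. \<Sum>w\<in>words I. f w * indicator (cyl I w) \<omega>)
      (\<Sum>w\<in>words I. f w * (1 / real m ^ card I))"
  proof (intro has_bochner_integral_sum has_bochner_integral_mult_right)
    fix w assume "w \<in> words I"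
    then show "has_bochner_integral (mu m) (indicator (cyl I w)) (1 / real m ^ card I :: real)"
      using has_bochner_integral_real_indicator[of "cyl I w" "mu m"] cyl[OF I, of w] words_Omega
      by (simp add: less_top[symmetric])
  qed
  then show ?thesis
    by (subst has_bochner_integral_cong[OF refl window_function_eq[OF I f]])
      (auto simp: space_mu sum_divide_distrib)
qed

text \<open>Counting by integration: every word has mass \<open>1 / m ^ card I\<close>, and the
  constant function 1 has integral 1.\<close>

lemma card_words: assumes "finite I" shows "card (words I) = m ^ card I"
proof -
  interpret prob_space "mu m" by (rule prob_space_mu)
  have "(\<integral>\<omega>. 1 \<partial>mu m) = real (card (words I)) / real m ^ card I"
    using has_bochner_integral_integral_eq[OF window_function_integral[OF assms, of "\<lambda>_. 1"]] by (simp add: depends_on_def)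
  then have "real (card (words I)) = real (m ^ card I)" using m by (simp add: prob_space field_simps)
  then show ?thesis by (simp only: of_nat_eq_iff)
qed

lemma window_measure:
  assumes I: "finite I" and P: "depends_on I P"
  shows "{\<omega> \<in> Omega m. P \<omega>} \<in> sets (mu m)"
    and "measure (mu m) {\<omega> \<in> Omega m. P \<omega>} = real (card {w \<in> words I. P w}) / real m ^ card I"
proof -
  interpret prob_space "mu m" by (rule prob_space_mu)
  let ?f = "indicator {\<omega> \<in> Omega m. P \<omega>} :: (int \<Rightarrow> real) \<Rightarrow> real"
  have i: "has_bochner_integral (mu m) ?f ((\<Sum>w\<in>words I. ?f w) / real m ^ card I)"
    by (rule window_function_integral[OF I]) (use P trunc_Omega in \<open>auto simp: indicator_def depends_on_def\<close>)
  then have "?f \<in> borel_measurable (mu m)" by (rule borel_measurable_has_bochner_integral)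
  then show s: "{\<omega> \<in> Omega m. P \<omega>} \<in> sets (mu m)"
    by (simp add: borel_measurable_indicator_iff) (simp add: Int_absorb2 space_mu subset_iff)
  have "measure (mu m) {\<omega> \<in> Omega m. P \<omega>} = (\<Sum>w\<in>words I. ?f w) / real m ^ card I"
    using has_bochner_integral_integral_eq[OF i] s by (simp add: Int_absorb2 space_mu subset_iff)
  also have "(\<Sum>w\<in>words I. ?f w) = (\<Sum>w\<in>words I. if P w then 1 else 0)"
    by (rule sum.cong) (auto simp: indicator_def words_Omega)
  also have "\<dots> = real (card {w \<in> words I. P w})"
    using finite_words[OF I] by (simp add: sum.If_cases Int_def)
  finally show "measure (mu m) {\<omega> \<in> Omega m. P \<omega>} = real (card {w \<in> words I. P w}) / real m ^ card I" .
qed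

text \<open>Independence over disjoint coordinate sets. Decompose by the words on \<open>I\<close>
  that satisfy \<open>P\<close>; each meets \<open>cyl J v\<close> in the cylinder over
  \<open>I \<union> J\<close> of the glued word.\<close>

lemma window_cyl_independent:
  assumes I: "finite I" and P: "depends_on I P"
    and J: "finite J" "I \<inter> J = {}" and v: "v \<in> Omega m"
  shows "measure (mu m) {\<omega> \<in> cyl J v. P \<omega>} = measure (mu m) {\<omega> \<in> Omega m. P \<omega>} / real m ^ card J"
proof -
  interpret prob_space "mu m" by (rule prob_space_mu)
  let ?u = "\<lambda>w i. if i \<in> I then w i else v i"
  have u: "?u w \<in> Omega m" if "w \<in> Omega m" for w using that v by (auto simp: Omega_iff)
  have cc: "cyl I w \<inter> cyl J v = cyl (I \<union> J) (?u w)" for w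
    using J(2) by (auto simp: cyl_def)
  have "{\<omega> \<in> cyl J v. P \<omega>} = (\<Union>w\<in>{w\<in>words I. P w}. cyl I w \<inter> cyl J v)"
  proof (intro equalityI subsetI)
    fix \<omega> assume "\<omega> \<in> {\<omega> \<in> cyl J v. P \<omega>}"
    then have "\<omega> \<in> Omega m" "P (trunc I \<omega>)" "\<omega> \<in> cyl J v" using P by (auto simp: cyl_def depends_on_def)
    then show "\<omega> \<in> (\<Union>w\<in>{w\<in>words I. P w}. cyl I w \<inter> cyl J v)"
      by (auto simp: words_def in_cyl_iff[unfolded words_def] intro!: exI[of _ "trunc I \<omega>"])
  next
    fix \<omega> assume "\<omega> \<in> (\<Union>w\<in>{w\<in>words I. P w}. cyl I w \<inter> cyl J v)"
    then obtain w where w: "w \<in> words I" "P w" "\<omega> \<in> cyl I w" "\<omega> \<in> cyl J v" by auto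
    then have "\<omega> \<in> Omega m" by (simp add: cyl_def)
    then show "\<omega> \<in> {\<omega> \<in> cyl J v. P \<omega>}" using w P in_cyl_iff by (auto simp: depends_on_def)
  qed
  also have "measure (mu m) \<dots> = (\<Sum>w\<in>{w\<in>words I. P w}. measure (mu m) (cyl I w \<inter> cyl J v))"
  proof (rule finite_measure_finite_Union)
    show "disjoint_family_on (\<lambda>w. cyl I w \<inter> cyl J v) {w \<in> words I. P w}"
      unfolding disjoint_family_on_def
    proof (intro ballI impI)
      fix w w' assume "w \<in> {w \<in> words I. P w}" "w' \<in> {w \<in> words I. P w}" "w \<noteq> w'"
      then show "cyl I w \<inter> cyl J v \<inter> (cyl I w' \<inter> cyl J v) = {}"
        using in_cyl_iff[of w I] in_cyl_iff[of w' I] by (auto simp: cyl_def[of J])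
    qed
  qed (use finite_words[OF I] I J v u words_Omega in \<open>auto simp: cc intro!: cyl\<close>)
  also have "\<dots> = (\<Sum>w\<in>{w\<in>words I. P w}. 1 / real m ^ (card I + card J))"
    by (rule sum.cong) (use I J u words_Omega in \<open>auto simp: cc cyl card_Un_disjoint\<close>)
  also have "\<dots> = measure (mu m) {\<omega> \<in> Omega m. P \<omega>} / real m ^ card J"
    by (simp add: window_measure(2)[OF I P] power_add)
  finally show ?thesis .
qed

text \<open>Density of the two-sided orbit of \<open>\<omega>\<close>, phrased in finite
  patterns.\<close>

definition transitive :: "(int \<Rightarrow> real) \<Rightarrow> bool" where
  "transitive \<omega> \<longleftrightarrow> (\<forall>\<omega>'\<in>Omega m. \<forall>N. \<exists>s. \<forall>k\<in>window N. \<omega> (k + s) = \<omega>' k)"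

text \<open>
  Only the translates of the window by multiples of \<open>2 N + 1\<close> are examined: they are pairwise
  disjoint, hence independent.
\<close>

lemma AE_word_occurs:
  assumes v: "v \<in> Omega m" and N: "N \<ge> 0"
  shows "AE \<omega> in mu m. \<exists>s. \<forall>k\<in>window N. \<omega> (k + s) = v k"
proof -
  interpret prob_space "mu m" by (rule prob_space_mu)
  define L where "L = 2 * N + 1"
  define J where "J j = (\<lambda>k. k + int j * L) ` window N" for j :: nat
  have J: "finite (J j)" "card (J j) = nat L" for j
    unfolding J_def by (auto simp: window_def card_image inj_on_def L_def)
  have Jin: "i \<in> J j \<longleftrightarrow> int j * L - N \<le> i \<and> i \<le> int j * L + N" for i j
  proof
    assume "int j * L - N \<le> i \<and> i \<le> int j * L + N"
    then show "i \<in> J j" unfolding J_def window_def by (intro image_eqI[of _ _ "i - int j * L"]) auto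
  qed (auto simp: J_def window_def)
  have disj: "J i \<inter> J j = {}" if "i < j" for i j
  proof -
    have "(int i + 1) * L \<le> int j * L" using that N by (intro mult_right_mono) (auto simp: L_def)
    then show ?thesis using N by (auto simp: Jin L_def algebra_simps)
  qed
  \<comment> \<open>The mass of a single word on a window. \<open>P n\<close> below is the event
    that \<open>v\<close> is missed on the first \<open>n\<close> blocks, of probability
    \<open>(1 - p) ^ n\<close>.\<close>
  define p where "p = 1 / real m ^ nat L"
  have p: "0 < p" "p \<le> 1" using m by (auto simp: p_def field_simps intro: one_le_power)
  define P where "P n \<omega> \<longleftrightarrow> (\<forall>j<n. \<exists>k\<in>window N. \<omega> (k + int j * L) \<noteq> v k)" for n \<omega>
  define I where "I n = (\<Union>j<n. J j)" for n
  have I: "finite (I n)" for n by (auto simp: I_def J)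
  have PI: "depends_on (I n) (P n)" for n
    unfolding depends_on_def P_def trunc_def I_def J_def by (intro ballI all_cong bex_cong refl) auto
  note Ps = window_measure(1)[OF I PI]
  have "measure (mu m) {\<omega> \<in> Omega m. P n \<omega>} = (1 - p) ^ n" for n
  proof (induction n)
    case 0
    have "{\<omega> \<in> Omega m. P 0 \<omega>} = space (mu m)" by (auto simp: P_def space_mu)
    then show ?case by (simp only: prob_space) simp
  next
    case (Suc n)
    define u where "u = (\<lambda>i. v (i - int n * L))"
    have u: "u \<in> Omega m" using v by (auto simp: Omega_iff u_def)
    have "\<omega> \<in> cyl (J n) u \<longleftrightarrow> \<omega> \<in> Omega m \<and> (\<forall>k\<in>window N. \<omega> (k + int n * L) = v k)" for \<omega>
      by (auto simp: cyl_def J_def u_def)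
    then have "{\<omega> \<in> Omega m. P (Suc n) \<omega>} = {\<omega> \<in> Omega m. P n \<omega>} - {\<omega> \<in> cyl (J n) u. P n \<omega>}"
      by (auto simp: P_def less_Suc_eq)
    then have "measure (mu m) {\<omega> \<in> Omega m. P (Suc n) \<omega>} =
        measure (mu m) {\<omega> \<in> Omega m. P n \<omega>} - measure (mu m) {\<omega> \<in> cyl (J n) u. P n \<omega>}"
    proof (simp only:, intro finite_measure_Diff Ps)
      have "{\<omega> \<in> cyl (J n) u. P n \<omega>} = cyl (J n) u \<inter> {\<omega> \<in> Omega m. P n \<omega>}" by (auto simp: cyl_def)
      then show "{\<omega> \<in> cyl (J n) u. P n \<omega>} \<in> sets (mu m)" using cyl(1)[OF J(1) u] Ps by auto
    qed (auto simp: cyl_def)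
    also have "I n \<inter> J n = {}" using disj by (auto simp: I_def)
    then have "measure (mu m) {\<omega> \<in> cyl (J n) u. P n \<omega>} = (1 - p) ^ n * p"
      using window_cyl_independent[OF I PI J(1) _ u] Suc.IH by (simp add: J(2) p_def)
    finally show ?case by (simp add: Suc.IH algebra_simps)
  qed
  moreover have "(\<lambda>n. (1 - p) ^ n) \<longlonglongrightarrow> 0"
    using p by (intro LIMSEQ_power_zero) auto
  moreover define A where "A = (\<Inter>n. {\<omega> \<in> Omega m. P n \<omega>})"
  have A: "A \<in> sets (mu m)" unfolding A_def using Ps by (intro sets.countable_INT) auto
  have "measure (mu m) A \<le> measure (mu m) {\<omega> \<in> Omega m. P n \<omega>}" for n
    by (rule finite_measure_mono) (use Ps in \<open>auto simp: A_def\<close>)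
  ultimately have "measure (mu m) A \<le> 0"
    by (intro LIMSEQ_le_const[where X = "\<lambda>n. (1 - p) ^ n"]) auto
  then have "A \<in> null_sets (mu m)"
    using A by (simp add: null_sets_def emeasure_eq_measure measure_le_0_iff)
  then show ?thesis
  proof (rule AE_I')
    show "{\<omega> \<in> space (mu m). \<not> (\<exists>s. \<forall>k\<in>window N. \<omega> (k + s) = v k)} \<subseteq> A"
      by (auto simp: A_def P_def space_mu)
  qed
qed

text \<open>Countably many windows carry finitely many words each, so the exceptional null sets can
  be united.\<close>

lemma AE_transitive: "AE \<omega> in mu m. transitive \<omega>"
proof -
  have "AE \<omega> in mu m. \<forall>n. \<forall>v\<in>words (window (int n)). \<exists>s. \<forall>k\<in>window (int n). \<omega> (k + s) = v k"
    unfolding AE_all_countable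
    by (intro allI AE_finite_allI finite_words AE_word_occurs) (auto simp: window_def words_Omega)
  then show ?thesis
  proof (rule AE_mp, intro AE_I2 impI)
    fix \<omega> assume *: "\<forall>n. \<forall>v\<in>words (window (int n)). \<exists>s. \<forall>k\<in>window (int n). \<omega> (k + s) = v k"
    show "transitive \<omega>"
      unfolding transitive_def
    proof (intro ballI allI)
      fix \<omega>' N assume "\<omega>' \<in> Omega m"
      \<comment> \<open>For negative \<open>N\<close> the window is empty, hence still contained in
        the one of \<open>nat N = 0\<close>.\<close>
      then have "trunc (window (int (nat N))) \<omega>' \<in> words (window (int (nat N)))" by (auto simp: words_def)
      with * obtain s where "\<forall>k\<in>window (int (nat N)). \<omega> (k + s) = trunc (window (int (nat N))) \<omega>' k" by blast
      then show "\<exists>s. \<forall>k\<in>window N. \<omega> (k + s) = \<omega>' k"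
        by (intro exI[of _ s]) (auto simp: trunc_def window_def)
    qed
  qed
qed

end

section \<open>Moments of the density of states\<close>

text \<open>
  The matrix element \<open>\<langle>\<delta>\<^sub>i, J\<^sup>n \<delta>\<^sub>j\<rangle>\<close> of the Jacobi matrix with diagonal \<open>b\<close> is a
  polynomial in the off-diagonal entry.
\<close>

fun ker :: "(int \<Rightarrow> real) \<Rightarrow> nat \<Rightarrow> int \<Rightarrow> int \<Rightarrow> real poly" where
  "ker b 0 i j = (if i = j then 1 else 0)"
| "ker b (Suc n) i j = smult (b i) (ker b n i j) + [:0, 1:] * (ker b n (i - 1) j + ker b n (i + 1) j)"

lemma ker_Suc: "ker b (Suc n) i j = [:b i:] * ker b n i j + [:0, 1:] * (ker b n (i - 1) j + ker b n (i + 1) j)"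
  by simp

lemma (in bounded_potential) entry_funpow_delta:
  "entry ((const_jacobi b c ^^ n) (delta j)) i = complex_of_real (poly (ker b n i j) c)"
  by (induction n arbitrary: i) (auto simp: entry_delta entry_const_jacobi algebra_simps)

lemma ker_shift: "ker (\<lambda>k. b (k + s)) n i j = ker b n (i + s) (j + s)"
proof (induction n arbitrary: i)
  case (Suc n)
  have "i - 1 + s = i + s - 1" "i + 1 + s = i + s + 1" by auto
  then show ?case by (simp only: ker.simps Suc.IH)
qed simp

lemma degree_ker: "degree (ker b n i j) \<le> n"
proof (induction n arbitrary: i)
  case (Suc n)
  have "degree (smult (b i) (ker b n i j)) \<le> Suc n"
    using degree_smult_le[of "b i" "ker b n i j"] Suc[of i] by linarith
  moreover have "degree ([:0, 1:] * (ker b n (i - 1) j + ker b n (i + 1) j)) \<le> Suc n"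
    using degree_add_le[OF Suc[of "i - 1"] Suc[of "i + 1"]]
      degree_mult_le[of "[:0, 1:]" "ker b n (i - 1) j + ker b n (i + 1) j"] by simp
  ultimately show ?case unfolding ker.simps by (rule degree_add_le)
qed simp

lemma finite_window [simp]: "finite (window N)"
  by (simp add: window_def)

text \<open>Matrix multiplication for \<open>J^a\<close> and \<open>J^n\<close>. Finite propagation
  makes the sum finite: a walk of \<open>a\<close> steps from \<open>i\<close> stays inside the
  window.\<close>

lemma ker_add:
  assumes "\<bar>i\<bar> + int a \<le> N"
  shows "ker b (a + n) i j = (\<Sum>k\<in>window N. ker b a i k * ker b n k j)"
  using assms
proof (induction a arbitrary: i)
  case 0
  then have "i \<in> window N" by (auto simp: window_def)
  then show ?case by (simp add: if_distrib[of "\<lambda>x. x * _"] cong: if_cong)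
next
  case (Suc a)
  have "ker b (a + n) i j = (\<Sum>k\<in>window N. ker b a i k * ker b n k j)"
    "ker b (a + n) (i - 1) j = (\<Sum>k\<in>window N. ker b a (i - 1) k * ker b n k j)"
    "ker b (a + n) (i + 1) j = (\<Sum>k\<in>window N. ker b a (i + 1) k * ker b n k j)"
    using Suc.prems by (auto intro!: Suc.IH)
  then show ?case
    by (simp only: ker_Suc add_Suc)
      (simp only: sum.distrib[symmetric] sum_distrib_left distrib_right distrib_left mult.assoc)
qed

text \<open>Leibniz rule: the derivative of \<open>J^n\<close> is the sum of
  \<open>J^a \<Delta> J^(n-1-a)\<close>, where \<open>\<Delta>\<close> has ones next to the
  diagonal.\<close>

lemma pderiv_ker:
  assumes "\<bar>i\<bar> + int n \<le> N"
  shows "pderiv (ker b n i j) = (\<Sum>a<n. \<Sum>k\<in>window N.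
    ker b a i k * (ker b (n - 1 - a) (k - 1) j + ker b (n - 1 - a) (k + 1) j))"
  using assms
proof (induction n arbitrary: i)
  case (Suc n)
  \<comment> \<open>\<open>S\<close> holds the Leibniz terms for the power \<open>Suc n\<close>,
    \<open>S'\<close> those for \<open>n\<close>. The recursion of \<open>ker\<close> in its row
    index produces \<open>S (Suc a)\<close> from \<open>S' a\<close>, while \<open>S 0\<close> comes
    from differentiating the factor \<open>[:0, 1:]\<close>.\<close>
  define S where "S a i = (\<Sum>k\<in>window N. ker b a i k * (ker b (n - a) (k - 1) j + ker b (n - a) (k + 1) j))" for a i
  define S' where "S' a i = (\<Sum>k\<in>window N. ker b a i k * (ker b (n - Suc a) (k - 1) j + ker b (n - Suc a) (k + 1) j))" for a i
  have S: "S (Suc a) i = [:b i:] * S' a i + [:0, 1:] * (S' a (i - 1) + S' a (i + 1))" for a i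
    unfolding S_def S'_def ker_Suc
    by (simp only: sum.distrib[symmetric] sum_distrib_left) (intro sum.cong refl, simp only: algebra_simps)
  have IH: "pderiv (ker b n i' j) = (\<Sum>a<n. S' a i')" if "i' \<in> {i, i - 1, i + 1}" for i'
    using Suc.IH[of i'] that Suc.prems by (auto simp: S'_def)
  have "i \<in> window N" using Suc.prems by (auto simp: window_def)
  then have S0: "S 0 i = ker b n (i - 1) j + ker b n (i + 1) j"
    by (simp add: S_def if_distrib[of "\<lambda>x. x * _"] cong: if_cong)
  have "pderiv (ker b (Suc n) i j) = S 0 i + ([:b i:] * pderiv (ker b n i j)
      + [:0, 1:] * (pderiv (ker b n (i - 1) j) + pderiv (ker b n (i + 1) j)))"
    by (simp add: S0 pderiv_add pderiv_smult pderiv_mult pderiv_pCons algebra_simps)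
  also have "\<dots> = S 0 i + (\<Sum>a<n. S (Suc a) i)"
    by (simp only: IH insert_iff simp_thms S sum.distrib[symmetric] sum_distrib_left distrib_left)
  also have "\<dots> = (\<Sum>a<Suc n. S a i)"
    by (simp add: sum.lessThan_Suc_shift del: sum.lessThan_Suc)
  finally show ?case by (simp add: S_def)
qed (simp add: pderiv_1)

text \<open>A summation range independent of \<open>p\<close> is what permits exchanging the sum
  with an integral over \<open>\<omega>\<close>, along which the degree may vary.\<close>

lemma poly_eq_sum:
  fixes p :: "'a::comm_ring_1 poly"
  assumes "degree p \<le> N" shows "poly p x = (\<Sum>k\<le>N. coeff p k * x ^ k)"
  unfolding poly_altdef
  by (rule sum.mono_neutral_left) (use assms in \<open>auto simp: coeff_eq_0\<close>)

lemma poly_pderiv_eq_sum: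
  fixes p :: "real poly"
  assumes "degree p \<le> N" shows "poly (pderiv p) x = (\<Sum>k\<le>N. coeff p k * (real k * x ^ (k - 1)))"
proof -
  have "((\<lambda>x. \<Sum>k\<le>N. coeff p k * x ^ k) has_real_derivative (\<Sum>k\<le>N. coeff p k * (real k * x ^ (k - 1)))) (at x)"
    by (auto intro!: derivative_eq_intros sum.cong)
  moreover have "poly p = (\<lambda>x. \<Sum>k\<le>N. coeff p k * x ^ k)"
    by (rule ext) (rule poly_eq_sum[OF assms])
  ultimately have "(poly p has_real_derivative (\<Sum>k\<le>N. coeff p k * (real k * x ^ (k - 1)))) (at x)"
    by (simp only:)
  then show ?thesis using DERIV_unique[OF poly_DERIV] by blast
qed

section \<open>The trace per unit volume of polynomials in the Jacobi matrix\<close>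

locale shift_potential = uniform_shift m for m +
  fixes q :: "(int \<Rightarrow> real) \<Rightarrow> real" and R :: real
  assumes cont: "continuous_on (Omega m) q"
    and bound: "\<omega> \<in> Omega m \<Longrightarrow> \<bar>q \<omega>\<bar> \<le> R"
begin

definition pot :: "(int \<Rightarrow> real) \<Rightarrow> int \<Rightarrow> real" where
  "pot \<omega> n = q (\<lambda>k. \<omega> (k + n))"

lemma pot_shift: "pot (\<lambda>k. \<omega> (k + s)) = (\<lambda>n. pot \<omega> (n + s))"
  by (rule ext) (simp add: pot_def ac_simps)

lemma bounded_pot: "\<omega> \<in> Omega m \<Longrightarrow> bounded_potential (pot \<omega>) R"
  by standard (simp add: pot_def bound)

definition bdd :: "((int \<Rightarrow> real) \<Rightarrow> real) \<Rightarrow> bool" where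
  "bdd f \<longleftrightarrow> f \<in> borel_measurable (mu m) \<and> (\<exists>C. \<forall>\<omega>\<in>Omega m. \<bar>f \<omega>\<bar> \<le> C)"

lemma bdd_const: "bdd (\<lambda>_. c)"
  by (auto simp: bdd_def)

lemma bdd_add: "bdd f \<Longrightarrow> bdd g \<Longrightarrow> bdd (\<lambda>\<omega>. f \<omega> + g \<omega>)"
proof -
  assume "bdd f" "bdd g"
  then obtain C D where *: "\<And>\<omega>. \<omega> \<in> Omega m \<Longrightarrow> \<bar>f \<omega>\<bar> \<le> C" "\<And>\<omega>. \<omega> \<in> Omega m \<Longrightarrow> \<bar>g \<omega>\<bar> \<le> D"
    by (auto simp: bdd_def)
  have "\<bar>f \<omega> + g \<omega>\<bar> \<le> C + D" if "\<omega> \<in> Omega m" for \<omega>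
    using *[OF that] by linarith
  then show ?thesis using \<open>bdd f\<close> \<open>bdd g\<close> by (auto simp: bdd_def)
qed

lemma bdd_mult: "bdd f \<Longrightarrow> bdd g \<Longrightarrow> bdd (\<lambda>\<omega>. f \<omega> * g \<omega>)"
proof -
  assume "bdd f" "bdd g"
  then obtain C D where *: "\<And>\<omega>. \<omega> \<in> Omega m \<Longrightarrow> \<bar>f \<omega>\<bar> \<le> C" "\<And>\<omega>. \<omega> \<in> Omega m \<Longrightarrow> \<bar>g \<omega>\<bar> \<le> D"
    by (auto simp: bdd_def)
  have "\<bar>f \<omega> * g \<omega>\<bar> \<le> C * D" if "\<omega> \<in> Omega m" for \<omega>
    unfolding abs_mult by (rule mult_mono) (use *[OF that] in auto)
  then show ?thesis using \<open>bdd f\<close> \<open>bdd g\<close> by (auto simp: bdd_def)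
qed

lemma bdd_sum: "(\<And>i. i \<in> I \<Longrightarrow> bdd (f i)) \<Longrightarrow> bdd (\<lambda>\<omega>. \<Sum>i\<in>I. f i \<omega>)"
  by (induction I rule: infinite_finite_induct) (auto intro: bdd_const bdd_add)

lemma bdd_integrable: "bdd f \<Longrightarrow> integrable (mu m) f"
proof -
  interpret prob_space "mu m" by (rule prob_space_mu)
  assume "bdd f"
  then obtain C where "f \<in> borel_measurable (mu m)" "\<And>\<omega>. \<omega> \<in> Omega m \<Longrightarrow> \<bar>f \<omega>\<bar> \<le> C"
    by (auto simp: bdd_def)
  then show ?thesis by (intro integrable_const_bound[where B = C]) (auto simp: space_mu)
qed

lemma bdd_pot: "bdd (\<lambda>\<omega>. pot \<omega> n)"
  unfolding bdd_def pot_def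
proof (intro conjI exI ballI)
  show "(\<lambda>\<omega>. q (\<lambda>k. \<omega> (k + n))) \<in> borel_measurable (mu m)"
    by (intro continuous_borel_measurable_mu continuous_on_compose2[OF cont] continuous_on_shift) auto
qed (rule bound, simp)

lemma bdd_coeff_ker: "bdd (\<lambda>\<omega>. coeff (ker (pot \<omega>) n i j) k)"
proof (induction n arbitrary: i k)
  case (Suc n)
  show ?case
    by (cases k) (auto simp: coeff_pCons intro!: bdd_add bdd_mult bdd_pot bdd_const Suc)
qed (simp add: bdd_const)

lemma bdd_poly_ker: "bdd (\<lambda>\<omega>. poly (ker (pot \<omega>) n i j) c)"
  unfolding poly_eq_sum[OF degree_ker] by (intro bdd_sum bdd_mult bdd_coeff_ker bdd_const)

definition moment :: "real \<Rightarrow> nat \<Rightarrow> real" where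
  "moment c n = (\<integral>\<omega>. poly (ker (pot \<omega>) n 0 0) c \<partial>mu m)"

text \<open>The trace per unit volume of \<open>\<Delta> J^n\<close>: row 0 of
  \<open>\<Delta>\<close> selects the entries in rows -1 and 1.\<close>

definition hop_moment :: "real \<Rightarrow> nat \<Rightarrow> real" where
  "hop_moment c n = (\<integral>\<omega>. poly (ker (pot \<omega>) n (- 1) 0) c + poly (ker (pot \<omega>) n 1 0) c \<partial>mu m)"

text \<open>Cyclicity of the trace per unit volume; invariance of \<open>\<mu>\<close> permits to translate each summand.\<close>

lemma hop_moment_cyclic:
  assumes N: "int a + int r + 1 \<le> N"
  shows "(\<integral>\<omega>. (\<Sum>k\<in>window N. poly (ker (pot \<omega>) a 0 k) c *
      (poly (ker (pot \<omega>) r (k - 1) 0) c + poly (ker (pot \<omega>) r (k + 1) 0) c)) \<partial>mu m) = hop_moment c (r + a)"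
proof -
  \<comment> \<open>By \<open>ker_shift\<close>, \<open>?G k\<close> evaluated at
    \<open>\<omega>\<close> translated by \<open>k\<close> is the \<open>k\<close>-th summand at
    \<open>\<omega>\<close>. After the substitution of \<open>- k\<close> for \<open>k\<close>, the
    sum over \<open>?G\<close> is a matrix product in the opposite order.\<close>
  let ?G = "\<lambda>k \<omega>. poly (ker (pot \<omega>) a (- k) 0) c *
      (poly (ker (pot \<omega>) r (- 1) (- k)) c + poly (ker (pot \<omega>) r 1 (- k)) c)"
  have G: "bdd (?G k)" for k by (intro bdd_add bdd_mult bdd_poly_ker)
  have F: "bdd (\<lambda>\<omega>. poly (ker (pot \<omega>) a 0 k) c *
      (poly (ker (pot \<omega>) r (k - 1) 0) c + poly (ker (pot \<omega>) r (k + 1) 0) c))" for k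
    by (intro bdd_add bdd_mult bdd_poly_ker)
  have inner: "(\<Sum>k\<in>window N. ?G k \<omega>) =
      poly (ker (pot \<omega>) (r + a) (- 1) 0) c + poly (ker (pot \<omega>) (r + a) 1 0) c" for \<omega>
  proof -
    have "(\<Sum>k\<in>window N. ?G k \<omega>) = (\<Sum>k\<in>window N. poly (ker (pot \<omega>) a k 0) c *
      (poly (ker (pot \<omega>) r (- 1) k) c + poly (ker (pot \<omega>) r 1 k) c))"
      by (rule sum.reindex_bij_witness[of _ uminus uminus]) (auto simp: window_def)
    moreover have "poly (ker (pot \<omega>) (r + a) i 0) c =
        (\<Sum>k\<in>window N. poly (ker (pot \<omega>) a k 0) c * poly (ker (pot \<omega>) r i k) c)" if "\<bar>i\<bar> = 1" for i
      by (subst ker_add[where N = N]) (use that N in \<open>auto simp: poly_sum mult.commute\<close>)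
    ultimately show ?thesis by (simp add: sum.distrib distrib_left)
  qed
  have "(\<integral>\<omega>. poly (ker (pot \<omega>) a 0 k) c *
      (poly (ker (pot \<omega>) r (k - 1) 0) c + poly (ker (pot \<omega>) r (k + 1) 0) c) \<partial>mu m) = (\<integral>\<omega>. ?G k \<omega> \<partial>mu m)" for k
    using integral_mu_shift[of "?G k" k] G[of k]
    by (simp add: pot_shift ker_shift bdd_def algebra_simps)
  then have "(\<integral>\<omega>. (\<Sum>k\<in>window N. poly (ker (pot \<omega>) a 0 k) c *
      (poly (ker (pot \<omega>) r (k - 1) 0) c + poly (ker (pot \<omega>) r (k + 1) 0) c)) \<partial>mu m)
      = (\<integral>\<omega>. (\<Sum>k\<in>window N. ?G k \<omega>) \<partial>mu m)"
    using F G by (subst (1 2) Bochner_Integration.integral_sum) (auto intro: bdd_integrable)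
  also have "\<dots> = hop_moment c (r + a)"
    by (simp only: inner hop_moment_def)
  finally show ?thesis .
qed

text \<open>By cyclicity all \<open>n\<close> Leibniz terms have the same integral. Differentiation
  under the integral happens on the coefficients, since the integrand is a polynomial in
  \<open>c\<close> of degree at most \<open>n\<close>.\<close>

lemma moment_derivative:
  "((\<lambda>c. moment c n) has_real_derivative real n * hop_moment c (n - 1)) (at c)"
proof -
  let ?p = "\<lambda>\<omega>. ker (pot \<omega>) n 0 0"
  have eq: "moment c n = (\<Sum>k\<le>n. (\<integral>\<omega>. coeff (?p \<omega>) k \<partial>mu m) * c ^ k)" for c
    unfolding moment_def poly_eq_sum[OF degree_ker]
    by (subst Bochner_Integration.integral_sum) (auto intro!: bdd_integrable bdd_mult bdd_const bdd_coeff_ker)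
  have "((\<lambda>c. moment c n) has_real_derivative
      (\<Sum>k\<le>n. (\<integral>\<omega>. coeff (?p \<omega>) k \<partial>mu m) * (real k * c ^ (k - 1)))) (at c)"
    unfolding eq by (auto intro!: derivative_eq_intros sum.cong)
  also have "(\<Sum>k\<le>n. (\<integral>\<omega>. coeff (?p \<omega>) k \<partial>mu m) * (real k * c ^ (k - 1))) = (\<integral>\<omega>. poly (pderiv (?p \<omega>)) c \<partial>mu m)"
    unfolding poly_pderiv_eq_sum[OF degree_ker]
    by (subst Bochner_Integration.integral_sum) (auto intro!: bdd_integrable bdd_mult bdd_const bdd_coeff_ker)
  also have "\<dots> = (\<integral>\<omega>. (\<Sum>a<n. \<Sum>k\<in>window (int n + 1). poly (ker (pot \<omega>) a 0 k) c *
      (poly (ker (pot \<omega>) (n - 1 - a) (k - 1) 0) c + poly (ker (pot \<omega>) (n - 1 - a) (k + 1) 0) c)) \<partial>mu m)"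
    by (subst pderiv_ker[where N = "int n + 1"]) (auto simp: poly_sum)
  also have "\<dots> = (\<Sum>a<n. (\<integral>\<omega>. (\<Sum>k\<in>window (int n + 1). poly (ker (pot \<omega>) a 0 k) c *
      (poly (ker (pot \<omega>) (n - 1 - a) (k - 1) 0) c + poly (ker (pot \<omega>) (n - 1 - a) (k + 1) 0) c)) \<partial>mu m))"
    by (rule Bochner_Integration.integral_sum)
      (auto intro!: bdd_integrable bdd_sum bdd_mult bdd_add bdd_poly_ker)
  also have "\<dots> = (\<Sum>a<n. hop_moment c (n - 1))"
    by (rule sum.cong) (auto simp: hop_moment_cyclic)
  finally show ?thesis by simp
qed

text \<open>The functional \<open>\<tau>(f(J_c))\<close> on real polynomials, extended linearly from
  the moments.\<close>

definition state :: "real \<Rightarrow> real poly \<Rightarrow> real" where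
  "state c f = (\<Sum>k\<le>degree f. coeff f k * moment c k)"

lemma entry_poly_op:
  assumes "\<omega> \<in> Omega m"
  shows "entry (poly_op f (const_jacobi (pot \<omega>) c) (delta 0)) i =
    (\<Sum>k\<le>degree f. coeff f k * complex_of_real (poly (ker (pot \<omega>) k i 0) c))"
proof -
  interpret bounded_potential "pot \<omega>" R by (rule bounded_pot[OF assms])
  show ?thesis by (simp add: poly_op_def entry_funpow_delta)
qed

lemma degree_map_of_real [simp]: "degree (map_poly complex_of_real f) = degree f"
  by (rule degree_map_poly) simp

lemma entry_poly_op_real:
  assumes "\<omega> \<in> Omega m"
  shows "entry (poly_op (map_poly complex_of_real f) (const_jacobi (pot \<omega>) c) (delta 0)) i =
    complex_of_real (\<Sum>k\<le>degree f. coeff f k * poly (ker (pot \<omega>) k i 0) c)"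
  by (simp add: entry_poly_op[OF assms] coeff_map_poly)

lemma entry_poly_op_bound:
  assumes \<omega>: "\<omega> \<in> Omega m"
    and K: "\<And>x. complex_of_real x \<in> spectrum (const_jacobi (pot \<omega>) c) \<Longrightarrow> \<bar>poly f x\<bar> \<le> K"
  shows "\<bar>\<Sum>k\<le>degree f. coeff f k * poly (ker (pot \<omega>) k i 0) c\<bar> \<le> K"
proof -
  interpret bounded_potential "pot \<omega>" R by (rule bounded_pot[OF \<omega>])
  let ?\<psi> = "poly_op (map_poly complex_of_real f) (const_jacobi (pot \<omega>) c) (delta 0)"
  have "norm ?\<psi> \<le> K * norm (delta 0)"
    by (rule norm_poly_op_le[OF self_adjoint_const_jacobi]) (use K in \<open>simp add: poly_of_real_poly\<close>)
  moreover have "cmod (entry ?\<psi> i) = \<bar>\<Sum>k\<le>degree f. coeff f k * poly (ker (pot \<omega>) k i 0) c\<bar>"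
    unfolding entry_poly_op_real[OF \<omega>] norm_of_real ..
  ultimately show ?thesis using cmod_entry_le[of ?\<psi> i] by simp
qed

lemma state_eq_integral:
  "state c f = (\<integral>\<omega>. (\<Sum>k\<le>degree f. coeff f k * poly (ker (pot \<omega>) k 0 0) c) \<partial>mu m)"
  unfolding state_def moment_def
  by (subst Bochner_Integration.integral_sum) (auto intro!: bdd_integrable bdd_mult bdd_const bdd_poly_ker)

lemma integral_bound:
  assumes "\<And>\<omega>. \<omega> \<in> Omega m \<Longrightarrow> \<bar>f \<omega>\<bar> \<le> K" "bdd f"
  shows "\<bar>\<integral>\<omega>. f \<omega> \<partial>mu m\<bar> \<le> K"
proof -
  interpret prob_space "mu m" by (rule prob_space_mu)
  have "\<bar>\<integral>\<omega>. f \<omega> \<partial>mu m\<bar> \<le> (\<integral>\<omega>. \<bar>f \<omega>\<bar> \<partial>mu m)" by (rule integral_abs_bound)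
  also have "\<dots> \<le> (\<integral>\<omega>. K \<partial>mu m)"
    using assms bdd_integrable[OF assms(2)] by (intro integral_mono) (auto simp: space_mu)
  finally show ?thesis by (simp add: prob_space)
qed

lemma state_bound:
  assumes "\<And>x. \<bar>x\<bar> \<le> R + 2 * \<bar>c\<bar> \<Longrightarrow> \<bar>poly f x\<bar> \<le> K"
  shows "\<bar>state c f\<bar> \<le> K"
  unfolding state_eq_integral
proof (rule integral_bound)
  fix \<omega> assume \<omega>: "\<omega> \<in> Omega m"
  interpret bounded_potential "pot \<omega>" R by (rule bounded_pot[OF \<omega>])
  show "\<bar>\<Sum>k\<le>degree f. coeff f k * poly (ker (pot \<omega>) k 0 0) c\<bar> \<le> K"
    by (rule entry_poly_op_bound[OF \<omega>]) (use assms spectrum_const_jacobi_bounded in blast)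
qed (intro bdd_sum bdd_mult bdd_const bdd_poly_ker)

text \<open>Mean value theorem: the derivative is the average of two matrix elements of
  \<open>f'(J_t)\<close>, in rows -1 and 1, each at most \<open>K\<close>. Only values of
  \<open>f'\<close> on the spectra enter, so large values of \<open>f\<close> do no harm.\<close>

lemma state_derivative_bound:
  assumes K: "\<And>\<omega> t x. \<omega> \<in> Omega m \<Longrightarrow> 0 \<le> t \<Longrightarrow> t \<le> c \<Longrightarrow>
      complex_of_real x \<in> spectrum (const_jacobi (pot \<omega>) t) \<Longrightarrow> \<bar>poly (pderiv f) x\<bar> \<le> K"
    and c: "0 \<le> c"
  shows "\<bar>state c f - state 0 f\<bar> \<le> 2 * K * c"
proof -
  let ?n = "degree f"
  let ?D = "\<lambda>t. \<Sum>k\<le>?n. coeff f k * (real k * hop_moment t (k - 1))"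
  have der: "(\<lambda>t. state t f) differentiable at t"
    "((\<lambda>t. state t f) has_real_derivative ?D t) (at t)" for t
  proof -
    show "((\<lambda>t. state t f) has_real_derivative ?D t) (at t)"
      unfolding state_def by (intro DERIV_sum DERIV_cmult moment_derivative)
    then show "(\<lambda>t. state t f) differentiable at t" by (auto simp: real_differentiable_def)
  qed
  have D: "\<bar>?D t\<bar> \<le> 2 * K" if t: "0 \<le> t" "t \<le> c" for t
  proof -
    \<comment> \<open>The term \<open>k = 0\<close> carries the factor \<open>0\<close>, so the
      truncated subtraction \<open>k - 1\<close> is harmless there.\<close>
    have "?D t = (\<Sum>k<?n. coeff f (Suc k) * (real (Suc k) * hop_moment t k))"
      by (subst sum.atMost_shift) simp
    also have "\<dots> = (\<Sum>k<?n. coeff (pderiv f) k * hop_moment t k)"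
      by (intro sum.cong) (auto simp: coeff_pderiv)
    also have "\<dots> = (\<Sum>k\<le>degree (pderiv f). coeff (pderiv f) k * hop_moment t k)"
    proof (rule sum.mono_neutral_cong)
      show "coeff (pderiv f) k * hop_moment t k = 0" if "k \<in> {..degree (pderiv f)} - {..<?n}" for k
        using that by (auto simp: coeff_pderiv coeff_eq_0)
    qed (auto simp: coeff_eq_0)
    also have "\<dots> = (\<integral>\<omega>. (\<Sum>k\<le>degree (pderiv f). coeff (pderiv f) k * poly (ker (pot \<omega>) k (- 1) 0) t)
        + (\<Sum>k\<le>degree (pderiv f). coeff (pderiv f) k * poly (ker (pot \<omega>) k 1 0) t) \<partial>mu m)"
      unfolding hop_moment_def sum.distrib[symmetric] distrib_left[symmetric]
      by (subst Bochner_Integration.integral_sum)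
        (auto intro!: bdd_integrable bdd_mult bdd_add bdd_const bdd_poly_ker)
    also have "\<bar>\<dots>\<bar> \<le> K + K"
    proof (rule integral_bound)
      fix \<omega> assume \<omega>: "\<omega> \<in> Omega m"
      note eb = entry_poly_op_bound[OF \<omega>, of t "pderiv f" K, OF K[OF \<omega> t]]
      show "\<bar>(\<Sum>k\<le>degree (pderiv f). coeff (pderiv f) k * poly (ker (pot \<omega>) k (- 1) 0) t)
        + (\<Sum>k\<le>degree (pderiv f). coeff (pderiv f) k * poly (ker (pot \<omega>) k 1 0) t)\<bar> \<le> K + K"
        by (rule order_trans[OF abs_triangle_ineq add_mono[OF eb eb]])
    qed (intro bdd_add bdd_sum bdd_mult bdd_const bdd_poly_ker)
    finally show ?thesis by simp
  qed
  show ?thesis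
  proof (cases "c = 0")
    case False
    then have "0 < c" using c by simp
    then obtain t where "0 < t" "t < c" "state c f - state 0 f = (c - 0) * ?D t"
      using MVT2[of 0 c "\<lambda>t. state t f" ?D] der(2) by blast
    then show ?thesis using mult_right_mono[OF D[of t], of c] c by (simp add: abs_mult mult.commute)
  qed simp
qed

end

section \<open>Measures with prescribed moments\<close>

text \<open>
  Riesz representation for a positive functional on the polynomials over \<open>[-R, R]\<close>: the values of
  the functional on the Bernstein basis are the weights of discrete measures, and Helly's theorem
  yields a weak limit.
\<close>

locale moment_functional =
  fixes M :: "nat \<Rightarrow> real" and R :: real and L :: "real poly \<Rightarrow> real"
  defines "L f \<equiv> \<Sum>k\<le>degree f. coeff f k * M k"
  assumes R: "R > 0" and M0: "M 0 = 1"
    and L_bound: "\<And>f K. (\<And>x. \<bar>x\<bar> \<le> R \<Longrightarrow> \<bar>poly f x\<bar> \<le> K) \<Longrightarrow> \<bar>L f\<bar> \<le> K"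
begin

lemma L_eq: "degree f \<le> N \<Longrightarrow> L f = (\<Sum>k\<le>N. coeff f k * M k)"
  unfolding L_def by (rule sum.mono_neutral_left) (auto simp: coeff_eq_0)

lemma L_add: "L (f + g) = L f + L g"
  by (simp add: L_eq[of _ "max (degree f) (degree g)"] degree_add_le_max sum.distrib[symmetric] algebra_simps)

lemma L_smult: "L (smult c f) = c * L f"
  by (simp add: L_eq[of _ "degree f"] sum_distrib_left mult.assoc)

lemma L_diff: "L (f - g) = L f - L g"
  using L_add[of "f - g" g] by simp

lemma L_sum: "L (\<Sum>i\<in>I. f i) = (\<Sum>i\<in>I. L (f i))"
proof (induction I rule: infinite_finite_induct)
  case (insert i I)
  then show ?case by (simp add: L_add)
qed (simp_all add: L_def)

lemma L_const: "L [:c:] = c"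
  by (simp add: L_def M0)

lemma L_one: "L 1 = 1"
  using L_const[of 1] by (simp add: one_pCons)

text \<open>A functional with \<open>L 1 = 1\<close> that is bounded by the supremum is positive: if
  \<open>0 \<le> f \<le> B\<close>, then \<open>f - B / 2\<close> has absolute value at most
  \<open>B / 2\<close>.\<close>

lemma L_nonneg:
  assumes "\<And>x. \<bar>x\<bar> \<le> R \<Longrightarrow> 0 \<le> poly f x" shows "0 \<le> L f"
proof -
  have "compact ((\<lambda>x. poly f x) ` {-R..R})"
    by (intro compact_continuous_image continuous_intros compact_Icc)
  then obtain B where B: "\<And>x. x \<in> {-R..R} \<Longrightarrow> norm (poly f x) \<le> B"
    using compact_imp_bounded bounded_iff by (metis (mono_tags, lifting) image_eqI)
  have "\<bar>L (f - [:B / 2:])\<bar> \<le> B / 2"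
  proof (rule L_bound)
    fix x :: real assume x: "\<bar>x\<bar> \<le> R"
    then have "x \<in> {-R..R}" by auto
    then have "\<bar>poly f x - B / 2\<bar> \<le> B / 2" using B[of x] assms[OF x] unfolding abs_le_iff by auto
    then show "\<bar>poly (f - [:B / 2:]) x\<bar> \<le> B / 2" by simp
  qed
  then show ?thesis unfolding L_diff L_const by (auto simp only: abs_le_iff)
qed

definition node :: "nat \<Rightarrow> nat \<Rightarrow> real" where
  "node n k = 2 * R * (real k / real n) - R"

text \<open>The Bernstein basis of \<open>[0, 1]\<close> pulled back along
  \<open>x \<mapsto> (x + R) / (2 R)\<close>; \<open>node n k\<close> is the point of
  \<open>[-R, R]\<close> that corresponds to \<open>k / n\<close>.\<close>

definition bernstein_poly :: "nat \<Rightarrow> nat \<Rightarrow> real poly" where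
  "bernstein_poly n k =
     pcompose (smult (of_nat (n choose k)) ([:0, 1:] ^ k * [:1, -1:] ^ (n - k))) [:1 / 2, 1 / (2 * R):]"

definition weight :: "nat \<Rightarrow> nat \<Rightarrow> real" where
  "weight n k = L (bernstein_poly n k)"

lemma poly_bernstein: "poly (bernstein_poly n k) x = Bernstein n k ((x + R) / (2 * R))"
proof -
  have "1 / 2 + x * (1 / (2 * R)) = (x + R) / (2 * R)" using R by (simp add: field_simps)
  then show ?thesis
    by (simp add: bernstein_poly_def poly_pcompose Bernstein_def poly_power del: times_divide_eq_right)
qed

lemma rescale: "\<bar>x\<bar> \<le> R \<Longrightarrow> (x + R) / (2 * R) \<in> {0..1}"
  using R by (auto simp: field_simps)

lemma weight_nonneg: "0 \<le> weight n k"
  unfolding weight_def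
  by (rule L_nonneg) (use rescale in \<open>auto simp: poly_bernstein intro!: Bernstein_nonneg\<close>)

lemma sum_weight: "(\<Sum>k\<le>n. weight n k) = 1"
proof -
  have "(\<Sum>k\<le>n. bernstein_poly n k) = 1"
    by (subst poly_eq_poly_eq_iff[symmetric]) (auto simp: poly_sum poly_bernstein)
  then show ?thesis by (simp add: weight_def L_sum[symmetric] L_one)
qed

lemma abs_node: "k \<le> n \<Longrightarrow> \<bar>node n k\<bar> \<le> R"
proof -
  assume "k \<le> n"
  then have "0 \<le> real k / real n" "real k / real n \<le> 1" by (auto simp: divide_le_eq_1)
  then have "0 \<le> 2 * R * (real k / real n)" "2 * R * (real k / real n) \<le> 2 * R * 1"
    using R by (intro mult_nonneg_nonneg mult_left_mono; simp)+
  then show ?thesis by (simp add: node_def abs_le_iff)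
qed

definition discrete :: "nat \<Rightarrow> real measure" where
  "discrete n = distr (point_measure {..n} (weight n)) borel (node n)"

lemma measurable_node: "node n \<in> borel_measurable (point_measure {..n} (weight n))"
  by (auto simp: measurable_def space_point_measure sets_point_measure)

lemma real_distribution_discrete: "real_distribution (discrete n)"
proof -
  have "prob_space (point_measure {..n} (weight n))"
  proof (rule prob_spaceI)
    have "emeasure (point_measure {..n} (weight n)) {..n} = ennreal (\<Sum>k\<le>n. weight n k)"
      by (simp add: emeasure_point_measure_finite sum_ennreal weight_nonneg)
    then show "emeasure (point_measure {..n} (weight n)) (space (point_measure {..n} (weight n))) = 1"
      by (simp add: space_point_measure sum_weight)
  qed
  then have "prob_space (discrete n)"
    unfolding discrete_def by (rule prob_space.prob_space_distr[OF _ measurable_node])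
  then show ?thesis
    by (simp add: real_distribution_def real_distribution_axioms_def discrete_def)
qed

lemma integral_discrete:
  assumes "g \<in> borel_measurable borel"
  shows "(\<integral>x. g x \<partial>discrete n) = (\<Sum>k\<le>n. weight n k * g (node n k) :: real)"
  unfolding discrete_def integral_distr[OF measurable_node assms]
  by (subst lebesgue_integral_point_measure_finite) (auto simp: weight_nonneg)

text \<open>Tightness is phrased with left-open intervals, and \<open>-R\<close> is itself a node;
  hence the left end \<open>-R - 1\<close>.\<close>

lemma measure_discrete_Icc: "measure (discrete n) {-R - 1 <.. R} = 1"
proof -
  interpret real_distribution "discrete n" by (rule real_distribution_discrete)
  have "(\<integral>x. indicator {-R - 1 <.. R} x \<partial>discrete n) = (\<Sum>k\<le>n. weight n k * indicator {-R - 1 <.. R} (node n k) :: real)"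
    by (rule integral_discrete) simp
  also have "\<dots> = (\<Sum>k\<le>n. weight n k)"
  proof (intro sum.cong refl)
    fix k assume "k \<in> {..n}"
    then show "weight n k * indicator {-R - 1 <.. R} (node n k) = weight n k"
      using abs_node[of k n] by (auto simp: indicator_def abs_le_iff)
  qed
  finally show ?thesis by (simp add: sum_weight)
qed

text \<open>Integrating \<open>h\<close> against \<open>discrete n\<close> is applying
  \<open>L\<close> to the Bernstein polynomial of \<open>h\<close>, which is uniformly close to
  \<open>h\<close> and therefore to \<open>f\<close>; \<open>L_bound\<close> does the rest.\<close>

lemma L_approx:
  fixes h :: "real \<Rightarrow> real"
  assumes h: "continuous_on UNIV h" and f: "\<And>x. \<bar>x\<bar> \<le> R \<Longrightarrow> \<bar>h x - poly f x\<bar> \<le> e" and d: "d > 0"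
  shows "\<forall>\<^sub>F n in sequentially. \<bar>(\<integral>x. h x \<partial>discrete n) - L f\<bar> \<le> e + d"
proof -
  have "continuous_on {0..1} (\<lambda>s. h (2 * R * s - R))"
    by (intro continuous_on_compose2[OF h] continuous_intros) auto
  from Bernstein_Weierstrass[OF this d]
  obtain N where N: "\<And>n s. N \<le> n \<Longrightarrow> s \<in> {0..1} \<Longrightarrow>
      \<bar>h (2 * R * s - R) - (\<Sum>k\<le>n. h (2 * R * (k / n) - R) * Bernstein n k s)\<bar> < d"
    by blast
  have "\<bar>(\<integral>x. h x \<partial>discrete n) - L f\<bar> \<le> e + d" if n: "N \<le> n" for n
  proof -
    let ?B = "\<Sum>k\<le>n. smult (h (node n k)) (bernstein_poly n k)"
    have "(\<integral>x. h x \<partial>discrete n) = L ?B"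
      by (subst integral_discrete) (auto simp: h borel_measurable_continuous_onI L_sum L_smult weight_def mult.commute)
    then have "(\<integral>x. h x \<partial>discrete n) - L f = L (?B - f)" by (simp add: L_diff)
    also have "\<bar>\<dots>\<bar> \<le> e + d"
    proof (rule L_bound)
      fix x :: real assume x: "\<bar>x\<bar> \<le> R"
      have "2 * R * ((x + R) / (2 * R)) - R = x" using R by simp
      then have "\<bar>h x - poly ?B x\<bar> < d"
        using N[OF n rescale[OF x]] by (simp add: poly_sum poly_bernstein node_def)
      then show "\<bar>poly (?B - f) x\<bar> \<le> e + d"
        using f[OF x] by (auto simp: abs_le_iff abs_less_iff)
    qed
    finally show ?thesis .
  qed
  then show ?thesis by (auto simp: eventually_sequentially)
qed

lemma tight_discrete: "tight discrete"
  unfolding tight_def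
proof (intro conjI allI impI real_distribution_discrete)
  fix e :: real assume "e > 0"
  then show "\<exists>a b. a < b \<and> (\<forall>n. 1 - e < measure (discrete n) {a<..b})"
    using R by (intro exI[of _ "- R - 1"] exI[of _ R]) (auto simp: measure_discrete_Icc)
qed

theorem moment_measure_exists:
  obtains \<kappa> where "real_distribution \<kappa>" "AE x in \<kappa>. \<bar>x\<bar> \<le> R"
    "\<And>h f e. continuous_on UNIV h \<Longrightarrow> (\<And>x. \<bar>x\<bar> \<le> R \<Longrightarrow> \<bar>h x - poly f x\<bar> \<le> e) \<Longrightarrow> \<bar>(\<integral>x. h x \<partial>\<kappa>) - L f\<bar> \<le> e"
proof -
  obtain r \<kappa> where r: "strict_mono (r :: nat \<Rightarrow> nat)" and \<kappa>: "real_distribution \<kappa>"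
    and conv: "weak_conv_m (discrete \<circ> id \<circ> r) \<kappa>"
    using tight_imp_convergent_subsubsequence[OF tight_discrete strict_mono_id] by blast
  interpret real_distribution \<kappa> by (rule \<kappa>)
  have lim: "(\<lambda>n. \<integral>x. g x \<partial>discrete (r n)) \<longlonglongrightarrow> (\<integral>x. g x \<partial>\<kappa>)"
    if "\<And>x. isCont g x" "\<And>x. \<bar>g x\<bar> \<le> B" for g :: "real \<Rightarrow> real" and B
    using weak_conv_imp_integral_bdd_continuous_conv[of "discrete \<circ> id \<circ> r" \<kappa> g B] that conv \<kappa>
      real_distribution_discrete by (simp add: o_def)
  \<comment> \<open>A bounded test function that vanishes at every node and is positive outside
    \<open>[-R, R]\<close>, so the weak limit has no mass there.\<close>
  define g where "g x = min 1 (max 0 (\<bar>x\<bar> - R))" for x :: real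
  have g: "continuous_on UNIV g" "\<bar>g x\<bar> \<le> 1" for x
    by (auto simp: g_def intro!: continuous_intros)
  have "(\<integral>x. g x \<partial>discrete n) = 0" for n
    using abs_node by (subst integral_discrete)
      (auto simp: g_def intro!: sum.neutral borel_measurable_continuous_onI g(1))
  then have g0: "(\<integral>x. g x \<partial>\<kappa>) = 0"
    using lim[of g 1] g by (auto simp: continuous_on_eq_continuous_at intro: LIMSEQ_unique)
  have gi: "integrable \<kappa> g"
    by (rule integrable_const_bound[where B = 1]) (auto simp: g borel_measurable_continuous_onI)
  have "AE x in \<kappa>. g x = 0"
    using integral_nonneg_eq_0_iff_AE[OF gi] g0 by (auto simp: g_def)
  then have supp: "AE x in \<kappa>. \<bar>x\<bar> \<le> R"
    by eventually_elim (auto simp: g_def min_def max_def split: if_splits)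
  have approx: "\<bar>(\<integral>x. h x \<partial>\<kappa>) - L f\<bar> \<le> e"
    if h: "continuous_on UNIV h" and f: "\<And>x. \<bar>x\<bar> \<le> R \<Longrightarrow> \<bar>h x - poly f x\<bar> \<le> e" for h f e
  proof -
    \<comment> \<open>Weak convergence tests bounded functions only, so \<open>h\<close> is frozen
      outside \<open>[-R, R]\<close>; by \<open>supp\<close> the integral against
      \<open>\<kappa>\<close> does not change.\<close>
    define h' where "h' x = h (max (- R) (min R x))" for x
    have h': "continuous_on UNIV h'"
      unfolding h'_def by (intro continuous_on_compose2[OF h] continuous_intros) auto
    have h'eq: "h' x = h x" if "\<bar>x\<bar> \<le> R" for x using that by (auto simp: h'_def abs_le_iff)
    have "compact (h ` {-R..R})"
      using h by (intro compact_continuous_image continuous_on_subset[OF h] compact_Icc) auto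
    then obtain B where B: "\<And>x. x \<in> {-R..R} \<Longrightarrow> norm (h x) \<le> B"
      using compact_imp_bounded bounded_iff by (metis (mono_tags, lifting) image_eqI)
    have "\<bar>h' x\<bar> \<le> B" for x using B[of "max (- R) (min R x)"] R by (auto simp: h'_def)
    then have "(\<lambda>n. \<integral>x. h' x \<partial>discrete (r n)) \<longlonglongrightarrow> (\<integral>x. h' x \<partial>\<kappa>)"
      using lim h' by (auto simp: continuous_on_eq_continuous_at)
    then have l: "(\<lambda>n. \<bar>(\<integral>x. h' x \<partial>discrete (r n)) - L f\<bar>) \<longlonglongrightarrow> \<bar>(\<integral>x. h' x \<partial>\<kappa>) - L f\<bar>"
      by (intro tendsto_intros)
    have "\<bar>(\<integral>x. h' x \<partial>\<kappa>) - L f\<bar> \<le> e"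
    proof (rule field_le_epsilon)
      fix d :: real assume "d > 0"
      then have "\<forall>\<^sub>F n in sequentially. \<bar>(\<integral>x. h' x \<partial>discrete n) - L f\<bar> \<le> e + d"
        by (intro L_approx h') (simp add: f h'eq)
      then have "\<forall>\<^sub>F n in sequentially. \<bar>(\<integral>x. h' x \<partial>discrete (r n)) - L f\<bar> \<le> e + d"
        using eventually_subseq[OF r] by blast
      then show "\<bar>(\<integral>x. h' x \<partial>\<kappa>) - L f\<bar> \<le> e + d"
        by (intro tendsto_upperbound[OF l]) auto
    qed
    moreover have "(\<integral>x. h' x \<partial>\<kappa>) = (\<integral>x. h x \<partial>\<kappa>)"
      using supp by (intro integral_cong_AE) (auto simp: h h' borel_measurable_continuous_onI h'eq elim: eventually_mono)
    ultimately show ?thesis by simp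
  qed
  show ?thesis using that[OF \<kappa> supp approx] by blast
qed

end

text \<open>A competitor in the description of \<open>dos_measure\<close> is an arbitrary Borel
  measure. The constant test function shows that it is a probability measure, and the complex
  exponentials identify its characteristic function.\<close>

lemma finite_measure_eqI_continuous:
  assumes \<kappa>: "real_distribution \<kappa>" and s: "sets \<kappa>' = sets borel"
    and h: "\<And>h :: real \<Rightarrow> complex. continuous_on UNIV h \<Longrightarrow> (\<And>x. cmod (h x) \<le> 1) \<Longrightarrow>
      has_bochner_integral \<kappa>' h (\<integral>x. h x \<partial>\<kappa>)"
  shows "\<kappa>' = \<kappa>"
proof -
  interpret real_distribution \<kappa> by (rule \<kappa>)
  have sp: "space \<kappa>' = UNIV" using sets_eq_imp_space_eq[OF s] by simp
  have one: "has_bochner_integral \<kappa>' (\<lambda>_. 1 :: complex) 1"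
    using h[of "\<lambda>_. 1"] prob_space by simp
  then have "integrable \<kappa>' (\<lambda>_. 1 :: complex)" by (simp add: has_bochner_integral_iff)
  then have "emeasure \<kappa>' (space \<kappa>') < \<infinity>"
    by (simp add: integrable_iff_bounded)
  then interpret F: finite_measure \<kappa>' by (intro finite_measureI) auto
  have "complex_of_real (measure \<kappa>' (space \<kappa>')) = 1"
    using has_bochner_integral_integral_eq[OF one] by (simp add: scaleR_conv_of_real)
  then have "measure \<kappa>' (space \<kappa>') = 1" by (simp only: of_real_eq_1_iff)
  then have "prob_space \<kappa>'" by (intro prob_spaceI) (simp add: F.emeasure_eq_measure)
  then have \<kappa>': "real_distribution \<kappa>'"
    using s by (simp add: real_distribution_def real_distribution_axioms_def)
  have "char \<kappa>' t = char \<kappa> t" for t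
    unfolding char_def
    by (rule has_bochner_integral_integral_eq[OF h]) (auto intro!: continuous_intros)
  then show ?thesis using Levy_uniqueness[OF \<kappa>' \<kappa>] by (simp add: fun_eq_iff)
qed

section \<open>Almost-sure spectrum and density of states\<close>

context shift_potential
begin

lemma jacobi_eq:
  assumes "\<omega> \<in> Omega m"
  shows "jacobi (Omega m) left_shift q (\<lambda>\<omega>\<in>Omega m. c) \<omega> = const_jacobi (pot \<omega>) c"
proof -
  have "int_iterate (Omega m) left_shift n \<omega> = (\<lambda>k. \<omega> (k + n))" for n
    using assms int_iterate_shift unfolding Omega_def by blast
  then show ?thesis using assms by (simp add: jacobi_def pot_def[abs_def])
qed

abbreviation hopping :: "real \<Rightarrow> (int \<Rightarrow> real) \<Rightarrow> real" where
  "hopping c \<equiv> (\<lambda>\<omega>\<in>Omega m. c)"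

text \<open>The translates of a dense orbit approximate every other point on every window, so its
  spectrum is the largest one.\<close>

lemma spectrum_transitive:
  assumes \<omega>: "\<omega> \<in> Omega m" "transitive \<omega>" and \<omega>': "\<omega>' \<in> Omega m"
  shows "spectrum (const_jacobi (pot \<omega>') c) \<subseteq> spectrum (const_jacobi (pot \<omega>) c)"
proof (rule spectrum_subset_of_approx)
  show "\<bar>pot \<omega> n\<bar> \<le> R" "\<bar>pot \<omega>' n\<bar> \<le> R" for n
    using \<omega> \<omega>' by (auto simp: pot_def bound)
  fix e :: real and N :: int assume "e > 0"
  then obtain W where W: "\<And>\<xi> \<xi>'. \<xi> \<in> Omega m \<Longrightarrow> \<xi>' \<in> Omega m \<Longrightarrow> \<forall>i\<in>window W. \<xi> i = \<xi>' i \<Longrightarrow> \<bar>q \<xi> - q \<xi>'\<bar> < e"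
    using uniform_window_cfun[OF cont] by metis
  \<comment> \<open>The potential at a site \<open>n\<close> looks up to \<open>W\<close>
    coordinates beyond \<open>n\<close>, hence the larger window.\<close>
  obtain s where s: "\<And>k. k \<in> window (N + W) \<Longrightarrow> \<omega> (k + s) = \<omega>' k"
    using \<omega>(2) \<omega>' unfolding transitive_def by blast
  have "\<bar>pot \<omega> (n + s) - pot \<omega>' n\<bar> < e" if "\<bar>n\<bar> \<le> N" for n
    unfolding pot_def
  proof (rule W)
    show "\<forall>i\<in>window W. \<omega> (i + (n + s)) = \<omega>' (i + n)"
    proof
      fix i assume "i \<in> window W"
      then have "i + n \<in> window (N + W)"
        using that unfolding window_def atLeastAtMost_iff by linarith
      then show "\<omega> (i + (n + s)) = \<omega>' (i + n)"
        using s[of "i + n"] unfolding add.assoc by blast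
    qed
  qed (use \<omega> \<omega>' in auto)
  then show "\<exists>s. \<forall>n. \<bar>n\<bar> \<le> N \<longrightarrow> \<bar>pot \<omega> (n + s) - pot \<omega>' n\<bar> < e" by blast
qed

lemma transitive_exists: "\<exists>\<omega>\<in>Omega m. transitive \<omega>"
proof -
  interpret prob_space "mu m" by (rule prob_space_mu)
  show ?thesis
  proof (rule ccontr)
    assume *: "\<not> ?thesis"
    have "AE \<omega> in mu m. False"
      using AE_transitive AE_space by eventually_elim (use * in \<open>simp add: space_mu\<close>)
    then show False by simp
  qed
qed

text \<open>Any two transitive points have equal spectra by mutual inclusion, and almost every point
  is transitive. A second candidate agrees with the first at some common point, since a probability
  measure has no null full space.\<close>

lemma as_spectrum:
  defines "S \<equiv> \<lambda>c. as_spectrum (Omega m) left_shift (mu m) q (hopping c)"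
  shows "compact (S c)" "S c \<noteq> {}"
    and "\<And>\<omega>. \<omega> \<in> Omega m \<Longrightarrow> transitive \<omega> \<Longrightarrow> spectrum (const_jacobi (pot \<omega>) c) = complex_of_real ` S c"
proof -
  interpret prob_space "mu m" by (rule prob_space_mu)
  obtain \<omega>0 where \<omega>0: "\<omega>0 \<in> Omega m" "transitive \<omega>0" using transitive_exists by blast
  interpret bounded_potential "pot \<omega>0" R by (rule bounded_pot[OF \<omega>0(1)])
  define S0 where "S0 = {x. complex_of_real x \<in> spectrum (const_jacobi (pot \<omega>0) c)}"
  have S0: "spectrum (const_jacobi (pot \<omega>) c) = complex_of_real ` S0" if "\<omega> \<in> Omega m" "transitive \<omega>" for \<omega>
    using spectrum_transitive[OF \<omega>0 that(1), of c] spectrum_transitive[OF that \<omega>0(1), of c]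
      spectrum_of_real_image[OF self_adjoint_const_jacobi[of c]] unfolding S0_def by blast
  have "S0 \<subseteq> {- (R + 2 * \<bar>c\<bar>)..R + 2 * \<bar>c\<bar>}"
    using spectrum_const_jacobi_bounded[of _ c] by (fastforce simp: S0_def abs_le_iff)
  then have compact: "compact S0"
    using self_adjoint_spectrum_closed[OF self_adjoint_const_jacobi[of c]]
    unfolding compact_eq_bounded_closed S0_def by (auto intro: bounded_subset[OF bounded_closed_interval])
  have "S c = S0"
    unfolding S_def as_spectrum_def
  proof (rule the_equality)
    have "AE \<omega> in mu m. spectrum (jacobi (Omega m) left_shift q (hopping c) \<omega>) = complex_of_real ` S0"
      using AE_transitive AE_space
    proof eventually_elim
      case (elim \<omega>)
      then show ?case using S0[of \<omega>] jacobi_eq[of \<omega> c] by (simp add: space_mu)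
    qed
    then show "compact S0 \<and> (AE \<omega> in mu m. spectrum (jacobi (Omega m) left_shift q (hopping c) \<omega>) = complex_of_real ` S0)"
      using compact by simp
    fix S' assume "compact S' \<and> (AE \<omega> in mu m. spectrum (jacobi (Omega m) left_shift q (hopping c) \<omega>) = complex_of_real ` S')"
    then have "AE \<omega> in mu m. spectrum (jacobi (Omega m) left_shift q (hopping c) \<omega>) = complex_of_real ` S'"
      by simp
    then have "AE \<omega> in mu m. complex_of_real ` S' = complex_of_real ` S0"
      using AE_transitive AE_space
    proof eventually_elim
      case (elim \<omega>)
      then show ?case using S0[of \<omega>] jacobi_eq[of \<omega> c] by (simp add: space_mu)
    qed
    then show "S' = S0" by (simp add: inj_image_eq_iff inj_of_real)
  qed
  then show "compact (S c)" "S c \<noteq> {}"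
    and "\<And>\<omega>. \<omega> \<in> Omega m \<Longrightarrow> transitive \<omega> \<Longrightarrow> spectrum (const_jacobi (pot \<omega>) c) = complex_of_real ` S c"
    using compact S0 self_adjoint_spectrum_nonempty[OF self_adjoint_const_jacobi[of c]]
    by (auto simp: S0_def)
qed

text \<open>The norm bound for the Jacobi matrix, increased by 1 so that it stays positive for the
  zero operator, as \<open>moment_functional\<close> requires.\<close>

definition Rc :: "real \<Rightarrow> real" where "Rc c = R + 2 * \<bar>c\<bar> + 1"

lemma R_nonneg: "0 \<le> R"
  using Omega_nonempty bound by (metis abs_ge_zero all_not_in_conv order_trans)

lemma Rc_pos: "0 < Rc c"
  using R_nonneg by (simp add: Rc_def)

lemma spectrum_Rc:
  assumes "\<omega> \<in> Omega m" "complex_of_real x \<in> spectrum (const_jacobi (pot \<omega>) c)"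
  shows "\<bar>x\<bar> \<le> Rc c"
proof -
  interpret bounded_potential "pot \<omega>" R by (rule bounded_pot[OF assms(1)])
  show ?thesis using spectrum_const_jacobi_bounded[OF assms(2)] by (simp add: Rc_def)
qed

lemma moment_functional: "moment_functional (moment c) (Rc c)"
proof
  interpret prob_space "mu m" by (rule prob_space_mu)
  show "moment c 0 = 1" by (simp add: moment_def prob_space)
  fix f :: "real poly" and K assume "\<And>x. \<bar>x\<bar> \<le> Rc c \<Longrightarrow> \<bar>poly f x\<bar> \<le> K"
  then have "\<bar>state c f\<bar> \<le> K" by (intro state_bound) (auto simp: Rc_def)
  then show "\<bar>\<Sum>k\<le>degree f. coeff f k * moment c k\<bar> \<le> K" by (simp add: state_def)
qed (rule Rc_pos)

lemma integral_matrix_element: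
  "has_bochner_integral (mu m) (\<lambda>\<omega>. entry (poly_op f (const_jacobi (pot \<omega>) c) (delta 0)) 0)
    (\<Sum>k\<le>degree f. coeff f k * complex_of_real (moment c k))"
proof -
  have "has_bochner_integral (mu m) (\<lambda>\<omega>. \<Sum>k\<le>degree f. coeff f k * complex_of_real (poly (ker (pot \<omega>) k 0 0) c))
      (\<Sum>k\<le>degree f. coeff f k * complex_of_real (moment c k))"
    unfolding moment_def
    by (intro has_bochner_integral_sum has_bochner_integral_mult_right has_bochner_integral_of_real
        has_bochner_integral_integrable bdd_integrable bdd_poly_ker)
  then show ?thesis
    by (rule has_bochner_integral_cong[THEN iffD1, rotated -1]) (auto simp: space_mu entry_poly_op)
qed

lemma calc_close:
  assumes \<omega>: "\<omega> \<in> Omega m" and h: "continuous_on UNIV h"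
    and e: "\<And>x. complex_of_real x \<in> spectrum (const_jacobi (pot \<omega>) c) \<Longrightarrow> cmod (poly f (complex_of_real x) - h x) \<le> e"
  shows "cmod (entry (poly_op f (const_jacobi (pot \<omega>) c) (delta 0)) 0
      - cinner (delta 0) (cont_calc h (const_jacobi (pot \<omega>) c) (delta 0))) \<le> e"
proof -
  interpret bounded_potential "pot \<omega>" R by (rule bounded_pot[OF \<omega>])
  have "norm (poly_op f (const_jacobi (pot \<omega>) c) (delta 0) - cont_calc h (const_jacobi (pot \<omega>) c) (delta 0)) \<le> e * norm (delta 0)"
    by (rule cont_calc(2)[OF self_adjoint_const_jacobi h]) (rule e)
  then show ?thesis
    using cmod_entry_le[of "poly_op f (const_jacobi (pot \<omega>) c) (delta 0) - cont_calc h (const_jacobi (pot \<omega>) c) (delta 0)" 0]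
    by (simp add: cinner_delta_left)
qed

text \<open>All spectra lie in one compact interval, so a single sequence of polynomials serves
  every \<open>\<omega>\<close>, and the matrix element is a pointwise limit of measurable
  ones.\<close>

lemma calc_measurable:
  assumes h: "continuous_on UNIV h"
  shows "(\<lambda>\<omega>. cinner (delta 0) (cont_calc h (const_jacobi (pot \<omega>) c) (delta 0))) \<in> borel_measurable (mu m)"
proof -
  obtain f where f: "uniform_limit {- Rc c..Rc c} (\<lambda>n x. poly (f n) (complex_of_real x)) h sequentially"
    using complex_poly_sequence[OF compact_Icc continuous_on_subset[OF h subset_UNIV]] by blast
  show ?thesis
  proof (rule borel_measurable_LIMSEQ_metric)
    show "(\<lambda>\<omega>. entry (poly_op (f n) (const_jacobi (pot \<omega>) c) (delta 0)) 0) \<in> borel_measurable (mu m)" for n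
      by (rule borel_measurable_has_bochner_integral[OF integral_matrix_element])
    fix \<omega> assume "\<omega> \<in> space (mu m)"
    then have \<omega>: "\<omega> \<in> Omega m" by (simp add: space_mu)
    show "(\<lambda>n. entry (poly_op (f n) (const_jacobi (pot \<omega>) c) (delta 0)) 0)
        \<longlonglongrightarrow> cinner (delta 0) (cont_calc h (const_jacobi (pot \<omega>) c) (delta 0))"
    proof (rule tendstoI)
      fix e :: real assume "e > 0"
      then have "\<forall>\<^sub>F n in sequentially. \<forall>x\<in>{- Rc c..Rc c}. dist (poly (f n) (complex_of_real x)) (h x) < e / 2"
        using uniform_limitD[OF f, of "e / 2"] by simp
      then show "\<forall>\<^sub>F n in sequentially. dist (entry (poly_op (f n) (const_jacobi (pot \<omega>) c) (delta 0)) 0)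
          (cinner (delta 0) (cont_calc h (const_jacobi (pot \<omega>) c) (delta 0))) < e"
      proof eventually_elim
        case (elim n)
        have "cmod (poly (f n) (complex_of_real x) - h x) \<le> e / 2"
          if "complex_of_real x \<in> spectrum (const_jacobi (pot \<omega>) c)" for x
          using elim spectrum_Rc[OF \<omega> that] by (auto simp: dist_norm abs_le_iff less_imp_le)
        then have "cmod (entry (poly_op (f n) (const_jacobi (pot \<omega>) c) (delta 0)) 0
            - cinner (delta 0) (cont_calc h (const_jacobi (pot \<omega>) c) (delta 0))) \<le> e / 2"
          by (rule calc_close[OF \<omega> h])
        with \<open>e > 0\<close> show ?case by (simp add: dist_norm)
      qed
    qed
  qed
qed

section \<open>Existence, uniqueness and support of the density of states measure\<close>

definition dos_integral :: "real \<Rightarrow> (real \<Rightarrow> complex) \<Rightarrow> complex" where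
  "dos_integral c h = (\<integral>\<omega>. cinner (delta 0) (cont_calc h (jacobi (Omega m) left_shift q (hopping c) \<omega>) (delta 0)) \<partial>mu m)"

lemma dos_integral_eq:
  "dos_integral c h = (\<integral>\<omega>. cinner (delta 0) (cont_calc h (const_jacobi (pot \<omega>) c) (delta 0)) \<partial>mu m)"
  unfolding dos_integral_def
  by (rule Bochner_Integration.integral_cong) (auto simp: space_mu jacobi_eq)

lemma dos_integral_close:
  assumes h: "continuous_on UNIV h"
    and e: "\<And>x. \<bar>x\<bar> \<le> Rc c \<Longrightarrow> cmod (poly f (complex_of_real x) - h x) \<le> e"
  shows "cmod ((\<Sum>k\<le>degree f. coeff f k * complex_of_real (moment c k)) - dos_integral c h) \<le> e"
proof -
  interpret prob_space "mu m" by (rule prob_space_mu)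
  let ?A = "\<lambda>\<omega>. entry (poly_op f (const_jacobi (pot \<omega>) c) (delta 0)) 0"
  let ?B = "\<lambda>\<omega>. cinner (delta 0) (cont_calc h (const_jacobi (pot \<omega>) c) (delta 0))"
  have close: "cmod (?A \<omega> - ?B \<omega>) \<le> e" if "\<omega> \<in> Omega m" for \<omega>
    by (rule calc_close[OF that h]) (use e spectrum_Rc[OF that] in blast)
  have A: "integrable (mu m) ?A" "integral\<^sup>L (mu m) ?A = (\<Sum>k\<le>degree f. coeff f k * complex_of_real (moment c k))"
    using integral_matrix_element has_bochner_integral_iff by blast+
  have AB: "integrable (mu m) (\<lambda>\<omega>. ?A \<omega> - ?B \<omega>)"
    by (rule integrable_const_bound[where B = e])
      (use close calc_measurable[OF h] A(1) in \<open>auto simp: space_mu intro!: AE_I2\<close>)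
  then have "integrable (mu m) (\<lambda>\<omega>. ?A \<omega> - (?A \<omega> - ?B \<omega>))"
    using A(1) by (rule Bochner_Integration.integrable_diff[rotated])
  then have B: "integrable (mu m) ?B" by simp
  have "(\<Sum>k\<le>degree f. coeff f k * complex_of_real (moment c k)) - dos_integral c h = (\<integral>\<omega>. ?A \<omega> - ?B \<omega> \<partial>mu m)"
    unfolding dos_integral_eq A(2)[symmetric] using A(1) B by simp
  also have "cmod \<dots> \<le> (\<integral>\<omega>. cmod (?A \<omega> - ?B \<omega>) \<partial>mu m)" by (rule integral_norm_bound)
  also have "\<dots> \<le> (\<integral>\<omega>. e \<partial>mu m)"
    using AB close by (intro integral_mono) (auto simp: space_mu)
  finally show ?thesis by (simp add: prob_space)
qed

text \<open>The measure built from the moments satisfies the defining identity for polynomials and,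
  by approximation on the interval given by \<open>Rc c\<close>, for continuous functions. The third
  claim keeps the link to \<open>state\<close>, on which the gap labels are computed.\<close>

lemma dos_measure:
  defines "\<kappa> \<equiv> \<lambda>c. dos_measure (Omega m) left_shift (mu m) q (hopping c)"
  shows "real_distribution (\<kappa> c)" and "AE x in \<kappa> c. \<bar>x\<bar> \<le> Rc c"
    and "\<And>h f e. continuous_on UNIV h \<Longrightarrow> (\<And>x. \<bar>x\<bar> \<le> Rc c \<Longrightarrow> \<bar>h x - poly f x\<bar> \<le> e) \<Longrightarrow>
      \<bar>(\<integral>x. h x \<partial>\<kappa> c) - state c f\<bar> \<le> e"
    and "\<And>h. continuous_on UNIV h \<Longrightarrow> has_bochner_integral (\<kappa> c) h (dos_integral c h)"
proof -
  interpret L: moment_functional "moment c" "Rc c" "state c"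
    unfolding state_def[abs_def] by (rule moment_functional)
  obtain \<kappa>0 where \<kappa>0: "real_distribution \<kappa>0" "AE x in \<kappa>0. \<bar>x\<bar> \<le> Rc c"
    and approx: "\<And>h f e. continuous_on UNIV h \<Longrightarrow> (\<And>x. \<bar>x\<bar> \<le> Rc c \<Longrightarrow> \<bar>h x - poly f x\<bar> \<le> e) \<Longrightarrow>
      \<bar>(\<integral>x. h x \<partial>\<kappa>0) - state c f\<bar> \<le> e"
    using L.moment_measure_exists by blast
  interpret K: real_distribution \<kappa>0 by fact
  have integrable: "integrable \<kappa>0 h" if "continuous_on UNIV h" for h :: "real \<Rightarrow> complex"
  proof -
    have "compact (h ` {- Rc c..Rc c})"
      using that by (intro compact_continuous_image continuous_on_subset[OF that] compact_Icc) auto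
    then obtain B where "\<And>x. x \<in> {- Rc c..Rc c} \<Longrightarrow> norm (h x) \<le> B"
      using compact_imp_bounded bounded_iff by (metis (mono_tags, lifting) image_eqI)
    then have "AE x in \<kappa>0. norm (h x) \<le> B"
      using \<kappa>0(2) by (auto simp: abs_le_iff elim: eventually_mono)
    then show ?thesis
      by (intro K.integrable_const_bound) (auto simp: borel_measurable_continuous_onI that)
  qed
  have moment: "(\<integral>x. x ^ k \<partial>\<kappa>0) = moment c k" for k
  proof -
    \<comment> \<open>A monomial approximates itself with error 0, so the moments come out
      exactly.\<close>
    have "\<bar>(\<integral>x. x ^ k \<partial>\<kappa>0) - state c (monom 1 k)\<bar> \<le> 0"
      by (rule approx) (auto intro!: continuous_intros simp: poly_monom)
    then show ?thesis
      by (simp add: state_def degree_monom_eq if_distrib[of "\<lambda>x. x * _"] cong: if_cong)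
  qed
  have poly_int: "(\<integral>x. poly f (complex_of_real x) \<partial>\<kappa>0) = (\<Sum>k\<le>degree f. coeff f k * complex_of_real (moment c k))" for f
  proof -
    have "(\<integral>x. poly f (complex_of_real x) \<partial>\<kappa>0) = (\<Sum>k\<le>degree f. (\<integral>x. coeff f k * complex_of_real (x ^ k) \<partial>\<kappa>0))"
      unfolding poly_altdef of_real_power
      by (rule Bochner_Integration.integral_sum) (auto intro!: integrable continuous_intros)
    also have "\<dots> = (\<Sum>k\<le>degree f. coeff f k * complex_of_real (moment c k))"
      by (simp only: integral_mult_right_zero integral_complex_of_real moment)
    finally show ?thesis .
  qed
  have \<kappa>0_int: "has_bochner_integral \<kappa>0 h (dos_integral c h)" if h: "continuous_on UNIV h" for h
  proof -
    have "cmod ((\<integral>x. h x \<partial>\<kappa>0) - dos_integral c h) \<le> 0 + e" if e: "e > 0" for e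
    proof -
      obtain f where f: "\<And>x. x \<in> {- Rc c..Rc c} \<Longrightarrow> cmod (poly f (complex_of_real x) - h x) < e / 2"
        using complex_poly_approx[OF compact_Icc continuous_on_subset[OF h subset_UNIV] half_gt_zero[OF e]] by blast
      let ?P = "\<Sum>k\<le>degree f. coeff f k * complex_of_real (moment c k)"
      have f': "cmod (poly f (complex_of_real x) - h x) \<le> e / 2" if "\<bar>x\<bar> \<le> Rc c" for x
        using f[of x] that by (auto simp: abs_le_iff)
      have pi: "integrable \<kappa>0 (\<lambda>x. poly f (complex_of_real x))"
        by (intro integrable continuous_intros)
      have "cmod (?P - (\<integral>x. h x \<partial>\<kappa>0)) = cmod (\<integral>x. poly f (complex_of_real x) - h x \<partial>\<kappa>0)"
        using pi integrable[OF h] by (simp add: poly_int)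
      also have "\<dots> \<le> (\<integral>x. cmod (poly f (complex_of_real x) - h x) \<partial>\<kappa>0)" by (rule integral_norm_bound)
      also have "\<dots> \<le> (\<integral>x. e / 2 \<partial>\<kappa>0)"
      proof (rule integral_mono_AE)
        show "AE x in \<kappa>0. cmod (poly f (complex_of_real x) - h x) \<le> e / 2"
          using \<kappa>0(2) by eventually_elim (rule f')
      qed (use pi integrable[OF h] in auto)
      also have "\<dots> = e / 2" using K.prob_space by simp
      finally have "cmod (?P - (\<integral>x. h x \<partial>\<kappa>0)) \<le> e / 2" .
      moreover have "cmod (?P - dos_integral c h) \<le> e / 2"
        by (rule dos_integral_close[OF h f'])
      ultimately show ?thesis
        using norm_triangle_ineq4[of "?P - dos_integral c h" "?P - (\<integral>x. h x \<partial>\<kappa>0)"] by simp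
    qed
    then have "cmod ((\<integral>x. h x \<partial>\<kappa>0) - dos_integral c h) \<le> 0" by (rule field_le_epsilon)
    then show ?thesis using integrable[OF h] by (simp add: has_bochner_integral_iff)
  qed
  have "\<kappa> c = \<kappa>0"
    unfolding \<kappa>_def dos_measure_def dos_integral_def[symmetric]
  proof (rule the_equality)
    fix \<kappa>' assume "sets \<kappa>' = sets borel \<and> (\<forall>h. continuous_on UNIV h \<longrightarrow> has_bochner_integral \<kappa>' h (dos_integral c h))"
    then show "\<kappa>' = \<kappa>0"
      using \<kappa>0_int by (intro finite_measure_eqI_continuous[OF \<kappa>0(1)]) (auto simp: has_bochner_integral_iff)
  qed (use \<kappa>0_int in auto)
  then show "real_distribution (\<kappa> c)" and "AE x in \<kappa> c. \<bar>x\<bar> \<le> Rc c"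
    and "\<And>h f e. continuous_on UNIV h \<Longrightarrow> (\<And>x. \<bar>x\<bar> \<le> Rc c \<Longrightarrow> \<bar>h x - poly f x\<bar> \<le> e) \<Longrightarrow>
      \<bar>(\<integral>x. h x \<partial>\<kappa> c) - state c f\<bar> \<le> e"
    and "\<And>h. continuous_on UNIV h \<Longrightarrow> has_bochner_integral (\<kappa> c) h (dos_integral c h)"
    using \<kappa>0 approx \<kappa>0_int by auto
qed

text \<open>Test with the distance to the spectrum: on almost every spectrum it coincides with the
  zero polynomial, so its functional calculus vanishes, and a nonnegative function with integral 0
  is 0 almost everywhere.\<close>

lemma dos_supported:
  "AE x in dos_measure (Omega m) left_shift (mu m) q (hopping c). x \<in> as_spectrum (Omega m) left_shift (mu m) q (hopping c)"
proof -
  let ?S = "as_spectrum (Omega m) left_shift (mu m) q (hopping c)"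
  let ?\<kappa> = "dos_measure (Omega m) left_shift (mu m) q (hopping c)"
  define h where "h x = complex_of_real (infdist x ?S)" for x
  have h: "continuous_on UNIV h" unfolding h_def by (intro continuous_intros)
  have "dos_integral c h = (\<integral>\<omega>. 0 \<partial>mu m)"
    unfolding dos_integral_eq
  proof (rule integral_cong_AE)
    show "AE \<omega> in mu m. cinner (delta 0) (cont_calc h (const_jacobi (pot \<omega>) c) (delta 0)) = 0"
      using AE_transitive AE_space
    proof eventually_elim
      case (elim \<omega>)
      then have \<omega>: "\<omega> \<in> Omega m" by (simp add: space_mu)
      have "cmod (entry (poly_op 0 (const_jacobi (pot \<omega>) c) (delta 0)) 0
          - cinner (delta 0) (cont_calc h (const_jacobi (pot \<omega>) c) (delta 0))) \<le> 0"
      proof (rule calc_close[OF \<omega> h])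
        fix x assume "complex_of_real x \<in> spectrum (const_jacobi (pot \<omega>) c)"
        then have "x \<in> ?S" using as_spectrum(3)[OF \<omega> elim(1)] by auto
        then show "cmod (poly 0 (complex_of_real x) - h x) \<le> 0" by (simp add: h_def)
      qed
      then show ?case by simp
    qed
  qed (use calc_measurable[OF h] in auto)
  then have "has_bochner_integral ?\<kappa> h 0" using dos_measure(4)[OF h, of c] by simp
  then have "integrable ?\<kappa> (\<lambda>x. Re (h x))" "(\<integral>x. Re (h x) \<partial>?\<kappa>) = Re 0"
    by (auto simp: has_bochner_integral_iff)
  then have "AE x in ?\<kappa>. Re (h x) = 0"
    using integral_nonneg_eq_0_iff_AE[of ?\<kappa> "\<lambda>x. Re (h x)"] by (auto simp: h_def infdist_nonneg)
  then have "AE x in ?\<kappa>. infdist x ?S = 0" by (simp add: h_def)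
  then show ?thesis
    using as_spectrum(1,2)[of c] by (auto simp: in_closed_iff_infdist_zero compact_imp_closed elim: eventually_mono)
qed

end

section \<open>Gap labels under a small hopping term\<close>

lemma poly_antiderivative:
  fixes g :: "real poly"
  obtains f where "pderiv f = g" "poly f a = b"
proof -
  define f where "f = (\<Sum>i\<le>degree g. monom (coeff g i / real (Suc i)) (Suc i))"
  have "pderiv (monom (coeff g i / real (Suc i)) (Suc i)) = monom (coeff g i) i" for i
    by (simp add: pderiv_monom del: of_nat_Suc)
  then have "pderiv f = g"
    by (simp add: f_def higher_pderiv_sum[of 1, simplified] poly_as_sum_of_monoms)
  then have "pderiv (f + [:b - poly f a:]) = g" "poly (f + [:b - poly f a:]) a = b"
    by (simp_all add: pderiv_add pderiv_pCons)
  then show ?thesis using that by blast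
qed

text \<open>Approximate the derivative and integrate; the error picks up at most the factor
  \<open>B\<close>.\<close>

lemma C1_poly_approx:
  fixes h h' :: "real \<Rightarrow> real"
  assumes der: "\<And>x. (h has_real_derivative h' x) (at x)" and h': "continuous_on UNIV h'"
    and B: "B > 0" and e: "e > 0"
  obtains f where "\<And>x. \<bar>x\<bar> \<le> B \<Longrightarrow> \<bar>poly (pderiv f) x - h' x\<bar> \<le> e"
    "\<And>x. \<bar>x\<bar> \<le> B \<Longrightarrow> \<bar>h x - poly f x\<bar> \<le> e * B"
proof -
  obtain g where g: "\<And>x. x \<in> {-B..B} \<Longrightarrow> \<bar>poly g x - h' x\<bar> < e"
    using real_poly_approx[OF compact_Icc continuous_on_subset[OF h' subset_UNIV] e] by blast
  obtain f where f: "pderiv f = g" "poly f 0 = h 0" by (rule poly_antiderivative)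
  have "\<bar>h x - poly f x\<bar> \<le> e * B" if x: "\<bar>x\<bar> \<le> B" for x
  proof -
    have "norm ((poly f x - h x) - (poly f 0 - h 0)) \<le> e * norm (x - 0)"
    proof (rule field_differentiable_bound[where S = "{-B..B}" and f' = "\<lambda>x. poly g x - h' x"])
      show "((\<lambda>x. poly f x - h x) has_field_derivative poly g z - h' z) (at z within {-B..B})" for z
        using DERIV_diff[OF poly_DERIV[of f z] der[of z]] f(1)
        by (simp add: has_field_derivative_at_within)
      show "norm (poly g z - h' z) \<le> e" if "z \<in> {-B..B}" for z using g[OF that] by simp
    qed (use x B in auto)
    also have "\<dots> \<le> e * B" using x e by (intro mult_left_mono) auto
    finally show ?thesis using f(2) by (simp add: abs_minus_commute)
  qed
  moreover have "\<bar>poly (pderiv f) x - h' x\<bar> \<le> e" if "\<bar>x\<bar> \<le> B" for x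
  proof -
    have "x \<in> {-B..B}" using that by auto
    then show ?thesis using g[of x] f(1) by simp
  qed
  ultimately show ?thesis using that[of f] by blast
qed

lemma DERIV_pos_part_square: "((\<lambda>x::real. (max 0 x)\<^sup>2) has_real_derivative 2 * max 0 x) (at x)"
proof -
  consider "x > 0" | "x < 0" | "x = 0" by linarith
  then show ?thesis
  proof cases
    case 1
    have "((\<lambda>x. x\<^sup>2) has_real_derivative 2 * max 0 x) (at x)"
      using 1 by (auto intro!: derivative_eq_intros)
    then show ?thesis
      by (rule has_field_derivative_transform_within_open[of _ _ _ "{0<..}"]) (use 1 in auto)
  next
    case 2
    have "((\<lambda>x. 0) has_real_derivative 2 * max 0 x) (at x)"
      using 2 by (auto intro!: derivative_eq_intros)
    then show ?thesis
      by (rule has_field_derivative_transform_within_open[of _ _ _ "{..<0}"]) (use 2 in auto)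
  next
    case 3
    have "((\<lambda>h::real. (max 0 h)\<^sup>2 / h) \<longlongrightarrow> 0) (at 0)"
    proof (rule Lim_null_comparison)
      show "\<forall>\<^sub>F h in at 0. norm ((max 0 h)\<^sup>2 / h) \<le> \<bar>h :: real\<bar>"
        by (auto simp: max_def power2_eq_square intro!: always_eventually)
      show "((\<lambda>h. \<bar>h :: real\<bar>) \<longlongrightarrow> 0) (at 0)"
        using tendsto_rabs[OF tendsto_ident_at, of "0::real" UNIV] by simp
    qed
    then show ?thesis by (simp add: 3 DERIV_def)
  qed
qed

text \<open>A quadratic spline. In the coordinate \<open>s\<close>, which runs from 0 to 1 between
  \<open>u\<close> and \<open>v\<close>, the combination
  \<open>s\<^sup>2 - 2 (s - 1/2)\<^sup>2 + (s - 1)\<^sup>2\<close> is constantly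
  \<open>1 / 2\<close>, so \<open>h\<close> is \<open>1 - 1 = 0\<close> beyond \<open>v\<close>;
  before \<open>u\<close> all positive parts vanish.\<close>

lemma smooth_cutoff:
  fixes u v :: real
  assumes "u < v"
  obtains h h' where "\<And>x. (h has_real_derivative h' x) (at x)" "continuous_on UNIV h'"
    "\<And>x. x \<le> u \<Longrightarrow> h x = 1 \<and> h' x = 0" "\<And>x. x \<ge> v \<Longrightarrow> h x = 0 \<and> h' x = 0"
proof -
  define s where "s x = (x - u) / (v - u)" for x
  define P where "P a x = (max 0 (s x - a))\<^sup>2" for a x
  define D where "D a x = 2 * max 0 (s x - a) * (1 / (v - u))" for a x
  define h where "h x = 1 - 2 * (P 0 x - 2 * P (1 / 2) x + P 1 x)" for x
  define h' where "h' x = - (2 * (D 0 x - 2 * D (1 / 2) x + D 1 x))" for x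
  have s: "((\<lambda>x. s x - a) has_real_derivative 1 / (v - u)) (at x)" for x a
    unfolding s_def using assms by (auto intro!: derivative_eq_intros)
  have P: "(P a has_real_derivative D a x) (at x)" for x a
    unfolding P_def D_def by (rule DERIV_chain2[OF DERIV_pos_part_square s])
  show ?thesis
  proof (rule that)
    show "(h has_real_derivative h' x) (at x)" for x
    proof -
      have "((\<lambda>x. 1 - 2 * (P 0 x - 2 * P (1 / 2) x + P 1 x)) has_real_derivative
          0 - 2 * (D 0 x - 2 * D (1 / 2) x + D 1 x)) (at x)"
        by (intro DERIV_diff DERIV_const DERIV_cmult DERIV_add P)
      then show ?thesis unfolding h_def[abs_def] h'_def by (simp only: diff_0)
    qed
    show "continuous_on UNIV h'"
      unfolding h'_def D_def s_def using assms by (intro continuous_intros) auto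
    show "h x = 1 \<and> h' x = 0" if "x \<le> u" for x
    proof -
      have "s x \<le> 0" using that assms by (simp add: s_def divide_nonpos_pos)
      then show ?thesis by (simp add: h_def h'_def P_def D_def)
    qed
    show "h x = 0 \<and> h' x = 0" if "x \<ge> v" for x
    proof -
      have "s x \<ge> 1" using that assms by (simp add: s_def)
      then show ?thesis by (simp add: h_def h'_def P_def D_def max_absorb2 power2_eq_square algebra_simps)
    qed
  qed
qed

lemma poly_ker_0: "poly (ker b n i j) 0 = (if i = j then b i ^ n else 0)"
  by (induction n arbitrary: i) auto

context shift_potential
begin

lemma state_0: "state 0 f = (\<integral>\<omega>. poly f (q \<omega>) \<partial>mu m)"
  unfolding state_eq_integral poly_ker_0 pot_def by (simp add: poly_altdef)

lemma Rc_mono: "0 \<le> t \<Longrightarrow> t \<le> c \<Longrightarrow> Rc t \<le> Rc c"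
  by (simp add: Rc_def)

theorem gap_label:
  assumes gap: "\<And>\<omega>. \<omega> \<in> Omega m \<Longrightarrow> q \<omega> \<le> x \<or> y \<le> q \<omega>" and c: "0 \<le> c"
    and xy: "x + 2 * c < E" "E < y - 2 * c"
  shows "ids (Omega m) left_shift (mu m) q (hopping c) E = measure (mu m) {\<omega> \<in> Omega m. q \<omega> \<le> x}"
proof -
  interpret prob_space "mu m" by (rule prob_space_mu)
  \<comment> \<open>The interval kept free at hopping \<open>c\<close>. Smaller hopping costs less
    at each end, so it is free along the entire path, see \<open>nospec\<close>.\<close>
  define u v where "u = x + 2 * c" and "v = y - 2 * c"
  define l where "l = measure (mu m) {\<omega> \<in> Omega m. q \<omega> \<le> x}"
  let ?\<kappa> = "dos_measure (Omega m) left_shift (mu m) q (hopping c)"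
  let ?S = "as_spectrum (Omega m) left_shift (mu m) q (hopping c)"
  interpret K: real_distribution ?\<kappa> by (rule dos_measure)
  obtain h h' where h: "\<And>x. (h has_real_derivative h' x) (at x)" "continuous_on UNIV h'"
    and low: "\<And>x. x \<le> u \<Longrightarrow> h x = 1 \<and> h' x = 0" and high: "\<And>x. x \<ge> v \<Longrightarrow> h x = 0 \<and> h' x = 0"
    using smooth_cutoff[of u v] xy unfolding u_def v_def by (metis less_trans)
  have hc: "continuous_on UNIV h" using h(1) by (intro DERIV_continuous_on) (auto intro: has_field_derivative_at_within)
  have nospec: "z \<le> u \<or> v \<le> z" if \<omega>: "\<omega> \<in> Omega m" and t: "0 \<le> t" "t \<le> c"
    and z: "complex_of_real z \<in> spectrum (const_jacobi (pot \<omega>) t)" for \<omega> t z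
  proof (rule ccontr)
    interpret bounded_potential "pot \<omega>" R by (rule bounded_pot[OF \<omega>])
    assume "\<not> (z \<le> u \<or> v \<le> z)"
    then have "complex_of_real z \<notin> spectrum (const_jacobi (pot \<omega>) t)"
      using t \<omega> by (intro spectrum_const_jacobi_gap[of x y]) (auto simp: u_def v_def pot_def gap)
    then show False using z by blast
  qed
  have l: "(\<integral>\<omega>. h (q \<omega>) \<partial>mu m) = l"
  proof -
    have "q \<in> borel_measurable (mu m)" using cont by (rule continuous_borel_measurable_mu)
    then have m: "{\<omega> \<in> Omega m. q \<omega> \<le> x} \<in> sets (mu m)"
      using borel_measurable_le[of q "mu m" "\<lambda>_. x"] by (simp add: space_mu)
    have "(\<integral>\<omega>. h (q \<omega>) \<partial>mu m) = (\<integral>\<omega>. indicator {\<omega> \<in> Omega m. q \<omega> \<le> x} \<omega> \<partial>mu m)"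
    proof (rule Bochner_Integration.integral_cong)
      fix \<omega> assume "\<omega> \<in> space (mu m)"
      then show "h (q \<omega>) = indicator {\<omega> \<in> Omega m. q \<omega> \<le> x} \<omega>"
        using low[of "q \<omega>"] high[of "q \<omega>"] gap[of \<omega>] xy c
        by (auto simp: space_mu indicator_def u_def v_def)
    qed simp
    then show ?thesis using m by (simp add: l_def Int_absorb2 space_mu subset_iff)
  qed
  have "\<bar>(\<integral>z. h z \<partial>?\<kappa>) - l\<bar> \<le> 0 + d" if d: "d > 0" for d
  proof -
    \<comment> \<open>The three errors below add up to this multiple of \<open>e\<close>:
      \<open>e * Rc c\<close> at each end of the path and \<open>2 * e * c\<close> along it.\<close>
    obtain e where e: "e > 0" "e * (2 * Rc c + 2 * c) < d"
      using obtain_scale[of "2 * Rc c + 2 * c" d] d Rc_pos[of c] c by auto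
    obtain f where f': "\<And>z. \<bar>z\<bar> \<le> Rc c \<Longrightarrow> \<bar>poly (pderiv f) z - h' z\<bar> \<le> e"
      and f: "\<And>z. \<bar>z\<bar> \<le> Rc c \<Longrightarrow> \<bar>h z - poly f z\<bar> \<le> e * Rc c"
      using C1_poly_approx[OF h Rc_pos e(1)] by blast
    have 1: "\<bar>(\<integral>z. h z \<partial>?\<kappa>) - state c f\<bar> \<le> e * Rc c"
      by (rule dos_measure(3)[OF hc f])
    have 2: "\<bar>state c f - state 0 f\<bar> \<le> 2 * e * c"
    proof (rule state_derivative_bound[OF _ c])
      fix \<omega> t z assume \<omega>: "\<omega> \<in> Omega m" and t: "0 \<le> t" "t \<le> c"
        and z: "complex_of_real z \<in> spectrum (const_jacobi (pot \<omega>) t)"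
      have "\<bar>z\<bar> \<le> Rc c" using spectrum_Rc[OF \<omega> z] Rc_mono[OF t] by linarith
      moreover have "h' z = 0" using nospec[OF \<omega> t z] low high by blast
      ultimately show "\<bar>poly (pderiv f) z\<bar> \<le> e" using f'[of z] by simp
    qed
    have 3: "\<bar>state 0 f - l\<bar> \<le> e * Rc c"
    proof -
      have bm: "bdd (\<lambda>\<omega>. poly f (q \<omega>))" "bdd (\<lambda>\<omega>. h (q \<omega>))"
      proof -
        have *: "bdd (\<lambda>\<omega>. g (q \<omega>))" if g: "continuous_on UNIV g" for g :: "real \<Rightarrow> real"
        proof -
          have "continuous_on (Omega m) (\<lambda>\<omega>. g (q \<omega>))"
            by (intro continuous_on_compose2[OF g cont]) auto
          moreover from this have "bounded ((\<lambda>\<omega>. g (q \<omega>)) ` Omega m)"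
            using compact_Omega compact_continuous_image compact_imp_bounded by blast
          ultimately show ?thesis
            by (auto simp: bdd_def bounded_iff intro: continuous_borel_measurable_mu)
        qed
        show "bdd (\<lambda>\<omega>. poly f (q \<omega>))" by (rule *) (intro continuous_intros)
        show "bdd (\<lambda>\<omega>. h (q \<omega>))" by (rule *[OF hc])
      qed
      have "state 0 f - l = (\<integral>\<omega>. poly f (q \<omega>) + (- 1) * h (q \<omega>) \<partial>mu m)"
        unfolding state_0 l[symmetric] using bdd_integrable[OF bm(1)] bdd_integrable[OF bm(2)] by simp
      also have "\<bar>\<dots>\<bar> \<le> e * Rc c"
      proof (rule integral_bound)
        fix \<omega> assume "\<omega> \<in> Omega m"
        then have "\<bar>q \<omega>\<bar> \<le> Rc c" using bound[of \<omega>] by (simp add: Rc_def)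
        then show "\<bar>poly f (q \<omega>) + (- 1) * h (q \<omega>)\<bar> \<le> e * Rc c" using f by (simp add: abs_minus_commute)
      qed (intro bdd_add bdd_mult bdd_const bm)
      finally show ?thesis .
    qed
    show ?thesis using 1 2 3 e(2) by (simp add: algebra_simps)
  qed
  then have "\<bar>(\<integral>z. h z \<partial>?\<kappa>) - l\<bar> \<le> 0" by (rule field_le_epsilon)
  \<comment> \<open>The cutoff and the indicator can differ only strictly between \<open>u\<close>
    and \<open>v\<close>, where \<open>E\<close> lies and the measure has no mass.\<close>
  moreover have "(\<integral>z. h z \<partial>?\<kappa>) = (\<integral>z. indicator {..E} z \<partial>?\<kappa>)"
  proof (rule integral_cong_AE)
    show "AE z in ?\<kappa>. h z = indicator {..E} z"
      using dos_supported[of c]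
    proof eventually_elim
      case (elim z)
      obtain \<omega> where \<omega>: "\<omega> \<in> Omega m" "transitive \<omega>" using transitive_exists by blast
      have "complex_of_real z \<in> spectrum (const_jacobi (pot \<omega>) c)"
        using elim as_spectrum(3)[OF \<omega>, of c] by auto
      then have "z \<le> u \<or> v \<le> z" using nospec[OF \<omega>(1) c order_refl] by blast
      then show ?case using low[of z] high[of z] xy by (auto simp: u_def v_def indicator_def)
    qed
  qed (auto simp: hc borel_measurable_continuous_onI)
  ultimately show ?thesis by (simp add: ids_def l_def)
qed

text \<open>The gap is the component of the midpoint \<open>E\<close>. No mass lies between two of
  its points, so the label found at \<open>E\<close> holds throughout. It is bounded because
  \<open>0 < l\<close> forces spectrum below \<open>E\<close> and \<open>l < 1\<close> forces
  spectrum above.\<close>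

theorem open_gap:
  assumes gap: "\<And>\<omega>. \<omega> \<in> Omega m \<Longrightarrow> q \<omega> \<le> x \<or> y \<le> q \<omega>" and c: "0 \<le> c"
    and xy: "x + 2 * c < y - 2 * c"
    and l: "measure (mu m) {\<omega> \<in> Omega m. q \<omega> \<le> x} = l" "0 < l" "l < 1"
  shows "has_open_gap (Omega m) left_shift (mu m) q (hopping c) l"
proof -
  let ?\<kappa> = "dos_measure (Omega m) left_shift (mu m) q (hopping c)"
  let ?S = "as_spectrum (Omega m) left_shift (mu m) q (hopping c)"
  interpret K: real_distribution ?\<kappa> by (rule dos_measure)
  define E where "E = (x + y) / 2"
  have E: "x + 2 * c < E" "E < y - 2 * c" using xy by (auto simp: E_def)
  have ids_E: "measure ?\<kappa> {..E} = l" using gap_label[OF gap c E] by (simp add: ids_def l)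
  obtain \<omega> where \<omega>: "\<omega> \<in> Omega m" "transitive \<omega>" using transitive_exists by blast
  interpret B: bounded_potential "pot \<omega>" R by (rule bounded_pot[OF \<omega>(1)])
  have "complex_of_real E \<notin> spectrum (const_jacobi (pot \<omega>) c)"
    using E c \<omega>(1) by (intro B.spectrum_const_jacobi_gap[of x y]) (auto simp: pot_def gap)
  then have ES: "E \<in> - ?S" using as_spectrum(3)[OF \<omega>, of c] by auto
  let ?I = "connected_component_set (- ?S) E"
  have I: "?I \<in> components (- ?S)" using ES by (auto simp: components_def)
  have seg: "{min E z..max E z} \<inter> ?S = {}" if "z \<in> ?I" for z
  proof -
    have "connected ?I" "E \<in> ?I" "?I \<subseteq> - ?S"
      using ES by (auto simp: connected_component_subset)
    then have "{min E z..max E z} \<subseteq> ?I"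
      using that by (intro connected_contains_Icc) (simp_all add: min_def max_def)
    then show ?thesis using \<open>?I \<subseteq> - ?S\<close> by blast
  qed
  have null: "measure ?\<kappa> {..z} = l" if "z \<in> ?I" for z
  proof -
    have "measure ?\<kappa> {..z} = measure ?\<kappa> {..E}"
    proof (rule K.finite_measure_eq_AE)
      show "AE a in ?\<kappa>. a \<in> {..z} \<longleftrightarrow> a \<in> {..E}"
        using dos_supported[of c]
      proof eventually_elim
        case (elim a)
        then have "a \<notin> {min E z..max E z}" using seg[OF that] by blast
        then show ?case by (auto simp: min_def max_def split: if_splits)
      qed
    qed auto
    then show ?thesis using ids_E by simp
  qed
  have "\<exists>a\<in>?S. a < E"
  proof (rule ccontr)
    assume *: "\<not> (\<exists>a\<in>?S. a < E)"
    have "AE a in ?\<kappa>. a \<notin> {..E}"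
      using dos_supported[of c]
    proof eventually_elim
      case (elim a)
      moreover from this ES have "a \<noteq> E" by auto
      ultimately show ?case using * by force
    qed
    then have "K.prob {..E} = 0" by (simp add: K.prob_eq_0)
    then show False using ids_E l by simp
  qed
  then obtain a where a: "a \<in> ?S" "a < E" by blast
  have "\<exists>b\<in>?S. E < b"
  proof (rule ccontr)
    assume *: "\<not> (\<exists>b\<in>?S. E < b)"
    have "AE a in ?\<kappa>. a \<in> {..E}"
      using dos_supported[of c] by eventually_elim (use * in force)
    then have "K.prob {..E} = 1" by (simp add: K.prob_eq_1)
    then show False using ids_E l by simp
  qed
  then obtain b where b: "b \<in> ?S" "E < b" by blast
  have "?I \<subseteq> {a..b}"
  proof
    fix z assume "z \<in> ?I"
    then have "a \<notin> {min E z..max E z}" "b \<notin> {min E z..max E z}" using seg a b by blast+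
    then show "z \<in> {a..b}" using a b by (auto simp: min_def max_def split: if_splits)
  qed
  then have "bounded ?I" using bounded_subset[OF bounded_closed_interval] by blast
  then show ?thesis unfolding has_open_gap_def using I null by (auto simp: ids_def)
qed

end

section \<open>The Schwartzman group of the full shift\<close>

definition ecirc :: "real \<Rightarrow> complex" where "ecirc s = cis (2 * pi * s)"

lemma norm_ecirc [simp]: "cmod (ecirc s) = 1"
  by (simp add: ecirc_def)

lemma ecirc_add: "ecirc (s + t) = ecirc s * ecirc t"
  by (simp add: ecirc_def cis_mult distrib_left)

lemma ecirc_int [simp]: "ecirc (of_int n) = 1"
  by (simp add: ecirc_def)

lemma ecirc_eq_iff: "ecirc s = ecirc t \<longleftrightarrow> s - t \<in> \<int>"
proof
  assume "ecirc s = ecirc t"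
  then have "sin (2 * pi * s) = sin (2 * pi * t) \<and> cos (2 * pi * s) = cos (2 * pi * t)"
    by (simp add: ecirc_def complex_eq_iff)
  then obtain n :: int where "2 * pi * s = 2 * pi * t + 2 * pi * n" by (auto simp: sin_cos_eq_iff)
  then have "2 * pi * (s - t - n) = 0" by (simp add: algebra_simps)
  then have "s - t = of_int n" by simp
  then show "s - t \<in> \<int>" by simp
next
  assume "s - t \<in> \<int>"
  then obtain n where "s = t + of_int n" by (metis Ints_cases add.commute diff_add_cancel)
  then show "ecirc s = ecirc t" by (simp add: ecirc_add)
qed

text \<open>Chordal distance below 1 makes the relative angle have positive cosine, which means less
  than a quarter turn from the nearest integer.\<close>

lemma ecirc_close:
  assumes "cmod (ecirc s - ecirc t) < 1"
  shows "\<exists>k::int. \<bar>s - t - k\<bar> < 1 / 4"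
proof -
  define k where "k = round (s - t)"
  define d where "d = s - t - k"
  have d: "\<bar>d\<bar> \<le> 1 / 2" using of_int_round_abs_le[of "s - t"] unfolding d_def k_def by linarith
  have "ecirc s = ecirc t * ecirc d"
    using ecirc_add[of "t + of_int k" d] ecirc_add[of t "of_int k"] by (simp add: d_def)
  then have "cmod (ecirc t * (ecirc d - 1)) < 1" using assms by (simp add: algebra_simps)
  then have "cmod (ecirc d - 1) < 1" by (simp add: norm_mult)
  moreover have "\<bar>Re (ecirc d - 1)\<bar> \<le> cmod (ecirc d - 1)" by (rule abs_Re_le_cmod)
  ultimately have c: "cos (2 * pi * d) > 0" by (simp add: ecirc_def abs_less_iff)
  have "\<bar>d\<bar> < 1 / 4"
  proof (rule ccontr)
    assume "\<not> \<bar>d\<bar> < 1 / 4"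
    then have "pi / 2 \<le> \<bar>2 * pi * d\<bar>" "\<bar>2 * pi * d\<bar> \<le> pi" using d by (auto simp: abs_mult)
    then have "cos \<bar>2 * pi * d\<bar> \<le> cos (pi / 2)" by (intro cos_monotone_0_pi_le) auto
    then show False using c by simp
  qed
  then show ?thesis by (auto simp: d_def)
qed

text \<open>The values avoid \<open>1 / 4\<close> in modulus, so by the intermediate value theorem
  the function cannot leave the neighbourhood of 0 in which it starts.\<close>

lemma near_integers_trapped:
  fixes D :: "real \<Rightarrow> real"
  assumes D: "continuous_on {0..1} D" and near: "\<And>t. t \<in> {0..1} \<Longrightarrow> \<exists>k::int. \<bar>D t - k\<bar> < 1 / 4"
    and D0: "\<bar>D 0\<bar> < 1 / 2"
  shows "\<bar>D 1\<bar> < 1 / 4"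
proof -
  have quarter: "\<bar>D t\<bar> \<noteq> 1 / 4" if t01: "t \<in> {0..1}" for t
  proof
    assume t: "\<bar>D t\<bar> = 1 / 4"
    obtain k :: int where k: "\<bar>D t - k\<bar> < 1 / 4" using near[OF t01] by blast
    then have "\<bar>real_of_int k\<bar> < 1" using t by linarith
    then have "k = 0" by linarith
    then show False using k t by simp
  qed
  obtain k :: int where k: "\<bar>D 0 - k\<bar> < 1 / 4" using near[of 0] by auto
  then have "\<bar>real_of_int k\<bar> < 1" using D0 by linarith
  then have "k = 0" by linarith
  then have D0: "\<bar>D 0\<bar> \<le> 1 / 4" using k by simp
  show ?thesis
  proof (rule ccontr)
    assume "\<not> \<bar>D 1\<bar> < 1 / 4"
    then obtain t where "0 \<le> t" "t \<le> 1" "\<bar>D t\<bar> = 1 / 4"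
      using IVT'[of "\<lambda>t. \<bar>D t\<bar>" 0 "1 / 4" 1] D0 D by (auto intro!: continuous_intros)
    then show False using quarter by auto
  qed
qed

text \<open>Two lifts of one circle-valued path: their difference is continuous with integer
  values.\<close>

lemma integer_difference_constant:
  fixes f g :: "real \<Rightarrow> real"
  assumes f: "continuous_on UNIV f" and g: "continuous_on UNIV g" and eq: "\<And>t. ecirc (f t) = ecirc (g t)"
  shows "f s - g s = f t - g t"
proof -
  have Z: "f t - g t \<in> \<int>" for t using eq by (simp add: ecirc_eq_iff)
  have "(\<lambda>t. f t - g t) constant_on UNIV"
  proof (rule continuous_discrete_range_constant)
    fix x
    have "1 \<le> norm ((f y - g y) - (f x - g x))" if "f y - g y \<noteq> f x - g x" for y
      using Ints_nonzero_abs_ge1[of "(f y - g y) - (f x - g x)"] Z[of x] Z[of y] that by simp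
    then show "\<exists>e>0. \<forall>y. y \<in> UNIV \<and> f y - g y \<noteq> f x - g x \<longrightarrow> e \<le> norm ((f y - g y) - (f x - g x))"
      by (intro exI[of _ 1]) auto
  qed (use f g in \<open>auto intro: continuous_intros\<close>)
  then obtain y where "\<And>t. f t - g t = y" by (auto simp: constant_on_def)
  then show ?thesis by simp
qed

text \<open>On the contractible line a nowhere vanishing function has a continuous logarithm, purely
  imaginary when the modulus is 1.\<close>

lemma circle_lift:
  fixes F :: "real \<Rightarrow> complex"
  assumes F: "continuous_on UNIV F" "\<And>t. cmod (F t) = 1"
  obtains g where "continuous_on UNIV g" "\<And>t. ecirc (g t) = F t"
proof -
  have "F t \<noteq> 0" for t using F(2)[of t] by auto
  then obtain k where k: "continuous_on UNIV k" "\<And>t. F t = exp (k t)"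
    using continuous_logarithm_on_contractible[OF F(1)] convex_imp_contractible[OF convex_UNIV] by (metis UNIV_I)
  have "Re (k t) = 0" for t using F(2)[of t] k(2)[of t] by simp
  then have "k t = \<i> * complex_of_real (Im (k t))" for t by (simp add: complex_eq_iff)
  then have "F t = cis (Im (k t))" for t using k(2)[of t] by (metis cis_conv_exp)
  then show ?thesis
    by (intro that[of "\<lambda>t. Im (k t) / (2 * pi)"]) (auto simp: ecirc_def intro!: continuous_intros k(1))
qed

text \<open>Identifies the quotient circle with the unit circle of the complex plane; the chosen
  representative is immaterial on cosets of the integers, see
  \<open>circle_map_proj\<close>.\<close>

definition circle_map :: "real set \<Rightarrow> complex" where
  "circle_map C = ecirc (SOME s. s \<in> C)"

lemma circle_map_proj: "circle_map (circle_proj s) = ecirc s"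
proof -
  have "s + of_int 0 \<in> circle_proj s" unfolding circle_proj_def by blast
  then have "(SOME x. x \<in> circle_proj s) \<in> circle_proj s" by (rule someI)
  then obtain n where "(SOME x. x \<in> circle_proj s) = s + of_int n" by (auto simp: circle_proj_def)
  then show ?thesis by (simp add: circle_map_def ecirc_add)
qed

lemma continuous_circle_map: "continuous_map circle euclidean circle_map"
proof -
  have "circle_map \<circ> circle_proj = ecirc" by (auto simp: circle_map_proj)
  moreover have "continuous_on UNIV ecirc" unfolding ecirc_def by (intro continuous_intros)
  ultimately show ?thesis
    unfolding circle_def continuous_compose_quotient_map_eq[OF quotient_map_quotient_topology, symmetric]
    by simp
qed

lemma topspace_circle: "topspace circle = range circle_proj"
  by (simp add: circle_def topspace_quotient_topology)

context uniform_shift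
begin

lemma suspension_proj_eq:
  assumes "\<xi> \<in> Omega m"
  shows "suspension_proj (Omega m) left_shift (\<xi>, t) = range (\<lambda>n::int. (\<lambda>k. \<xi> (k - n), t + of_int n))"
proof (intro equalityI subsetI)
  have it: "int_iterate (Omega m) left_shift n \<omega> = (\<lambda>k. \<omega> (k + n))" if "\<omega> \<in> Omega m" for n \<omega>
    using that int_iterate_shift unfolding Omega_def by blast
  {
    fix x assume "x \<in> suspension_proj (Omega m) left_shift (\<xi>, t)"
    then obtain n \<omega> where x: "\<omega> \<in> Omega m" "\<xi> = (\<lambda>k. \<omega> (k + n))" "x = (\<omega>, t + of_int n)"
      by (auto simp: suspension_proj_def suspension_rel_def it)
    then show "x \<in> range (\<lambda>n::int. (\<lambda>k. \<xi> (k - n), t + of_int n))" by (intro image_eqI[of _ _ n]) auto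
  next
    fix x assume "x \<in> range (\<lambda>n::int. (\<lambda>k. \<xi> (k - n), t + of_int n))"
    then obtain n :: int where x: "x = (\<lambda>k. \<xi> (k - n), t + of_int n)" by auto
    have "(\<lambda>k. \<xi> (k - n)) \<in> Omega m" using assms by (simp add: Omega_iff)
    from it[OF this, of n] this show "x \<in> suspension_proj (Omega m) left_shift (\<xi>, t)"
      by (auto simp: suspension_proj_def suspension_rel_def x intro!: exI[of _ n] exI[of _ "\<lambda>k. \<xi> (k - n)"])
  }
qed

lemma suspension_proj_shift:
  assumes "\<omega> \<in> Omega m"
  shows "suspension_proj (Omega m) left_shift (\<lambda>k. \<omega> (k + 1), t) = suspension_proj (Omega m) left_shift (\<omega>, t + 1)"
proof -
  have "range (\<lambda>n::int. (\<lambda>k. \<omega> (k - n + 1), t + of_int n)) = range (\<lambda>n::int. (\<lambda>k. \<omega> (k - n), t + 1 + of_int n))"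
  proof (intro equalityI subsetI)
    fix x assume "x \<in> range (\<lambda>n::int. (\<lambda>k. \<omega> (k - n + 1), t + of_int n))"
    then obtain n :: int where "x = (\<lambda>k. \<omega> (k - n + 1), t + of_int n)" by auto
    then show "x \<in> range (\<lambda>n::int. (\<lambda>k. \<omega> (k - n), t + 1 + of_int n))"
      by (intro image_eqI[of _ _ "n - 1"]) (auto simp: algebra_simps)
  next
    fix x assume "x \<in> range (\<lambda>n::int. (\<lambda>k. \<omega> (k - n), t + 1 + of_int n))"
    then obtain n :: int where "x = (\<lambda>k. \<omega> (k - n), t + 1 + of_int n)" by auto
    then show "x \<in> range (\<lambda>n::int. (\<lambda>k. \<omega> (k - n + 1), t + of_int n))"
      by (intro image_eqI[of _ _ "n + 1"]) (auto simp: algebra_simps)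
  qed
  then show ?thesis using assms by (simp add: suspension_proj_eq)
qed

lemma suspension_flow_proj:
  assumes "\<omega> \<in> Omega m"
  shows "suspension_flow s (suspension_proj (Omega m) left_shift (\<omega>, t)) = suspension_proj (Omega m) left_shift (\<omega>, s + t)"
  unfolding suspension_proj_eq[OF assms] suspension_flow_def image_image
  by (simp add: add.assoc)

end

section \<open>Winding of a circle-valued map on the suspension\<close>

locale suspension_circle_map = uniform_shift m for m +
  fixes \<phi> :: "((int \<Rightarrow> real) \<times> real) set \<Rightarrow> real set" and \<alpha> :: real
  assumes \<phi>: "continuous_map (suspension (Omega m) left_shift) circle \<phi>"
    and winding: "winding_value (Omega m) left_shift (mu m) \<phi> \<alpha>"
begin

text \<open>\<open>\<phi>\<close> unrolled to \<open>\<Omega> \<times> \<real>\<close> and read in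
  the complex unit circle, where distances and logarithms are at hand.\<close>

definition F :: "(int \<Rightarrow> real) \<times> real \<Rightarrow> complex" where
  "F x = circle_map (\<phi> (suspension_proj (Omega m) left_shift x))"

lemma continuous_F: "continuous_on (Omega m \<times> UNIV) F"
proof -
  have "continuous_map (top_of_set (Omega m \<times> UNIV)) (suspension (Omega m) left_shift) (suspension_proj (Omega m) left_shift)"
    unfolding suspension_def by (rule quotient_imp_continuous_map[OF quotient_map_quotient_topology])
  from continuous_map_compose[OF continuous_map_compose[OF this \<phi>] continuous_circle_map]
  show ?thesis by (simp add: F_def[abs_def] o_def)
qed

lemma \<phi>_range: "\<omega> \<in> Omega m \<Longrightarrow> \<phi> (suspension_proj (Omega m) left_shift (\<omega>, t)) \<in> range circle_proj"
  using continuous_map_image_subset_topspace[OF \<phi>]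
  by (auto simp: topspace_circle suspension_def topspace_quotient_topology image_subset_iff)

lemma norm_F: "\<omega> \<in> Omega m \<Longrightarrow> cmod (F (\<omega>, t)) = 1"
  using \<phi>_range[of \<omega> t] by (auto simp: F_def circle_map_proj)

lemma F_shift: "\<omega> \<in> Omega m \<Longrightarrow> F (\<lambda>k. \<omega> (k + 1), t) = F (\<omega>, t + 1)"
  by (simp add: F_def suspension_proj_shift)

lemma F_shift_nat: "\<omega> \<in> Omega m \<Longrightarrow> F (\<lambda>k. \<omega> (k + int j), t) = F (\<omega>, t + real j)"
proof (induction j arbitrary: t)
  case (Suc j)
  have "F (\<lambda>k. \<omega> (k + int (Suc j)), t) = F (\<lambda>k. \<omega> (k + int j), t + 1)"
    using F_shift[of "\<lambda>k. \<omega> (k + int j)" t] Suc.prems by (simp add: add.assoc)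
  then show ?case using Suc by (simp add: add.assoc)
qed simp

text \<open>Where total disconnectedness enters: agreement on this window keeps the paths within
  chordal distance 1 during one unit of time, the threshold of \<open>ecirc_close\<close>.\<close>

definition W :: int where
  "W = (SOME N. \<forall>\<omega>\<in>Omega m. \<forall>\<omega>'\<in>Omega m. (\<forall>i\<in>window N. \<omega> i = \<omega>' i) \<longrightarrow>
    (\<forall>t\<in>{0..1}. dist (F (\<omega>, t)) (F (\<omega>', t)) < 1))"

lemma W:
  assumes "\<omega> \<in> Omega m" "\<omega>' \<in> Omega m" "\<And>i. i \<in> window W \<Longrightarrow> \<omega> i = \<omega>' i" "t \<in> {0..1}"
  shows "cmod (F (\<omega>, t) - F (\<omega>', t)) < 1"
proof -
  have "continuous_on (Omega m \<times> {0..1}) F" by (rule continuous_on_subset[OF continuous_F]) auto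
  from someI_ex[OF uniform_window[OF this compact_Icc zero_less_one]] show ?thesis
    unfolding W_def[symmetric] using assms by (simp add: dist_norm)
qed

definition base :: "(int \<Rightarrow> real) \<Rightarrow> real" where
  "base \<rho> = (SOME s. s \<in> {0..1} \<and> ecirc s = F (\<rho>, 0))"

lemma lift_exists: "\<omega> \<in> Omega m \<Longrightarrow> \<exists>g. continuous_on UNIV g \<and> (\<forall>t. ecirc (g t) = F (\<omega>, t))"
proof -
  assume \<omega>: "\<omega> \<in> Omega m"
  have "continuous_on UNIV (\<lambda>t. F (\<omega>, t))"
    by (rule continuous_on_compose2[OF continuous_F]) (use \<omega> in \<open>auto intro!: continuous_intros\<close>)
  then obtain g where "continuous_on UNIV g" "\<And>t. ecirc (g t) = F (\<omega>, t)"
    using circle_lift norm_F[OF \<omega>] by metis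
  then show ?thesis by blast
qed

lemma base: assumes "\<rho> \<in> Omega m" shows "base \<rho> \<in> {0..1}" "ecirc (base \<rho>) = F (\<rho>, 0)"
proof -
  obtain g where "\<forall>t. ecirc (g t) = F (\<rho>, t)" using lift_exists[OF assms] by blast
  then have g: "ecirc (g 0) = F (\<rho>, 0)" ..
  have "ecirc (frac (g 0)) = ecirc (g 0)" by (simp add: ecirc_eq_iff frac_def)
  then have "frac (g 0) \<in> {0..1} \<and> ecirc (frac (g 0)) = F (\<rho>, 0)"
    using g frac_lt_1[of "g 0"] by (auto simp: less_imp_le)
  then show "base \<rho> \<in> {0..1}" "ecirc (base \<rho>) = F (\<rho>, 0)"
    unfolding base_def using someI[of "\<lambda>s. s \<in> {0..1} \<and> ecirc s = F (\<rho>, 0)"] by blast+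
qed

text \<open>
  The lift over \<open>\<omega>\<close>, normalised at time zero by a choice that only depends on the
  coordinates in \<open>window W\<close>.
\<close>

definition lift :: "(int \<Rightarrow> real) \<Rightarrow> real \<Rightarrow> real" where
  "lift \<omega> = (SOME g. continuous_on UNIV g \<and> (\<forall>t. ecirc (g t) = F (\<omega>, t)) \<and>
     \<bar>g 0 - base (trunc (window W) \<omega>)\<bar> < 1 / 4)"

lemma lift:
  assumes \<omega>: "\<omega> \<in> Omega m"
  shows "continuous_on UNIV (lift \<omega>)" "ecirc (lift \<omega> t) = F (\<omega>, t)"
    "\<bar>lift \<omega> 0 - base (trunc (window W) \<omega>)\<bar> < 1 / 4"
proof -
  let ?\<rho> = "trunc (window W) \<omega>"
  have \<rho>: "?\<rho> \<in> Omega m" by (rule trunc_Omega[OF \<omega>])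
  obtain g where g: "continuous_on UNIV g" "\<And>t. ecirc (g t) = F (\<omega>, t)" using lift_exists[OF \<omega>] by blast
  have "cmod (F (\<omega>, 0) - F (?\<rho>, 0)) < 1" by (rule W[OF \<omega> \<rho>]) (auto simp: trunc_def)
  then have "cmod (ecirc (g 0) - ecirc (base ?\<rho>)) < 1" by (simp add: g base(2)[OF \<rho>])
  then obtain k :: int where k: "\<bar>g 0 - base ?\<rho> - k\<bar> < 1 / 4" using ecirc_close by blast
  have "ecirc (g t - of_int k) = F (\<omega>, t)" for t
  proof -
    have "ecirc (g t - of_int k) = ecirc (g t)" by (simp add: ecirc_eq_iff)
    then show ?thesis by (simp add: g)
  qed
  moreover have "\<bar>(g 0 - of_int k) - base ?\<rho>\<bar> < 1 / 4" using k by (simp add: algebra_simps)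
  moreover have "continuous_on UNIV (\<lambda>t. g t - of_int k)" by (intro continuous_intros g)
  ultimately have "\<exists>g. continuous_on UNIV g \<and> (\<forall>t. ecirc (g t) = F (\<omega>, t)) \<and> \<bar>g 0 - base ?\<rho>\<bar> < 1 / 4"
    by blast
  from someI_ex[OF this]
  show "continuous_on UNIV (lift \<omega>)" "ecirc (lift \<omega> t) = F (\<omega>, t)"
    "\<bar>lift \<omega> 0 - base (trunc (window W) \<omega>)\<bar> < 1 / 4"
    unfolding lift_def[symmetric] by blast+
qed

text \<open>Following the lift for one unit of time and starting afresh at the shifted point end
  over the same point of the circle; the mismatch is an integer. The renormalisation at each step is
  the coboundary.\<close>

definition turns :: "(int \<Rightarrow> real) \<Rightarrow> real" where
  "turns \<omega> = lift \<omega> 1 - lift (\<lambda>k. \<omega> (k + 1)) 0"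

lemma turns_int:
  assumes "\<omega> \<in> Omega m" shows "turns \<omega> \<in> \<int>"
proof -
  have "ecirc (lift \<omega> 1) = ecirc (lift (\<lambda>k. \<omega> (k + 1)) 0)"
    using assms by (simp add: lift F_shift)
  then show ?thesis by (simp add: turns_def ecirc_eq_iff)
qed

lemma lift_0_close:
  assumes "\<omega> \<in> Omega m" "\<omega>' \<in> Omega m" "\<And>i. i \<in> window W \<Longrightarrow> \<omega> i = \<omega>' i"
  shows "\<bar>lift \<omega> 0 - lift \<omega>' 0\<bar> < 1 / 2"
proof -
  have "trunc (window W) \<omega> = trunc (window W) \<omega>'" using assms(3) by (auto simp: trunc_def)
  then have "base (trunc (window W) \<omega>) = base (trunc (window W) \<omega>')" by simp
  then show ?thesis using lift(3)[OF assms(1)] lift(3)[OF assms(2)] by linarith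
qed

text \<open>The lift at time 1 moves by less than \<open>1 / 4\<close> and the one restarted at the
  shifted point by less than \<open>1 / 2\<close>, so the integers differ by less than 1. The
  shifted point sees one more coordinate, hence \<open>W + 1\<close>.\<close>

lemma turns_depends_on: "depends_on (window (W + 1)) turns"
  unfolding depends_on_def
proof
  fix \<omega> assume \<omega>: "\<omega> \<in> Omega m"
  let ?\<omega>' = "trunc (window (W + 1)) \<omega>"
  have \<omega>': "?\<omega>' \<in> Omega m" by (rule trunc_Omega[OF \<omega>])
  have agree: "\<omega> i = ?\<omega>' i" "\<omega> (i + 1) = ?\<omega>' (i + 1)" if "i \<in> window W" for i
    using that by (auto simp: trunc_def window_def)
  have "\<bar>lift \<omega> 1 - lift ?\<omega>' 1\<bar> < 1 / 4"
  proof (rule near_integers_trapped[of "\<lambda>t. lift \<omega> t - lift ?\<omega>' t"])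
    show "continuous_on {0..1} (\<lambda>t. lift \<omega> t - lift ?\<omega>' t)"
      by (intro continuous_on_diff continuous_on_subset[OF lift(1)] \<omega> \<omega>') auto
    show "\<bar>lift \<omega> 0 - lift ?\<omega>' 0\<bar> < 1 / 2" by (rule lift_0_close[OF \<omega> \<omega>' agree(1)])
    show "\<exists>k::int. \<bar>lift \<omega> t - lift ?\<omega>' t - k\<bar> < 1 / 4" if "t \<in> {0..1}" for t
      by (rule ecirc_close) (use W[OF \<omega> \<omega>' agree(1) that] in \<open>simp add: lift \<omega> \<omega>'\<close>)
  qed
  moreover have "\<bar>lift (\<lambda>k. \<omega> (k + 1)) 0 - lift (\<lambda>k. ?\<omega>' (k + 1)) 0\<bar> < 1 / 2"
    by (rule lift_0_close) (use \<omega> \<omega>' agree(2) in auto)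
  ultimately have "\<bar>turns \<omega> - turns ?\<omega>'\<bar> < 1" unfolding turns_def by linarith
  moreover have "turns \<omega> - turns ?\<omega>' \<in> \<int>" using turns_int[OF \<omega>] turns_int[OF \<omega>'] by simp
  ultimately show "turns \<omega> = turns ?\<omega>'" using Ints_nonzero_abs_less1 by fastforce
qed

lemma turns_integral:
  "has_bochner_integral (mu m) turns ((\<Sum>w\<in>words (window (W + 1)). turns w) / real m ^ card (window (W + 1)))"
  by (rule window_function_integral[OF finite_window turns_depends_on])

lemma turns_bounded: "\<exists>C. \<forall>\<omega>\<in>Omega m. \<bar>turns \<omega>\<bar> \<le> C"
proof (intro exI ballI)
  fix \<omega> assume \<omega>: "\<omega> \<in> Omega m"
  let ?I = "window (W + 1)"
  have "\<bar>turns \<omega>\<bar> = \<bar>turns (trunc ?I \<omega>)\<bar>" using turns_depends_on \<omega> by (simp add: depends_on_def)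
  also have "\<dots> \<le> (\<Sum>w\<in>words ?I. \<bar>turns w\<bar>)"
    by (rule member_le_sum) (use \<omega> finite_words in \<open>auto simp: words_def\<close>)
  finally show "\<bar>turns \<omega>\<bar> \<le> (\<Sum>w\<in>words ?I. \<bar>turns w\<bar>)" .
qed

text \<open>Telescoping: the lift at the shifted point and the translated lift cover the same path
  and differ by a constant, so consecutive increments fit together.\<close>

lemma sum_turns:
  assumes \<omega>: "\<omega> \<in> Omega m"
  shows "(\<Sum>j<n. turns (\<lambda>k. \<omega> (k + int j))) = lift \<omega> (real n) - lift (\<lambda>k. \<omega> (k + int n)) 0"
proof (induction n)
  case (Suc n)
  let ?\<omega>' = "\<lambda>k. \<omega> (k + int n)"
  have \<omega>': "?\<omega>' \<in> Omega m" using \<omega> by simp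
  have "lift ?\<omega>' 1 - lift \<omega> (1 + real n) = lift ?\<omega>' 0 - lift \<omega> (0 + real n)"
  proof (rule integer_difference_constant)
    show "continuous_on UNIV (\<lambda>t. lift \<omega> (t + real n))"
      by (intro continuous_on_compose2[OF lift(1)[OF \<omega>]] continuous_intros) auto
    show "ecirc (lift ?\<omega>' t) = ecirc (lift \<omega> (t + real n))" for t
      using F_shift_nat[OF \<omega>] by (simp add: lift(2)[OF \<omega>] lift(2)[OF \<omega>'])
  qed (rule lift(1)[OF \<omega>'])
  then show ?case using Suc by (simp add: turns_def algebra_simps)
qed simp

lemma lift_0_bounded:
  assumes "\<omega> \<in> Omega m" shows "\<bar>lift \<omega> 0\<bar> \<le> 2"
  using lift(3)[OF assms] base(1)[OF trunc_Omega[OF assms, of "window W"]]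
  unfolding atLeastAtMost_iff by linarith

text \<open>By Fubini almost every \<open>\<omega>\<close> has some starting time \<open>t0\<close>
  at which the limit in \<open>winding_value\<close> holds. Moving back to time 0 translates the
  argument and adds a constant, and neither affects the slope.\<close>

lemma AE_lift_limit: "AE \<omega> in mu m. (\<lambda>n. lift \<omega> (real n) / real n) \<longlonglongrightarrow> \<alpha>"
proof -
  interpret M: prob_space "mu m" by (rule prob_space_mu)
  interpret I: prob_space "restrict_space lborel {0..1 :: real}"
    by (rule prob_space_restrict_space) auto
  interpret P: pair_sigma_finite "mu m" "restrict_space lborel {0..1 :: real}" by standard
  have "AE x in mu m \<Otimes>\<^sub>M restrict_space lborel {0..1}.
      \<exists>g. is_lift \<phi> (suspension_proj (Omega m) left_shift x) g \<and> ((\<lambda>t. g t / t) \<longlongrightarrow> \<alpha>) at_top"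
    using AE_distrD[OF measurable_suspension_proj winding[unfolded winding_value_def suspension_measure_def]] .
  from P.AE_pair[OF this] AE_space show ?thesis
  proof eventually_elim
    case (elim \<omega>)
    have \<omega>: "\<omega> \<in> Omega m" using elim(2) by (simp add: space_mu)
    have "\<exists>t0 g. is_lift \<phi> (suspension_proj (Omega m) left_shift (\<omega>, t0)) g \<and> ((\<lambda>t. g t / t) \<longlongrightarrow> \<alpha>) at_top"
    proof (rule ccontr)
      assume *: "\<not> ?thesis"
      have "AE t in restrict_space lborel {0..1 :: real}. False"
        using elim(1) by eventually_elim (use * in blast)
      then show False by simp
    qed
    then obtain t0 g where g: "is_lift \<phi> (suspension_proj (Omega m) left_shift (\<omega>, t0)) g"
      and lim: "((\<lambda>t. g t / t) \<longlongrightarrow> \<alpha>) at_top" by blast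
    have gF: "ecirc (g t) = F (\<omega>, t + t0)" for t
    proof -
      have "circle_proj (g t) = \<phi> (suspension_proj (Omega m) left_shift (\<omega>, t + t0))"
        using g by (simp add: is_lift_def suspension_flow_proj[OF \<omega>])
      then show ?thesis by (metis F_def circle_map_proj)
    qed
    define c where "c = lift \<omega> t0 - g 0"
    have "lift \<omega> (t + t0) - g t = lift \<omega> (0 + t0) - g 0" for t
    proof (rule integer_difference_constant)
      show "continuous_on UNIV (\<lambda>t. lift \<omega> (t + t0))"
        by (intro continuous_on_compose2[OF lift(1)[OF \<omega>]] continuous_intros) auto
      show "continuous_on UNIV g" using g by (simp add: is_lift_def)
      show "ecirc (lift \<omega> (t + t0)) = ecirc (g t)" for t by (simp add: gF lift(2)[OF \<omega>])
    qed
    from this[of "_ - t0"] have gl: "lift \<omega> t = g (t - t0) + c" for t by (simp add: c_def algebra_simps)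
    have "filterlim (\<lambda>n. real n - t0) at_top sequentially"
      using filterlim_tendsto_add_at_top[OF tendsto_const[of "- t0"] filterlim_real_sequentially]
      by (simp add: add.commute)
    then have "(\<lambda>n. g (real n - t0) / (real n - t0)) \<longlonglongrightarrow> \<alpha>"
      by (rule filterlim_compose[OF lim])
    moreover have "(\<lambda>n. 1 - t0 / real n) \<longlonglongrightarrow> 1 - 0"
      by (intro tendsto_diff tendsto_const lim_const_over_n)
    moreover have "(\<lambda>n. c / real n) \<longlonglongrightarrow> 0" by (rule lim_const_over_n)
    ultimately have "(\<lambda>n. g (real n - t0) / (real n - t0) * (1 - t0 / real n) + c / real n) \<longlonglongrightarrow> \<alpha> * (1 - 0) + 0"
      by (intro tendsto_add tendsto_mult)
    then have "(\<lambda>n. g (real n - t0) / (real n - t0) * (1 - t0 / real n) + c / real n) \<longlonglongrightarrow> \<alpha>" by simp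
    moreover have "\<forall>\<^sub>F n in sequentially. g (real n - t0) / (real n - t0) * (1 - t0 / real n) + c / real n
        = lift \<omega> (real n) / real n"
    proof -
      have "\<forall>\<^sub>F n in sequentially. real n > max 0 t0"
        by (rule eventually_compose_filterlim[OF eventually_gt_at_top filterlim_real_sequentially])
      then show ?thesis by eventually_elim (auto simp: gl field_simps)
    qed
    ultimately show ?case by (rule Lim_transform_eventually)
  qed
qed

text \<open>The averages of \<open>turns\<close> along the orbit converge almost surely to the slope
  \<open>\<alpha>\<close>, while shift invariance gives each of them the same integral; dominated
  convergence identifies the two.\<close>

lemma winding_eq_integral: "\<alpha> = (\<integral>\<omega>. turns \<omega> \<partial>mu m)"
proof -
  interpret M: prob_space "mu m" by (rule prob_space_mu)
  have tm: "turns \<in> borel_measurable (mu m)"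
    by (rule borel_measurable_has_bochner_integral[OF turns_integral])
  have ti: "integrable (mu m) turns" using turns_integral has_bochner_integral_iff by blast
  obtain C where C: "\<And>\<omega>. \<omega> \<in> Omega m \<Longrightarrow> \<bar>turns \<omega>\<bar> \<le> C" using turns_bounded by blast
  define s where "s n \<omega> = (\<Sum>j<n. turns (\<lambda>k. \<omega> (k + int j))) / real n" for n \<omega>
  have shift_m: "(\<lambda>\<omega>. turns (\<lambda>k. \<omega> (k + int j))) \<in> borel_measurable (mu m)" for j
    using measurable_compose[OF measurable_shift tm] .
  have shift_i: "integrable (mu m) (\<lambda>\<omega>. turns (\<lambda>k. \<omega> (k + int j)))" for j
    by (rule M.integrable_const_bound[where B = C]) (use shift_m C in \<open>auto simp: space_mu\<close>)
  have sm: "s n \<in> borel_measurable (mu m)" for n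
    unfolding s_def[abs_def] using shift_m by measurable
  have "(\<lambda>n. \<integral>\<omega>. s n \<omega> \<partial>mu m) \<longlonglongrightarrow> (\<integral>\<omega>. \<alpha> \<partial>mu m)"
  proof (rule integral_dominated_convergence[where w = "\<lambda>_. C"])
    show "AE \<omega> in mu m. (\<lambda>n. s n \<omega>) \<longlonglongrightarrow> \<alpha>"
      using AE_lift_limit AE_space
    proof eventually_elim
      case (elim \<omega>)
      have \<omega>: "\<omega> \<in> Omega m" using elim(2) by (simp add: space_mu)
      have "(\<lambda>n. lift (\<lambda>k. \<omega> (k + int n)) 0 / real n) \<longlonglongrightarrow> 0"
      proof (rule Lim_null_comparison)
        show "\<forall>\<^sub>F n in sequentially. norm (lift (\<lambda>k. \<omega> (k + int n)) 0 / real n) \<le> 2 / real n"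
          using \<omega> by (intro always_eventually allI) (auto intro!: divide_right_mono lift_0_bounded)
      qed (rule lim_const_over_n)
      from tendsto_diff[OF elim(1) this] show ?case
        by (simp add: s_def sum_turns[OF \<omega>] diff_divide_distrib)
    qed
    show "AE \<omega> in mu m. norm (s n \<omega>) \<le> C" for n
    proof (rule AE_I2)
      fix \<omega> assume "\<omega> \<in> space (mu m)"
      then have \<omega>: "\<omega> \<in> Omega m" by (simp add: space_mu)
      have C0: "0 \<le> C" using C[OF \<omega>] by linarith
      have "\<bar>\<Sum>j<n. turns (\<lambda>k. \<omega> (k + int j))\<bar> \<le> (\<Sum>j<n. C)"
        by (rule order_trans[OF sum_abs sum_mono]) (use \<omega> in \<open>auto intro: C\<close>)
      then show "norm (s n \<omega>) \<le> C"
        using C0 by (cases "n = 0") (auto simp: s_def field_simps)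
    qed
  qed (use sm in auto)
  moreover have "(\<integral>\<omega>. s n \<omega> \<partial>mu m) = (\<integral>\<omega>. turns \<omega> \<partial>mu m)" if "n > 0" for n
    unfolding s_def using that integral_mu_shift[OF tm] shift_i
    by (simp add: Bochner_Integration.integral_sum)
  then have "\<forall>\<^sub>F n in sequentially. (\<integral>\<omega>. s n \<omega> \<partial>mu m) = (\<integral>\<omega>. turns \<omega> \<partial>mu m)"
    by (auto simp: eventually_sequentially intro!: exI[of _ 1])
  then have "(\<lambda>n. \<integral>\<omega>. s n \<omega> \<partial>mu m) \<longlonglongrightarrow> (\<integral>\<omega>. turns \<omega> \<partial>mu m)"
    by (rule tendsto_eventually)
  ultimately have "(\<integral>\<omega>. \<alpha> \<partial>mu m) = (\<integral>\<omega>. turns \<omega> \<partial>mu m)" by (rule LIMSEQ_unique)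
  then show ?thesis by (simp add: M.prob_space)
qed

lemma winding_value_eq: "\<exists>j k. \<alpha> = of_int j / real m ^ k"
proof -
  let ?I = "window (W + 1)"
  have "\<alpha> = (\<Sum>w\<in>words ?I. turns w) / real m ^ card ?I"
    using winding_eq_integral has_bochner_integral_integral_eq[OF turns_integral] by simp
  moreover have "(\<Sum>w\<in>words ?I. turns w) \<in> \<int>"
    by (intro Ints_sum turns_int words_Omega)
  then obtain z where "(\<Sum>w\<in>words ?I. turns w) = of_int z" by (rule Ints_cases)
  ultimately show ?thesis by metis
qed

end

context uniform_shift
begin

text \<open>Every assertion about labels is universal, so it may be proved for this explicit
  countable set instead.\<close>

lemma schwartzman0_subset:
  "schwartzman0 (Omega m) left_shift (mu m) \<subseteq> {real j / real m ^ k | j k. 0 < j \<and> j < m ^ k}"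
proof
  fix \<alpha> assume "\<alpha> \<in> schwartzman0 (Omega m) left_shift (mu m)"
  then obtain \<phi> where \<phi>: "continuous_map (suspension (Omega m) left_shift) circle \<phi>"
    "winding_value (Omega m) left_shift (mu m) \<phi> \<alpha>" and \<alpha>: "0 < \<alpha>" "\<alpha> < 1"
    by (auto simp: schwartzman0_def schwartzman_def)
  interpret suspension_circle_map m \<phi> \<alpha> by standard fact+
  obtain j k where jk: "\<alpha> = of_int j / real m ^ k" using winding_value_eq by blast
  have mk: "real m ^ k > 0" using m by simp
  have "0 < j" using \<alpha>(1) mk by (simp add: jk zero_less_divide_iff)
  moreover have "real_of_int j < real m ^ k" using \<alpha>(2) mk by (simp add: jk)
  then have "j < int (m ^ k)" by (metis of_int_less_iff of_int_of_nat_eq of_nat_power)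
  ultimately show "\<alpha> \<in> {real j / real m ^ k | j k. 0 < j \<and> j < m ^ k}"
    using jk by (intro CollectI exI[of _ "nat j"] exI[of _ k]) (auto simp: nat_less_iff)
qed

end

section \<open>Generic potentials\<close>

lemma inj_perturbation:
  fixes f :: "'a \<Rightarrow> real"
  assumes "finite A" "e > 0"
  shows "\<exists>v. inj_on v A \<and> (\<forall>a\<in>A. \<bar>v a - f a\<bar> < e)"
  using assms(1)
proof induction
  case (insert a A)
  then obtain v where v: "inj_on v A" "\<forall>a\<in>A. \<bar>v a - f a\<bar> < e" by blast
  have "infinite ({f a - e<..<f a + e} - v ` A)"
    using insert.hyps(1) \<open>e > 0\<close> by (intro Diff_infinite_finite) (auto simp: infinite_Ioo)
  then obtain y where "y \<in> {f a - e<..<f a + e}" "y \<notin> v ` A" by (metis Diff_iff finite.emptyI ex_in_conv)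
  then show ?case
    using v insert.hyps(2) by (intro exI[of _ "v(a := y)"]) (auto simp: inj_on_def)
qed simp

text \<open>\<open>x\<close> and \<open>y\<close> are the \<open>j\<close>-th smallest element and
  its successor; the bounds on \<open>j\<close> make both exist.\<close>

lemma finite_set_threshold:
  fixes V :: "real set"
  assumes V: "finite V" and j: "0 < j" "j < card V"
  obtains x y where "x < y" "\<And>z. z \<in> V \<Longrightarrow> z \<le> x \<or> y \<le> z" "card {z \<in> V. z \<le> x} = j"
proof -
  define xs where "xs = sorted_list_of_set V"
  have xs: "set xs = V" "distinct xs" "length xs = card V" "sorted_wrt (<) xs"
    using V by (auto simp: xs_def)
  have mono: "xs ! i < xs ! k \<longleftrightarrow> i < k" if "i < card V" "k < card V" for i k
    using sorted_wrt_nth_less[OF xs(4)] that xs(3) by (metis less_asym linorder_neqE_nat less_irrefl)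
  have le: "xs ! i \<le> xs ! k \<longleftrightarrow> i \<le> k" if "i < card V" "k < card V" for i k
    using mono[OF that(2,1)] by (auto simp: not_less[symmetric])
  have V_eq: "V = (\<lambda>i. xs ! i) ` {..<card V}"
    using xs by (auto simp: set_conv_nth)
  have "{z \<in> V. z \<le> xs ! (j - 1)} = (\<lambda>i. xs ! i) ` {..<j}"
    using j by (subst V_eq) (auto simp: le image_iff intro!: bexI)
  moreover have "inj_on (\<lambda>i. xs ! i) {..<j}"
    using xs(2,3) j by (auto simp: inj_on_def nth_eq_iff_index_eq)
  ultimately have "card {z \<in> V. z \<le> xs ! (j - 1)} = j" by (simp add: card_image)
  moreover have "xs ! (j - 1) < xs ! j" using j by (simp add: mono)
  moreover have "z \<le> xs ! (j - 1) \<or> xs ! j \<le> z" if zV: "z \<in> V" for z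
  proof -
    obtain i where "i < card V" "z = xs ! i" using zV xs(1,3) by (metis in_set_conv_nth)
    then show ?thesis using j by (auto simp: le)
  qed
  ultimately show ?thesis using that by blast
qed

section \<open>A dense open set of potentials for each label\<close>

context uniform_shift
begin

lemma const_cfun: "(\<lambda>\<omega>\<in>Omega m. c) \<in> cfun (Omega m)"
  unfolding cfun_iff by (auto intro: continuous_on_eq[OF continuous_on_const])

lemma scale_cfun: "q \<in> cfun (Omega m) \<Longrightarrow> (\<lambda>\<omega>\<in>Omega m. c * q \<omega>) \<in> cfun (Omega m)"
  unfolding cfun_iff by (auto intro!: continuous_on_eq[OF continuous_on_mult_left[of _ q c]])

lemma open_gap_cfun:
  assumes q: "q \<in> cfun (Omega m)"
    and "\<And>\<omega>. \<omega> \<in> Omega m \<Longrightarrow> q \<omega> \<le> x \<or> y \<le> q \<omega>" "0 \<le> c" "x + 2 * c < y - 2 * c"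
    and "measure (mu m) {\<omega> \<in> Omega m. q \<omega> \<le> x} = l" "0 < l" "l < 1"
  shows "has_open_gap (Omega m) left_shift (mu m) q (\<lambda>\<omega>\<in>Omega m. c) l"
proof -
  have cont: "continuous_on (Omega m) q" using q by (simp add: cfun_iff)
  obtain R where "\<And>\<omega>. \<omega> \<in> Omega m \<Longrightarrow> \<bar>q \<omega>\<bar> \<le> R"
    using compact_imp_bounded[OF compact_continuous_image[OF cont compact_Omega]]
    by (auto simp: bounded_iff)
  then interpret shift_potential m q R by unfold_locales (auto intro: cont)
  show ?thesis by (rule open_gap) fact+
qed

text \<open>The gap condition of the diagonal operator expressed by \<open>q\<close> alone, so that
  the hopping plays no part in the category argument.\<close>

definition gapped :: "real \<Rightarrow> ((int \<Rightarrow> real) \<Rightarrow> real) set" where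
  "gapped l = {q \<in> cfun (Omega m). \<exists>x y. x < y \<and> (\<forall>\<omega>\<in>Omega m. q \<omega> \<le> x \<or> y \<le> q \<omega>) \<and>
     measure (mu m) {\<omega> \<in> Omega m. q \<omega> \<le> x} = l}"

lemma gapped_OG_diag:
  assumes "q \<in> gapped l" "0 < l" "l < 1" shows "q \<in> OG_diag (Omega m) left_shift (mu m) l"
proof -
  obtain x y where q: "q \<in> cfun (Omega m)" "x < y" "\<And>\<omega>. \<omega> \<in> Omega m \<Longrightarrow> q \<omega> \<le> x \<or> y \<le> q \<omega>"
    "measure (mu m) {\<omega> \<in> Omega m. q \<omega> \<le> x} = l"
    using assms(1) by (auto simp: gapped_def)
  have "has_open_gap (Omega m) left_shift (mu m) q (\<lambda>\<omega>\<in>Omega m. 0) l"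
    by (rule open_gap_cfun[of q x y]) (use q assms in auto)
  then show ?thesis
    using q(1) const_cfun[of 0] by (simp add: OG_diag_def OG_Jacobi_def cfun_nonneg_def)
qed

lemma gapped_OG_Schr:
  assumes "q \<in> gapped l" "0 < l" "l < 1"
  shows "\<exists>c0. \<forall>c\<ge>c0. (\<lambda>\<omega>\<in>Omega m. c * q \<omega>) \<in> OG_Schr (Omega m) left_shift (mu m) l"
proof -
  obtain x y where q: "q \<in> cfun (Omega m)" "x < y" "\<And>\<omega>. \<omega> \<in> Omega m \<Longrightarrow> q \<omega> \<le> x \<or> y \<le> q \<omega>"
    "measure (mu m) {\<omega> \<in> Omega m. q \<omega> \<le> x} = l"
    using assms(1) by (auto simp: gapped_def)
  \<comment> \<open>Hopping 1 takes away 2 at each end of the scaled gap of length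
    \<open>c (y - x)\<close>; any constant above 4 would do in place of 5.\<close>
  have "(\<lambda>\<omega>\<in>Omega m. c * q \<omega>) \<in> OG_Schr (Omega m) left_shift (mu m) l" if c: "c \<ge> 5 / (y - x)" for c
  proof -
    have "0 < 5 / (y - x)" using q(2) by simp
    then have "c > 0" using c by linarith
    let ?q = "\<lambda>\<omega>\<in>Omega m. c * q \<omega>"
    have "5 \<le> c * (y - x)" using c q(2) by (simp add: field_simps)
    then have "c * x + 2 * 1 < c * y - 2 * 1" by (simp add: algebra_simps)
    moreover have "{\<omega> \<in> Omega m. ?q \<omega> \<le> c * x} = {\<omega> \<in> Omega m. q \<omega> \<le> x}"
      using \<open>c > 0\<close> by auto
    ultimately have "has_open_gap (Omega m) left_shift (mu m) ?q (\<lambda>\<omega>\<in>Omega m. 1) l"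
      using q assms \<open>c > 0\<close> by (intro open_gap_cfun[of ?q "c * x" "c * y"] scale_cfun) auto
    then show ?thesis
      using scale_cfun[OF q(1)] const_cfun[of 1] by (simp add: OG_Schr_def OG_Jacobi_def cfun_nonneg_def)
  qed
  then show ?thesis by blast
qed

sublocale C: Metric_space "cfun (Omega m)" "mdist (cfun_metric (Omega m))"
  by (rule Metric_space_mspace_mdist)

lemma mtopology_cfun: "mtopology_of (cfun_metric (Omega m)) = C.mtopology"
  by (simp add: mtopology_of_def)

lemma mdist_cfun_le_iff:
  assumes "q \<in> cfun (Omega m)" "q' \<in> cfun (Omega m)"
  shows "mdist (cfun_metric (Omega m)) q q' \<le> a \<longleftrightarrow> (\<forall>\<omega>\<in>Omega m. \<bar>q \<omega> - q' \<omega>\<bar> \<le> a)"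
  using cfunspace_mdist_le[of q "top_of_set (Omega m)" euclidean_metric q' a] assms Omega_nonempty
  unfolding cfun_metric_def by (simp add: dist_real_def)

lemma mcomplete_cfun: "C.mcomplete"
proof -
  have "Met_TC.mcomplete TYPE(real)" by (simp add: complete_UNIV)
  from Met_TC.mcomplete_cfunspace[OF this, of "top_of_set (Omega m)"]
  show ?thesis by (simp add: cfun_metric_def euclidean_metric_def Met_TC.Self_def mcomplete_of_def)
qed

lemma openin_gapped: "openin C.mtopology (gapped l)"
  unfolding C.openin_mtopology
proof (intro conjI allI impI)
  show "gapped l \<subseteq> cfun (Omega m)" by (auto simp: gapped_def)
  fix q assume "q \<in> gapped l"
  then obtain x y where q: "q \<in> cfun (Omega m)" "x < y" "\<And>\<omega>. \<omega> \<in> Omega m \<Longrightarrow> q \<omega> \<le> x \<or> y \<le> q \<omega>"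
    "measure (mu m) {\<omega> \<in> Omega m. q \<omega> \<le> x} = l"
    by (auto simp: gapped_def)
  \<comment> \<open>If values move by at most a third of the gap, a gap of width \<open>r\<close>
    survives and no value changes sides, so the label is preserved exactly.\<close>
  define r where "r = (y - x) / 3"
  have "C.mball q r \<subseteq> gapped l"
  proof
    fix q' assume "q' \<in> C.mball q r"
    then have q': "q' \<in> cfun (Omega m)" "mdist (cfun_metric (Omega m)) q q' \<le> r" by auto
    then have close: "\<bar>q \<omega> - q' \<omega>\<bar> \<le> r" if "\<omega> \<in> Omega m" for \<omega>
      using mdist_cfun_le_iff[OF q(1)] that by blast
    have r: "x + r < y - r" "r > 0" using q(2) by (auto simp: r_def field_simps)
    have "q' \<omega> \<le> x + r \<or> y - r \<le> q' \<omega>" if "\<omega> \<in> Omega m" for \<omega>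
      using q(3)[OF that] close[OF that] by linarith
    moreover have "q' \<omega> \<le> x + r \<longleftrightarrow> q \<omega> \<le> x" if "\<omega> \<in> Omega m" for \<omega>
      using q(3)[OF that] close[OF that] r by linarith
    then have "{\<omega> \<in> Omega m. q' \<omega> \<le> x + r} = {\<omega> \<in> Omega m. q \<omega> \<le> x}" by blast
    ultimately show "q' \<in> gapped l"
      using r q' q(4) unfolding gapped_def by (intro CollectI conjI exI[of _ "x + r"] exI[of _ "y - r"]) auto
  qed
  then show "\<exists>r>0. C.mball q r \<subseteq> gapped l" using q(2) by (intro exI[of _ r]) (auto simp: r_def)
qed

lemma trunc_trunc [simp]: "trunc I (trunc I \<omega>) = trunc I \<omega>"
  by (simp add: trunc_def fun_eq_iff)

text \<open>All words on \<open>I\<close> are equally likely. Once the potential separates them, a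
  threshold can cut off any prescribed number of words and thus realise the label.\<close>

lemma gapped_dense:
  assumes j: "0 < j" "j < m ^ k" and q: "q \<in> cfun (Omega m)" and r: "r > 0"
  shows "\<exists>q'\<in>gapped (real j / real m ^ k). mdist (cfun_metric (Omega m)) q q' < r"
proof -
  have "continuous_on (Omega m) q" using q by (simp add: cfun_iff)
  then obtain N0 where N0: "\<And>\<omega> \<omega>'. \<omega> \<in> Omega m \<Longrightarrow> \<omega>' \<in> Omega m \<Longrightarrow> \<forall>i\<in>window N0. \<omega> i = \<omega>' i \<Longrightarrow> \<bar>q \<omega> - q \<omega>'\<bar> < r / 4"
    using uniform_window_cfun[of m q "r / 4"] r by (auto simp del: zero_less_divide_iff)
  \<comment> \<open>Having at least \<open>k\<close> coordinates turns \<open>j / m ^ k\<close> into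
    the fraction \<open>j' / m ^ card I\<close> with an integer numerator; \<open>N0\<close>
    controls the loss from truncation.\<close>
  define I where "I = window (max N0 (int k))"
  have I: "finite I" "window N0 \<subseteq> I" "k \<le> card I" by (auto simp: I_def window_def)
  obtain v where v: "inj_on v (words I)" "\<And>w. w \<in> words I \<Longrightarrow> \<bar>v w - q w\<bar> < r / 4"
    using inj_perturbation[OF finite_words[OF I(1)], of "r / 4" q] r by auto
  define q' where "q' = (\<lambda>\<omega>\<in>Omega m. v (trunc I \<omega>))"
  have "continuous_on (Omega m) (\<lambda>\<omega>. v (trunc I \<omega>))"
  proof (rule continuous_on_compose2[where g = v and f = "trunc I"])
    show "continuous_on (words I) v" by (rule continuous_on_finite[OF finite_words[OF I(1)]])
    show "continuous_on (Omega m) (trunc I)"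
      unfolding trunc_def[abs_def]
    proof (rule continuous_on_coordinatewise_then_product)
      show "continuous_on (Omega m) (\<lambda>\<omega>. if i \<in> I then \<omega> i else 0)" for i
        using continuous_on_subset[OF continuous_on_product_coordinates subset_UNIV]
        by (cases "i \<in> I") simp_all
    qed
  qed (simp add: words_def)
  then have q': "q' \<in> cfun (Omega m)"
    unfolding cfun_iff q'_def by (auto intro: continuous_on_eq)
  have "\<bar>q \<omega> - q' \<omega>\<bar> \<le> r / 2" if \<omega>: "\<omega> \<in> Omega m" for \<omega>
  proof -
    have "trunc I \<omega> \<in> words I" using \<omega> by (simp add: words_def)
    moreover have "\<bar>q \<omega> - q (trunc I \<omega>)\<bar> < r / 4"
      by (rule N0[OF \<omega> trunc_Omega[OF \<omega>]]) (use I(2) in \<open>auto simp: trunc_def\<close>)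
    moreover have "q' \<omega> = v (trunc I \<omega>)" using \<omega> by (simp add: q'_def)
    ultimately show ?thesis using v(2)[of "trunc I \<omega>"] by linarith
  qed
  then have "mdist (cfun_metric (Omega m)) q q' \<le> r / 2" using mdist_cfun_le_iff[OF q q'] by blast
  then have close: "mdist (cfun_metric (Omega m)) q q' < r" using r by simp
  define j' where "j' = j * m ^ (card I - k)"
  have mk: "m ^ card I = m ^ k * m ^ (card I - k)" using I(3) by (simp add: power_add[symmetric])
  have card: "card (v ` words I) = m ^ card I" using v(1) I(1) by (simp add: card_image card_words)
  have j': "0 < j'" "j' < card (v ` words I)" using j m unfolding card mk by (auto simp: j'_def)
  obtain x y where xy: "x < y" "\<And>z. z \<in> v ` words I \<Longrightarrow> z \<le> x \<or> y \<le> z" "card {z \<in> v ` words I. z \<le> x} = j'"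
    using finite_set_threshold[OF finite_imageI[OF finite_words[OF I(1)]] j'] by metis
  have "measure (mu m) {\<omega> \<in> Omega m. v (trunc I \<omega>) \<le> x} = real (card {w \<in> words I. v (trunc I w) \<le> x}) / real m ^ card I"
    by (rule window_measure[OF I(1)]) (simp add: depends_on_def)
  also have "{w \<in> words I. v (trunc I w) \<le> x} = {w \<in> words I. v w \<le> x}"
    using trunc_words by auto
  also have "card {w \<in> words I. v w \<le> x} = card (v ` {w \<in> words I. v w \<le> x})"
    using v(1) by (intro card_image[symmetric]) (auto intro: inj_on_subset)
  also have "v ` {w \<in> words I. v w \<le> x} = {z \<in> v ` words I. z \<le> x}" by auto
  also have "real (card \<dots>) / real m ^ card I = real j / real m ^ k"
    using m unfolding xy(3) j'_def of_nat_power[symmetric] mk by simp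
  also have "{\<omega> \<in> Omega m. v (trunc I \<omega>) \<le> x} = {\<omega> \<in> Omega m. q' \<omega> \<le> x}" by (auto simp: q'_def)
  finally have "measure (mu m) {\<omega> \<in> Omega m. q' \<omega> \<le> x} = real j / real m ^ k" .
  moreover have "\<forall>\<omega>\<in>Omega m. q' \<omega> \<le> x \<or> y \<le> q' \<omega>"
    using xy(2) by (auto simp: q'_def words_def)
  ultimately have "q' \<in> gapped (real j / real m ^ k)" using xy(1) q' by (auto simp: gapped_def)
  then show ?thesis using close by blast
qed

definition labels :: "real set" where
  "labels = {real j / real m ^ k | j k. 0 < j \<and> j < m ^ k}"

definition generic :: "((int \<Rightarrow> real) \<Rightarrow> real) set" where
  "generic = cfun (Omega m) \<inter> (\<Inter>l\<in>labels. gapped l)"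

lemma countable_labels: "countable labels"
proof -
  have "labels \<subseteq> (\<lambda>(j, k). real j / real m ^ k) ` UNIV" by (auto simp: labels_def)
  then show ?thesis by (rule countable_subset) (rule countable_image, rule countableI_type)
qed

text \<open>The whole space joins the family so that the intersection is taken over a nonempty one
  even for \<open>m = 1\<close>, when there are no labels.\<close>

lemma generic_eq: "generic = \<Inter>(insert (cfun (Omega m)) (gapped ` labels))"
  by (auto simp: generic_def)

lemma gdelta_generic: "gdelta_in C.mtopology generic"
  unfolding generic_eq
proof (rule gdelta_in_Inter)
  fix T assume "T \<in> insert (cfun (Omega m)) (gapped ` labels)"
  then show "gdelta_in C.mtopology T"
    using gdelta_in_topspace[of C.mtopology] open_imp_gdelta_in[OF openin_gapped]
    unfolding C.topspace_mtopology by blast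
qed (auto simp: countable_labels)

lemma dense_generic: "C.mtopology closure_of generic = cfun (Omega m)"
  unfolding generic_eq
proof (rule C.metric_Baire_category[OF mcomplete_cfun])
  fix T assume "T \<in> insert (cfun (Omega m)) (gapped ` labels)"
  then consider "T = cfun (Omega m)" | l where "l \<in> labels" "T = gapped l" by blast
  then show "openin C.mtopology T \<and> C.mtopology closure_of T = cfun (Omega m)"
  proof cases
    case 1
    then show ?thesis by (metis C.topspace_mtopology closure_of_topspace openin_topspace)
  next
    case 2
    then obtain j k where jk: "l = real j / real m ^ k" "0 < j" "j < m ^ k" by (auto simp: labels_def)
    have "\<exists>q'\<in>T. q' \<in> C.mball q r" if q: "q \<in> cfun (Omega m)" and r: "r > 0" for q r
    proof -
      obtain q' where "q' \<in> T" "mdist (cfun_metric (Omega m)) q q' < r"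
        using gapped_dense[OF jk(2,3) q r] unfolding 2 jk(1) by blast
      then show ?thesis using q by (intro bexI[of _ q']) (auto simp: 2 gapped_def)
    qed
    then show ?thesis using openin_gapped by (auto simp: C.metric_closure_of 2)
  qed
qed (simp add: countable_labels)

lemma generic_nonempty: "generic \<noteq> {}"
  using dense_generic const_cfun[of 0] by fastforce

end

theorem theorem1p7:
  fixes m :: nat
  assumes "m > 0"
  shows
    "(\<exists>G. G \<subseteq> cfun (Omega m)
        \<and> gdelta_in (mtopology_of (cfun_metric (Omega m))) G
        \<and> mtopology_of (cfun_metric (Omega m)) closure_of G = cfun (Omega m)
        \<and> (\<forall>q\<in>G. \<forall>l\<in>schwartzman0 (Omega m) left_shift (mu m).
              \<exists>c\<^sub>0::real. \<forall>c\<ge>c\<^sub>0.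
                (\<lambda>\<omega>\<in>Omega m. c * q \<omega>) \<in> OG_Schr (Omega m) left_shift (mu m) l))
     \<and> (\<forall>l\<in>schwartzman0 (Omega m) left_shift (mu m). OG_Schr (Omega m) left_shift (mu m) l \<noteq> {})
     \<and> AGO_diag (Omega m) left_shift (mu m) \<noteq> {}
     \<and> AGO_Jacobi (Omega m) left_shift (mu m) \<noteq> {}"
proof -
  interpret uniform_shift m by standard (rule assms)
  let ?S0 = "schwartzman0 (Omega m) left_shift (mu m)"
  have l: "l \<in> labels" "0 < l" "l < 1" if "l \<in> ?S0" for l
    using that schwartzman0_subset by (auto simp: labels_def schwartzman0_def)
  have gapped: "q \<in> gapped l" if "q \<in> generic" "l \<in> ?S0" for q l
    using that l by (auto simp: generic_def)
  have schr: "\<exists>c\<^sub>0::real. \<forall>c\<ge>c\<^sub>0. (\<lambda>\<omega>\<in>Omega m. c * q \<omega>) \<in> OG_Schr (Omega m) left_shift (mu m) l"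
    if "q \<in> generic" "l \<in> ?S0" for q l
    by (rule gapped_OG_Schr) (use that gapped l in auto)
  obtain q where q: "q \<in> generic" "q \<in> cfun (Omega m)"
    using generic_nonempty by (auto simp: generic_def)
  have diag: "q \<in> OG_diag (Omega m) left_shift (mu m) l" if "l \<in> ?S0" for l
    by (rule gapped_OG_diag) (use that gapped q l in auto)
  show ?thesis
  proof (intro conjI)
    show "\<exists>G. G \<subseteq> cfun (Omega m)
        \<and> gdelta_in (mtopology_of (cfun_metric (Omega m))) G
        \<and> mtopology_of (cfun_metric (Omega m)) closure_of G = cfun (Omega m)
        \<and> (\<forall>q\<in>G. \<forall>l\<in>?S0. \<exists>c\<^sub>0::real. \<forall>c\<ge>c\<^sub>0.
                (\<lambda>\<omega>\<in>Omega m. c * q \<omega>) \<in> OG_Schr (Omega m) left_shift (mu m) l)"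
      unfolding mtopology_cfun
      using gdelta_generic dense_generic schr by (intro exI[of _ generic]) (auto simp: generic_def)
    show "\<forall>l\<in>?S0. OG_Schr (Omega m) left_shift (mu m) l \<noteq> {}"
      using schr[OF q(1)] by blast
    have "q \<in> AGO_diag (Omega m) left_shift (mu m)"
      using q diag by (auto simp: AGO_diag_def)
    then show "AGO_diag (Omega m) left_shift (mu m) \<noteq> {}" by blast
    have "(q, \<lambda>\<omega>\<in>Omega m. 0) \<in> AGO_Jacobi (Omega m) left_shift (mu m)"
      using q diag const_cfun[of 0] by (auto simp: AGO_Jacobi_def OG_diag_def cfun_nonneg_def)
    then show "AGO_Jacobi (Omega m) left_shift (mu m) \<noteq> {}" by blast
  qed
qed

end
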